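(* Let $\alpha\ge-\frac12$, $0<\beta<d_\alpha$, $\gamma>0$, $1<p<\infty$, and let $s,t$ satisfy $\frac{d_\alpha}{d_\alpha+\gamma-\beta}<s\le t<\frac{d_\alpha}{d_\alpha-\beta}$ and $1\le s\le t$. Let $\phi:\mathbb{R}^+\to\mathbb{R}^+$ be measurable, with $\phi$ almost decreasing and $r\mapsto r^{d_\alpha/p}\phi(r)$ almost increasing, and suppose that for some $\nu<-\beta$ and some constant $C_0>0$, $\phi(r)\le C_0r^\nu$ for every $r>0$. Then there is a constant $C>0$ such that for all $f\in L^{p,\phi}(\mathbb{R},d\mu_\alpha)$, $$\|I_{\beta,\gamma}^\alpha f\|_{L^{q,\psi}(\mathbb{R},d\mu_\alpha)}\le C\,\|K_{\beta,\gamma}^\alpha\|_{L^{s,t}(\mathbb{R},d\mu_\alpha)}\,\|f\|_{L^{p,\phi}(\mathbb{R},d\mu_\alpha)},$$ where $q=\frac{\nu t'p}{\nu t'+d_\alpha}$ with $\frac1t+\frac1{t'}=1$ (read as $q=p$ when $t=1$, $t'=\infty$), and $\psi(r)=(\phi(r))^{p/q}$.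
   Context: Notation: $\mathbb{R}^+=(0,\infty)$; $\alpha\ge-\frac12$ is a fixed real number; $d_\alpha=2\alpha+2$; $d\mu_\alpha(x)=A_\alpha|x|^{2\alpha+1}dx$ on $\mathbb{R}$ with $A_\alpha=(2^{\alpha+1}\Gamma(\alpha+1))^{-1}$; $B(0,r)=(-r,r)$. Dunkl translation: for $x,y\in\mathbb{R}$ and $\theta\in[0,\pi]$ put $(x,y)_\theta=\sqrt{x^2+y^2-2xy\cos\theta}$. For a function $g$ on $\mathbb{R}$ (continuous, or locally integrable with respect to $\mu_\alpha$, in which case the formula is understood for almost every $y$), $$\tau_x^\alpha g(y)=\frac{c_\alpha}{2}\int_0^\pi\Big\{g((x,y)_\theta)+g(-(x,y)_\theta)+\frac{x+y}{(x,y)_\theta}\big[g((x,y)_\theta)-g(-(x,y)_\theta)\big]\Big\}(1-\cos\theta)\sin^{2\alpha}\theta\,d\theta,$$ with $c_\alpha=\big(\int_0^\pi\sin^{2\alpha}\theta\,d\theta\big)^{-1}$; for $\alpha=-\frac12$ it is the ordinary translation $\tau_x^\alpha g(y)=g(x+y)$. The notation $\tau_x^\alpha|f|^p(y)$ means $(\tau_x^\alpha(|f|^p))(y)$. Dunkl-type Morrey space: for $1\le s\le t<\infty$, $L^{s,t}(\mathbb{R},d\mu_\alpha)$ is the set of locally $s$-integrable $f$ on $\mathbb{R}$ with $$\|f\|_{L^{s,t}(\mathbb{R},d\mu_\alpha)}=\sup_{r>0,\,x\in\mathbb{R}}r^{d_\alpha(\frac1t-\frac1s)}\Big(\int_{B(0,r)}\tau_x^\alpha|f|^s(y)\,d\mu_\alpha(y)\Big)^{1/s}<\infty.$$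 Generalized Dunkl-type Morrey space: for $1\le p<\infty$ and $\phi:\mathbb{R}^+\to\mathbb{R}^+$, $L^{p,\phi}(\mathbb{R},d\mu_\alpha)$ is the set of locally $p$-integrable $f$ on $\mathbb{R}$ with $$\|f\|_{L^{p,\phi}(\mathbb{R},d\mu_\alpha)}=\sup_{r>0,\,x\in\mathbb{R}}\frac1{\phi(r)}\Big(\frac1{r^{d_\alpha}}\int_{B(0,r)}\tau_x^\alpha|f|^p(y)\,d\mu_\alpha(y)\Big)^{1/p}<\infty.$$ Dunkl-type Bessel–Riesz operator: $I_{\beta,\gamma}^\alpha f(x)=\int_{\mathbb{R}}f(y)\,\tau_x^\alpha K_{\beta,\gamma}^\alpha(y)\,d\mu_\alpha(y)$, where $K_{\beta,\gamma}^\alpha(x)=\frac{|x|^{\beta-d_\alpha}}{(1+|x|)^\gamma}$. A function $\theta:(0,\infty)\to(0,\infty)$ is almost increasing (resp. almost decreasing) if there is $C>0$ with $\theta(r)\le C\theta(s)$ (resp. $\theta(r)\ge C\theta(s)$) for all $r\le s$. *)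

theory Defs
  imports "HOL-Analysis.Analysis"
begin

definition dunkl_dim :: "real \<Rightarrow> real" where
  "dunkl_dim \<alpha> = 2 * \<alpha> + 2"

text \<open>For \<open>\<alpha> = -1/2\<close> the convention \<open>0 powr 0 = 0\<close> changes the density only at the origin,
  so the measure is still a multiple of Lebesgue measure.\<close>

definition dunkl_measure :: "real \<Rightarrow> real measure" where
  "dunkl_measure \<alpha> =
     density lborel (\<lambda>x. ennreal (\<bar>x\<bar> powr (2 * \<alpha> + 1) / (2 powr (\<alpha> + 1) * Gamma (\<alpha> + 1))))"

definition dunkl_arg :: "real \<Rightarrow> real \<Rightarrow> real \<Rightarrow> real" where
  "dunkl_arg x y \<theta> = sqrt (x\<^sup>2 + y\<^sup>2 - 2 * x * y * cos \<theta>)"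

definition dunkl_const :: "real \<Rightarrow> real" where
  "dunkl_const \<alpha> = inverse (LBINT \<theta>:{0..pi}. sin \<theta> powr (2 * \<alpha>))"

text \<open>For \<open>g\<close> locally integrable with respect to \<open>dunkl_measure \<alpha>\<close> the integrand below is
  integrable in \<open>\<theta>\<close> for almost every \<open>y\<close>; on the exceptional null set the value is immaterial.
  Even for \<open>g \<ge> 0\<close> the translate can take negative values, so it cannot be
  defined by a nonnegative integral.\<close>

definition dunkl_translation :: "real \<Rightarrow> real \<Rightarrow> (real \<Rightarrow> real) \<Rightarrow> real \<Rightarrow> real" where
  "dunkl_translation \<alpha> x g y =
     (if \<alpha> = - 1 / 2 then g (x + y)
      else dunkl_const \<alpha> / 2 *
        (LBINT \<theta>:{0..pi}.
           (g (dunkl_arg x y \<theta>) + g (- dunkl_arg x y \<theta>)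
             + (x + y) / dunkl_arg x y \<theta> * (g (dunkl_arg x y \<theta>) - g (- dunkl_arg x y \<theta>)))
           * (1 - cos \<theta>) * sin \<theta> powr (2 * \<alpha>)))"

text \<open>Functions are represented by Borel measurable ones; every class modulo null sets contains
  such a representative.\<close>

definition locally_p_integrable :: "real \<Rightarrow> real \<Rightarrow> (real \<Rightarrow> 'a::real_normed_vector) \<Rightarrow> bool" where
  "locally_p_integrable \<alpha> p f \<longleftrightarrow>
     f \<in> borel_measurable borel \<and>
     (\<forall>S. compact S \<longrightarrow> set_integrable (dunkl_measure \<alpha>) S (\<lambda>x. norm (f x) powr p))"

text \<open>The Morrey norms take values in \<open>[0,\<infinity>]\<close>. They are meaningful for locally \<open>p\<close>-integrable
  functions, for which the integral over the ball exists and is nonnegative: it equals the integral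
  of \<open>\<bar>f\<bar>\<^sup>p\<close> against a translate of the even function \<open>indicator (ball 0 r)\<close>.\<close>

definition dunkl_morrey_norm ::
  "real \<Rightarrow> real \<Rightarrow> real \<Rightarrow> (real \<Rightarrow> 'a::real_normed_vector) \<Rightarrow> ennreal" where
  "dunkl_morrey_norm \<alpha> s t f =
     (SUP r\<in>{0<..}. SUP x. ennreal
        (r powr (dunkl_dim \<alpha> * (1 / t - 1 / s)) *
         (LINT y:ball 0 r|dunkl_measure \<alpha>.
            dunkl_translation \<alpha> x (\<lambda>z. norm (f z) powr s) y) powr (1 / s)))"

definition gen_dunkl_morrey_norm ::
  "real \<Rightarrow> real \<Rightarrow> (real \<Rightarrow> real) \<Rightarrow> (real \<Rightarrow> 'a::real_normed_vector) \<Rightarrow> ennreal" where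
  "gen_dunkl_morrey_norm \<alpha> p \<phi> f =
     (SUP r\<in>{0<..}. SUP x. ennreal
        (1 / \<phi> r *
         (1 / r powr dunkl_dim \<alpha> *
          (LINT y:ball 0 r|dunkl_measure \<alpha>.
             dunkl_translation \<alpha> x (\<lambda>z. norm (f z) powr p) y)) powr (1 / p)))"

definition gen_dunkl_morrey_space ::
  "real \<Rightarrow> real \<Rightarrow> (real \<Rightarrow> real) \<Rightarrow> (real \<Rightarrow> 'a::real_normed_vector) set" where
  "gen_dunkl_morrey_space \<alpha> p \<phi> =
     {f. locally_p_integrable \<alpha> p f \<and> gen_dunkl_morrey_norm \<alpha> p \<phi> f < \<infinity>}"

text \<open>The kernel is singular at the origin, where the definition yields \<open>0\<close>. This affects
  the translate at \<open>x\<close> only for \<open>y = x\<close> and \<open>y = -x\<close>.\<close>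

definition bessel_riesz_kernel :: "real \<Rightarrow> real \<Rightarrow> real \<Rightarrow> real \<Rightarrow> real" where
  "bessel_riesz_kernel \<alpha> \<beta> \<gamma> x = \<bar>x\<bar> powr (\<beta> - dunkl_dim \<alpha>) / (1 + \<bar>x\<bar>) powr \<gamma>"

definition bessel_riesz_integrand ::
  "real \<Rightarrow> real \<Rightarrow> real \<Rightarrow> (real \<Rightarrow> complex) \<Rightarrow> real \<Rightarrow> real \<Rightarrow> complex" where
  "bessel_riesz_integrand \<alpha> \<beta> \<gamma> f x y =
     f y * of_real (dunkl_translation \<alpha> x (bessel_riesz_kernel \<alpha> \<beta> \<gamma>) y)"

definition bessel_riesz_operator ::
  "real \<Rightarrow> real \<Rightarrow> real \<Rightarrow> (real \<Rightarrow> complex) \<Rightarrow> real \<Rightarrow> complex" where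
  "bessel_riesz_operator \<alpha> \<beta> \<gamma> f x =
     (LINT y|dunkl_measure \<alpha>. bessel_riesz_integrand \<alpha> \<beta> \<gamma> f x y)"

definition almost_increasing :: "(real \<Rightarrow> real) \<Rightarrow> bool" where
  "almost_increasing \<theta> \<longleftrightarrow> (\<exists>C>0. \<forall>r s. 0 < r \<longrightarrow> r \<le> s \<longrightarrow> \<theta> r \<le> C * \<theta> s)"

definition almost_decreasing :: "(real \<Rightarrow> real) \<Rightarrow> bool" where
  "almost_decreasing \<theta> \<longleftrightarrow> (\<exists>C>0. \<forall>r s. 0 < r \<longrightarrow> r \<le> s \<longrightarrow> \<theta> r \<ge> C * \<theta> s)"

end

theory Submission
  imports Defs
begin

text \<open>Write \<open>d = dunkl_dim \<alpha>\<close>, let \<open>K\<close> be the Bessel-Riesz kernel and let \<open>w\<^sub>r(x, y) = ball_weight \<alpha> r x y\<close> be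
the translate by \<open>x\<close> of the indicator of the ball of radius \<open>r\<close>.

Although the translate of a nonnegative function \<open>h\<close> may be negative, its integral over a centred ball
is the integral of \<open>h\<close> against the nonnegative weight \<open>w\<^sub>r(-x, \<cdot>)\<close> (\<open>dunkl_duality\<close>). Morrey norms are
therefore statements about such weighted integrals: if \<open>N\<close> is the norm of \<open>f\<close>, then
\<open>\<integral> \<bar>f\<bar>\<^sup>p w\<^sub>r(x, \<cdot>) d\<mu> \<le> (N \<phi>(r))\<^sup>p r\<^sup>d\<close> for all \<open>x\<close> and \<open>r\<close>, and the norm of \<open>I f\<close> is controlled as soon as
\<open>\<integral> \<bar>I f\<bar>\<^sup>q w\<^sub>r(x, \<cdot>) d\<mu> \<le> C N\<^sup>q \<phi>(r)\<^sup>p r\<^sup>d\<close>, because \<open>\<psi>\<^sup>q = \<phi>\<^sup>p\<close>. The weights behave like multiples of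
indicators of balls, up to the reflection \<open>y \<mapsto> -y\<close>: the weight \<open>w\<^sub>r(x, \<cdot>)\<close> lives on
\<open>\<bar>\<bar>x\<bar> - \<bar>y\<bar>\<bar> < r\<close>, is at most of size \<open>(r / (\<bar>x\<bar> + r))\<^sup>2\<^sup>\<alpha>\<^sup>+\<^sup>1\<close> there, and \<open>w\<^sub>4\<^sub>r(x, \<cdot>) + w\<^sub>4\<^sub>r(-x, \<cdot>)\<close> is at
least of that size (\<open>ball_weight_le\<close>, \<open>ball_weight_pair_ge\<close>).

Put \<open>b = d (1 - 1/t)\<close>. The hypotheses on \<open>s\<close> and \<open>t\<close> imply \<open>\<beta> - \<gamma> < b < \<beta>\<close>, and these strict
inequalities give geometric decay at both ends of a dyadic decomposition
\<open>K \<le> \<Sum>\<^sub>n \<Lambda>\<^sub>n R\<^sub>n\<^sup>b\<^sup>-\<^sup>d 1\<^bsub>[0, R\<^sub>n)\<^esub>(\<bar>\<cdot>\<bar>)\<close> with \<open>\<Sum> \<Lambda>\<^sub>n < \<infinity>\<close> (\<open>dyadic_kernel_bound\<close>). At one scale \<open>R\<close>, Hoelder's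
inequality and \<open>\<phi>(R) \<le> C\<^sub>0 R\<^sup>\<nu>\<close> give
\<open>(R\<^sup>b\<^sup>-\<^sup>d \<integral> \<bar>f\<bar> w\<^sub>R(x, \<cdot>) d\<mu>)\<^sup>q \<le> C N\<^sup>q\<^sup>-\<^sup>p R\<^sup>-\<^sup>d \<integral> \<bar>f\<bar>\<^sup>p w\<^sub>R(x, \<cdot>) d\<mu>\<close>: the exponent \<open>q\<close> is the one for which
\<open>b q + \<nu> (q - p) = 0\<close>, so that all other powers of \<open>R\<close> cancel (\<open>single_scale_bound\<close>). Convexity sums
this over the scales, because \<open>\<Lambda>\<close> is summable; this summation takes the place of a maximal function.
It remains to average the right-hand side against \<open>w\<^sub>r(z, \<cdot>)\<close>. An average of \<open>\<bar>f\<bar>\<^sup>p\<close> at scale \<open>R \<ge> r\<close>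
is at most \<open>(N \<phi>(R))\<^sup>p\<close>, hence of order \<open>(N \<phi>(r))\<^sup>p\<close> since \<open>\<phi>\<close> is almost decreasing; for \<open>R < r\<close>, Tonelli's
theorem turns the double average into an average at scale comparable to \<open>r\<close> (\<open>double_average_le\<close>).

Finally the kernel norm is bounded below by a positive number (\<open>kernel_morrey_norm_pos\<close>), which can be
absorbed into the constant.\<close>

section \<open>Angular measure and caps\<close>

text \<open>Keeping \<open>sin\<^sup>2\<^sup>\<alpha> \<theta>\<close> in a measure, and \<open>1 - cos \<theta>\<close> in the integrands, makes reflection
\<open>\<theta> \<mapsto> \<pi> - \<theta>\<close> a symmetry of the measure.\<close>

definition angular_measure :: "real \<Rightarrow> real measure" where
  "angular_measure \<alpha> = density lborel (\<lambda>\<theta>. ennreal (indicator {0..pi} \<theta> * sin \<theta> powr (2 * \<alpha>)))"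

lemma sets_angular_measure [measurable_cong, simp]: "sets (angular_measure \<alpha>) = sets borel"
  by (simp add: angular_measure_def)

lemma space_angular_measure [simp]: "space (angular_measure \<alpha>) = UNIV"
  by (simp add: angular_measure_def)

lemma nn_integral_angular_measure:
  assumes [measurable]: "F \<in> borel_measurable borel"
  shows "(\<integral>\<^sup>+\<theta>. F \<theta> \<partial>angular_measure \<alpha>)
    = (\<integral>\<^sup>+\<theta>. ennreal (indicator {0..pi} \<theta> * sin \<theta> powr (2 * \<alpha>)) * F \<theta> \<partial>lborel)"
  unfolding angular_measure_def by (subst nn_integral_density) (auto simp: )

lemma AE_angular_measure:
  "AE \<theta> in angular_measure \<alpha>. 0 < \<theta> \<and> \<theta> < pi"
proof -
  have "AE \<theta> in lborel. \<theta> \<noteq> 0 \<and> \<theta> \<noteq> pi"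
    by (intro AE_conjI AE_lborel_singleton)
  then show ?thesis
    unfolding angular_measure_def
    by (subst AE_density) (auto simp: indicator_def split: if_splits)
qed

lemma AE_lborel_imp_AE_angular_measure:
  assumes "AE \<theta> in lborel. P \<theta>"
  shows "AE \<theta> in angular_measure \<alpha>. P \<theta>"
  using assms unfolding angular_measure_def by (subst AE_density) auto

lemma sigma_finite_angular_measure: "sigma_finite_measure (angular_measure \<alpha>)"
  unfolding angular_measure_def
  by (subst sigma_finite_measure.sigma_finite_iff_density_finite[OF sigma_finite_lborel]) auto

lemma nn_integral_angular_reflect:
  assumes [measurable]: "F \<in> borel_measurable borel"
  shows "(\<integral>\<^sup>+\<theta>. F (pi - \<theta>) \<partial>angular_measure \<alpha>) = (\<integral>\<^sup>+\<theta>. F \<theta> \<partial>angular_measure \<alpha>)"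
proof -
  let ?A = "angular_measure \<alpha>"
  have "(\<integral>\<^sup>+\<theta>. F \<theta> \<partial>?A)
     = (\<integral>\<^sup>+\<theta>. ennreal (indicator {0..pi} (pi + (-1) * \<theta>) * sin (pi + (-1) * \<theta>) powr (2 * \<alpha>)) * F (pi + (-1) * \<theta>) \<partial>lborel)"
    by (subst nn_integral_angular_measure[OF assms], subst nn_integral_real_affine[where c="-1" and t=pi]) auto
  also have "\<dots> = (\<integral>\<^sup>+\<theta>. ennreal (indicator {0..pi} \<theta> * sin \<theta> powr (2 * \<alpha>)) * F (pi - \<theta>) \<partial>lborel)"
    by (intro nn_integral_cong) (auto simp: indicator_def)
  also have "\<dots> = (\<integral>\<^sup>+\<theta>. F (pi - \<theta>) \<partial>?A)"
    by (subst nn_integral_angular_measure) auto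
  finally show ?thesis by simp
qed

lemma nn_integral_powr_from_0:
  fixes a A :: real
  assumes "a > -1" "0 \<le> A"
  shows "(\<integral>\<^sup>+x. ennreal (indicator {0..A} x * x powr a) \<partial>lborel) = ennreal (A powr (a + 1) / (a + 1))"
proof -
  have "(\<integral>\<^sup>+x. ennreal (x powr a) * indicator {0..A} x \<partial>lborel) = ennreal (A powr (a + 1) / (a + 1))"
    using has_integral_powr_from_0[OF assms] assms
    by (intro nn_integral_has_integral_lebesgue') auto
  then show ?thesis
    by (simp add: ennreal_mult'' ennreal_indicator mult.commute)
qed

lemma sin_ge_linear:
  fixes x :: real
  assumes "0 \<le> x" "x \<le> pi / 2"
  shows "2 / pi * x \<le> sin x"
proof -
  have "concave_on {0..pi} sin"
  proof (rule f''_le0_imp_concave)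
    fix x :: real assume x: "x \<in> {0..pi}"
    show "(sin has_real_derivative cos x) (at x)" by (auto intro!: derivative_eq_intros)
    show "(cos has_real_derivative - sin x) (at x)" by (auto intro!: derivative_eq_intros)
    show "- sin x \<le> 0" using x sin_ge_zero by auto
  qed auto
  then have "sin ((1 - 2/pi*x) *\<^sub>R 0 + (2/pi*x) *\<^sub>R (pi/2)) \<ge> (1 - 2/pi*x) * sin 0 + (2/pi*x) * sin (pi/2)"
    by (rule concave_onD) (use assms in \<open>auto simp: field_simps\<close>)
  then show ?thesis by simp
qed

text \<open>Comparability of \<open>sin \<theta>\<close> with \<open>\<theta>\<close> passes to powers of either sign of the exponent.\<close>

lemma powr_between:
  fixes a m x y :: real
  assumes "0 < m" "m \<le> 1" "0 < x" "m * x \<le> y" "y \<le> x"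
  shows "m powr \<bar>a\<bar> * x powr a \<le> y powr a" and "y powr a \<le> m powr (-\<bar>a\<bar>) * x powr a"
proof -
  have y: "0 < y" using assms by (smt (verit) mult_pos_pos)
  define z where "z = y / x"
  have z: "m \<le> z" "z \<le> 1" "0 < z" and yz: "y = z * x"
    using assms y by (auto simp: z_def field_simps)
  have "m powr \<bar>a\<bar> \<le> z powr \<bar>a\<bar>" using z assms by (intro powr_mono2) auto
  moreover have "z powr \<bar>a\<bar> \<le> z powr a" using z by (intro powr_mono') auto
  moreover have "z powr a \<le> z powr (-\<bar>a\<bar>)" using z by (intro powr_mono') auto
  moreover have "z powr (-\<bar>a\<bar>) \<le> m powr (-\<bar>a\<bar>)" using z assms by (intro powr_mono2') auto
  ultimately have "m powr \<bar>a\<bar> \<le> z powr a" "z powr a \<le> m powr (-\<bar>a\<bar>)" by linarith+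
  then show "m powr \<bar>a\<bar> * x powr a \<le> y powr a" and "y powr a \<le> m powr (-\<bar>a\<bar>) * x powr a"
    unfolding yz using assms z by (simp_all add: powr_mult mult_right_mono)
qed

definition angular_cap :: "real \<Rightarrow> real \<Rightarrow> ennreal" where
  "angular_cap \<alpha> \<delta> = (\<integral>\<^sup>+\<theta>. indicator {\<theta>. 1 - cos \<theta> < \<delta>\<^sup>2} \<theta> \<partial>angular_measure \<alpha>)"

lemma angular_cap_reflect:
  "(\<integral>\<^sup>+\<theta>. indicator {\<theta>. 1 + cos \<theta> < \<delta>\<^sup>2} \<theta> \<partial>angular_measure \<alpha>) = angular_cap \<alpha> \<delta>"
proof -
  let ?A = "angular_measure \<alpha>"
  have "(\<integral>\<^sup>+\<theta>. indicator {\<theta>. 1 + cos (pi - \<theta>) < \<delta>\<^sup>2} \<theta> \<partial>?A)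
      = (\<integral>\<^sup>+\<theta>. indicator {\<theta>. 1 + cos \<theta> < \<delta>\<^sup>2} \<theta> \<partial>?A)"
    using nn_integral_angular_reflect[of "indicator {\<theta>. 1 + cos \<theta> < \<delta>\<^sup>2}" \<alpha>]
    by (simp add: indicator_def)
  then show ?thesis by (simp add: angular_cap_def)
qed

text \<open>A cap of radius \<open>\<delta>\<close> is comparable to the interval \<open>0 \<le> \<theta> \<le> \<delta>\<close>, on which \<open>sin \<theta>\<close> is comparable to
\<open>\<theta>\<close>; so its measure is comparable to \<open>\<integral>\<^sub>0\<^sup>\<delta> \<theta>\<^sup>2\<^sup>\<alpha> d\<theta>\<close>. This is where \<open>\<alpha> > -1/2\<close> enters.\<close>

lemma angular_cap_bounds:
  assumes "\<alpha> > -1/2"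
  obtains c C :: real where "0 < c" "0 < C"
    "\<And>\<delta>. 0 < \<delta> \<Longrightarrow> \<delta> \<le> 1 \<Longrightarrow> ennreal (c * \<delta> powr (2*\<alpha>+1)) \<le> angular_cap \<alpha> \<delta>"
    "\<And>\<delta>. 0 < \<delta> \<Longrightarrow> \<delta> \<le> 1 \<Longrightarrow> angular_cap \<alpha> \<delta> \<le> ennreal (C * \<delta> powr (2*\<alpha>+1))"
proof -
  define a where "a = 2 * \<alpha>"
  have a: "a > -1" using assms by (simp add: a_def)
  define m where "m = (2/pi) powr \<bar>a\<bar>"
  define m' where "m' = (2/pi) powr (-\<bar>a\<bar>)"
  have m: "0 < m" "0 < m'" by (auto simp: m_def m'_def)
  have pi2: "2/pi \<le> 1" "0 < 2/pi" using pi_ge_two by (auto simp: field_simps)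
  have sinb: "m * \<theta> powr a \<le> sin \<theta> powr a" "sin \<theta> powr a \<le> m' * \<theta> powr a"
    if "0 \<le> \<theta>" "\<theta> \<le> pi/2" for \<theta>
  proof -
    have "m * \<theta> powr a \<le> sin \<theta> powr a \<and> sin \<theta> powr a \<le> m' * \<theta> powr a" 
    proof (cases "\<theta> = 0")
      case False
      then have "0 < \<theta>" using that by auto
      with that pi2 sin_ge_linear[OF that] sin_x_le_x[of \<theta>] show ?thesis
        unfolding m_def m'_def by (auto intro!: powr_between)
    qed auto
    then show "m * \<theta> powr a \<le> sin \<theta> powr a" "sin \<theta> powr a \<le> m' * \<theta> powr a" by auto
  qed
  show ?thesis
  proof (rule that)
    show "0 < m / (a+1)" "0 < m' * pi powr (a+1) / (a+1)" using a m by auto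
  next
    fix \<delta> :: real assume \<delta>: "0 < \<delta>" "\<delta> \<le> 1"
    have sub: "1 - cos \<theta> < \<delta>\<^sup>2" if "0 \<le> \<theta>" "\<theta> \<le> \<delta>" for \<theta>
    proof -
      have "1 - cos \<theta> = 2 * (sin (\<theta>/2))\<^sup>2"
        using cos_double_sin[of "\<theta>/2"] by simp
      also have "(sin (\<theta>/2))\<^sup>2 \<le> (\<theta>/2)\<^sup>2"
        using that \<delta> pi_ge_two by (intro power_mono sin_x_le_x sin_ge_zero) auto
      also have "2 * (\<theta>/2)\<^sup>2 = \<theta>\<^sup>2 / 2" by (simp add: power2_eq_square)
      also have "\<dots> \<le> \<delta>\<^sup>2 / 2" using that by (intro divide_right_mono power_mono) auto
      also have "\<dots> < \<delta>\<^sup>2" using \<delta> by simp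
      finally show ?thesis by simp
    qed
    have "ennreal (m / (a+1) * \<delta> powr (2*\<alpha>+1)) = ennreal m * ennreal (\<delta> powr (a+1) / (a+1))"
      using m a by (simp add: ennreal_mult'[symmetric] a_def)
    also have "\<dots> = (\<integral>\<^sup>+\<theta>. ennreal m * ennreal (indicator {0..\<delta>} \<theta> * \<theta> powr a) \<partial>lborel)"
      using nn_integral_powr_from_0[OF a, of \<delta>] \<delta> by (subst nn_integral_cmult) auto
    also have "\<dots> \<le> (\<integral>\<^sup>+\<theta>. ennreal (indicator {0..pi} \<theta> * sin \<theta> powr (2 * \<alpha>)) * indicator {\<theta>. 1 - cos \<theta> < \<delta>\<^sup>2} \<theta> \<partial>lborel)"
    proof (intro nn_integral_mono)
      fix \<theta> :: real
      show "ennreal m * ennreal (indicator {0..\<delta>} \<theta> * \<theta> powr a) \<le> 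
        ennreal (indicator {0..pi} \<theta> * sin \<theta> powr (2 * \<alpha>)) * indicator {\<theta>. 1 - cos \<theta> < \<delta>\<^sup>2} \<theta>"
      proof (cases "\<theta> \<in> {0..\<delta>}")
        case True
        then have "\<theta> \<le> pi/2" using \<delta> pi_ge_two by auto
        then show ?thesis using True sub[of \<theta>] sinb(1)[of \<theta>] m pi_ge_two
          by (auto simp: ennreal_mult'[symmetric] a_def intro!: ennreal_leI)
      qed auto
    qed
    also have "\<dots> = angular_cap \<alpha> \<delta>"
      unfolding angular_cap_def by (subst nn_integral_angular_measure) auto
    finally show "ennreal (m / (a+1) * \<delta> powr (2*\<alpha>+1)) \<le> angular_cap \<alpha> \<delta>" .
  next
    fix \<delta> :: real assume \<delta>: "0 < \<delta>" "\<delta> \<le> 1"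
    have sub: "\<theta> \<le> pi * \<delta> \<and> \<theta> \<le> pi/2" if "0 \<le> \<theta>" "\<theta> \<le> pi" "1 - cos \<theta> < \<delta>\<^sup>2" for \<theta>
    proof -
      have "\<delta>\<^sup>2 \<le> 1" using \<delta> by (simp add: power_le_one)
      then have "cos \<theta> > 0" using that by linarith
      then have h: "\<theta> \<le> pi/2" 
        using that cos_monotone_0_pi_le[of "pi/2" \<theta>] by fastforce
      have "2 * (\<theta>/pi)\<^sup>2 \<le> 2 * (sin (\<theta>/2))\<^sup>2"
        using sin_ge_linear[of "\<theta>/2"] that by (intro mult_left_mono power_mono) auto
      also have "\<dots> = 1 - cos \<theta>"
        using cos_double_sin[of "\<theta>/2"] by simp
      finally have "2 * (\<theta>/pi)\<^sup>2 < \<delta>\<^sup>2" using that by linarith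
      then have "(\<theta>/pi)\<^sup>2 < \<delta>\<^sup>2" using zero_le_power2[of "\<theta>/pi"] by linarith
      then have "\<theta>/pi < \<delta>" using \<delta> by (auto dest: power2_less_imp_less)
      then show ?thesis using h by (simp add: field_simps)
    qed
    have "angular_cap \<alpha> \<delta> = (\<integral>\<^sup>+\<theta>. ennreal (indicator {0..pi} \<theta> * sin \<theta> powr (2 * \<alpha>)) * indicator {\<theta>. 1 - cos \<theta> < \<delta>\<^sup>2} \<theta> \<partial>lborel)"
      unfolding angular_cap_def by (subst nn_integral_angular_measure) auto
    also have "\<dots> \<le> (\<integral>\<^sup>+\<theta>. ennreal m' * ennreal (indicator {0..pi*\<delta>} \<theta> * \<theta> powr a) \<partial>lborel)"
    proof (intro nn_integral_mono)
      fix \<theta> :: real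
      show "ennreal (indicator {0..pi} \<theta> * sin \<theta> powr (2 * \<alpha>)) * indicator {\<theta>. 1 - cos \<theta> < \<delta>\<^sup>2} \<theta>
        \<le> ennreal m' * ennreal (indicator {0..pi*\<delta>} \<theta> * \<theta> powr a)"
      proof (cases "0 \<le> \<theta> \<and> \<theta> \<le> pi \<and> 1 - cos \<theta> < \<delta>\<^sup>2")
        case True
        with sub[of \<theta>] sinb(2)[of \<theta>] m show ?thesis
          by (auto simp: ennreal_mult'[symmetric] a_def intro!: ennreal_leI)
      qed auto
    qed
    also have "\<dots> = ennreal m' * ennreal ((pi*\<delta>) powr (a+1) / (a+1))"
      using nn_integral_powr_from_0[OF a, of "pi*\<delta>"] \<delta> by (subst nn_integral_cmult) auto
    also have "\<dots> = ennreal (m' * pi powr (a+1) / (a+1) * \<delta> powr (2*\<alpha>+1))"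
      using m a \<delta> by (simp add: ennreal_mult'[symmetric] a_def powr_mult mult_ac)
    finally show "angular_cap \<alpha> \<delta> \<le> ennreal (m' * pi powr (a+1) / (a+1) * \<delta> powr (2*\<alpha>+1))" .
  qed
qed

text \<open>The interval \<open>[0, \<pi>]\<close> is, up to the midpoint, the union of a cap of radius \<open>1\<close> and its reflection.\<close>

lemma finite_angular_measure:
  assumes "\<alpha> > -1/2"
  shows "emeasure (angular_measure \<alpha>) UNIV < \<infinity>"
proof -
  let ?A = "angular_measure \<alpha>"
  obtain C :: real where C: "angular_cap \<alpha> 1 \<le> ennreal (C * 1 powr (2*\<alpha>+1))"
    using angular_cap_bounds[OF assms] by (metis less_numeral_extra(1) order_refl)
  have "emeasure (?A) UNIV = (\<integral>\<^sup>+\<theta>. 1 \<partial>?A)" by simp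
  also have "\<dots> \<le> (\<integral>\<^sup>+\<theta>. indicator {\<theta>. 1 - cos \<theta> < 1\<^sup>2} \<theta> + indicator {\<theta>. 1 + cos \<theta> < 1\<^sup>2} \<theta> \<partial>?A)"
  proof (intro nn_integral_mono_AE)
    have "AE \<theta> in ?A. \<theta> \<noteq> pi/2"
      by (intro AE_lborel_imp_AE_angular_measure AE_lborel_singleton)
    with AE_angular_measure show "AE \<theta> in ?A. 
       (1::ennreal) \<le> indicator {\<theta>. 1 - cos \<theta> < 1\<^sup>2} \<theta> + indicator {\<theta>. 1 + cos \<theta> < 1\<^sup>2} \<theta>"
    proof eventually_elim
      case (elim \<theta>)
      then have "cos \<theta> \<noteq> 0" using cos_inj_pi[of \<theta> "pi/2"] by auto
      then show ?case by (auto simp: indicator_def)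
    qed
  qed
  also have "\<dots> = angular_cap \<alpha> 1 + angular_cap \<alpha> 1"
    by (subst nn_integral_add) (simp, simp, simp only: angular_cap_reflect angular_cap_def)
  also have "\<dots> < \<infinity>" using C by (auto simp: less_top[symmetric] top_unique)
  finally show ?thesis .
qed

lemma dunkl_const_pos:
  assumes "\<alpha> > -1/2"
  shows "dunkl_const \<alpha> > 0"
proof -
  let ?A = "angular_measure \<alpha>"
  have I: "(\<integral>\<^sup>+\<theta>. ennreal (indicator {0..pi} \<theta> * sin \<theta> powr (2 * \<alpha>)) \<partial>lborel) = emeasure (?A) UNIV"
    using nn_integral_angular_measure[of "\<lambda>_. 1" \<alpha>] by simp
  obtain c :: real where c: "0 < c" "ennreal (c * 1 powr (2*\<alpha>+1)) \<le> angular_cap \<alpha> 1"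
    using angular_cap_bounds[OF assms] by (metis less_numeral_extra(1) order_refl)
  have "angular_cap \<alpha> 1 \<le> emeasure (?A) UNIV"
    unfolding angular_cap_def by (subst nn_integral_indicator) (auto intro: emeasure_mono)
  then have pos: "0 < emeasure (?A) UNIV" using c
    by (metis ennreal_less_zero_iff less_le_trans mult.right_neutral powr_one_eq_one)
  have "(LBINT \<theta>:{0..pi}. sin \<theta> powr (2 * \<alpha>)) = enn2real (emeasure (?A) UNIV)"
    unfolding set_lebesgue_integral_def I[symmetric]
    by (subst integral_eq_nn_integral) auto
  also have "\<dots> > 0" using pos finite_angular_measure[OF assms]
    by (simp add: enn2real_positive_iff)
  finally show ?thesis by (simp add: dunkl_const_def)
qed

section \<open>The law of cosines and its symmetry\<close>

lemma dunkl_arg_sq: "(dunkl_arg x y \<theta>)\<^sup>2 = x\<^sup>2 + y\<^sup>2 - 2 * x * y * cos \<theta>"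
  and dunkl_arg_lower: "\<bar>\<bar>x\<bar> - \<bar>y\<bar>\<bar> \<le> dunkl_arg x y \<theta>"
proof -
  have "2 * x * y * cos \<theta> \<le> \<bar>2 * x * y * cos \<theta>\<bar>" by simp
  also have "\<dots> \<le> 2 * \<bar>x\<bar> * \<bar>y\<bar>" by (simp add: abs_mult mult_left_le)
  finally have "x\<^sup>2 + y\<^sup>2 - 2 * x * y * cos \<theta> \<ge> (\<bar>x\<bar> - \<bar>y\<bar>)\<^sup>2"
    by (simp add: power2_eq_square algebra_simps)
  then show *: "\<bar>\<bar>x\<bar> - \<bar>y\<bar>\<bar> \<le> dunkl_arg x y \<theta>"
    unfolding dunkl_arg_def by (intro real_le_rsqrt) simp
  show "(dunkl_arg x y \<theta>)\<^sup>2 = x\<^sup>2 + y\<^sup>2 - 2 * x * y * cos \<theta>"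
    using \<open>_ \<ge> (\<bar>x\<bar> - \<bar>y\<bar>)\<^sup>2\<close> zero_le_power2[of "\<bar>x\<bar> - \<bar>y\<bar>"]
    unfolding dunkl_arg_def by (intro real_sqrt_pow2) linarith
qed

lemma dunkl_arg_nonneg [simp]: "0 \<le> dunkl_arg x y \<theta>"
  using dunkl_arg_lower[of x y \<theta>] by linarith

lemma dunkl_arg_commute: "dunkl_arg x y \<theta> = dunkl_arg y x \<theta>"
  by (simp add: dunkl_arg_def algebra_simps)

lemma dunkl_arg_minus: "dunkl_arg (-x) (-y) \<theta> = dunkl_arg x y \<theta>"
  by (simp add: dunkl_arg_def)

lemma dunkl_arg_reflect: "dunkl_arg x (-y) (pi - \<theta>) = dunkl_arg x y \<theta>"
  by (simp add: dunkl_arg_def)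

lemma dunkl_arg_upper: "dunkl_arg x y \<theta> \<le> \<bar>x\<bar> + \<bar>y\<bar>"
proof (rule power2_le_imp_le)
  have "- (2 * x * y * cos \<theta>) \<le> \<bar>2 * x * y * cos \<theta>\<bar>" by simp
  also have "\<dots> \<le> 2 * \<bar>x\<bar> * \<bar>y\<bar>" by (simp add: abs_mult mult_left_le)
  finally show "(dunkl_arg x y \<theta>)\<^sup>2 \<le> (\<bar>x\<bar> + \<bar>y\<bar>)\<^sup>2"
    unfolding dunkl_arg_sq by (simp add: power2_eq_square algebra_simps)
qed simp

lemma measurable_dunkl_arg [measurable (raw)]:
  assumes [measurable]: "f \<in> borel_measurable M" "g \<in> borel_measurable M" "h \<in> borel_measurable M"
  shows "(\<lambda>z. dunkl_arg (f z) (g z) (h z)) \<in> borel_measurable M"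
  unfolding dunkl_arg_def by measurable

text \<open>The density of the third side \<open>u\<close> of a triangle with sides \<open>x\<close> and \<open>y\<close>, when the angle between these
is distributed by the angular measure, times \<open>y\<^sup>2\<^sup>\<alpha>\<^sup>+\<^sup>1\<close>. The product raised to the power \<open>\<alpha> - 1/2\<close>
is 16 times the squared area (Heron's formula), which makes the kernel symmetric in \<open>y\<close> and \<open>u\<close>.\<close>

definition triangle_kernel :: "real \<Rightarrow> real \<Rightarrow> real \<Rightarrow> real \<Rightarrow> real" where
  "triangle_kernel \<alpha> x y u = indicator {\<bar>x - y\<bar>..x + y} u *
     (2 powr (1 - 2 * \<alpha>) * x powr (- 2 * \<alpha>) * y * u *
       ((u\<^sup>2 - (x - y)\<^sup>2) * ((x + y)\<^sup>2 - u\<^sup>2)) powr (\<alpha> - 1 / 2))"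

lemma triangle_kernel_commute: "triangle_kernel \<alpha> x y u = triangle_kernel \<alpha> x u y"
proof -
  have "(u\<^sup>2 - (x - y)\<^sup>2) * ((x + y)\<^sup>2 - u\<^sup>2) = (y\<^sup>2 - (x - u)\<^sup>2) * ((x + u)\<^sup>2 - y\<^sup>2)"
    by (simp add: power2_eq_square algebra_simps)
  moreover have "u \<in> {\<bar>x - y\<bar>..x + y} \<longleftrightarrow> y \<in> {\<bar>x - u\<bar>..x + u}" by auto
  ultimately show ?thesis unfolding triangle_kernel_def indicator_def by (simp add: mult_ac)
qed

lemma measurable_triangle_kernel [measurable]:
  "(\<lambda>z. triangle_kernel \<alpha> x (fst z) (snd z)) \<in> borel_measurable (borel \<Otimes>\<^sub>M borel)"
  "(\<lambda>u. triangle_kernel \<alpha> x y u) \<in> borel_measurable borel"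
proof -
  have "(\<lambda>z::real\<times>real. indicator {z. \<bar>x - fst z\<bar> \<le> snd z \<and> snd z \<le> x + fst z} z *
     (2 powr (1 - 2 * \<alpha>) * x powr (- 2 * \<alpha>) * fst z * snd z *
       (((snd z)\<^sup>2 - (x - fst z)\<^sup>2) * ((x + fst z)\<^sup>2 - (snd z)\<^sup>2)) powr (\<alpha> - 1 / 2))) \<in> borel_measurable (borel \<Otimes>\<^sub>M borel)"
    by measurable
  then show "(\<lambda>z. triangle_kernel \<alpha> x (fst z) (snd z)) \<in> borel_measurable (borel \<Otimes>\<^sub>M borel)"
    unfolding triangle_kernel_def by (rule measurable_cong[THEN iffD1, rotated]) (auto simp: indicator_def)
  show "(\<lambda>u. triangle_kernel \<alpha> x y u) \<in> borel_measurable borel"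
    unfolding triangle_kernel_def by measurable
qed

lemma triangle_kernel_dunkl_arg:
  assumes "0 < x" "0 < y" "x \<noteq> y" "0 < \<theta>" "\<theta> < pi"
  shows "triangle_kernel \<alpha> x y (dunkl_arg x y \<theta>) * (x * y * sin \<theta> / dunkl_arg x y \<theta>)
    = y powr (2 * \<alpha> + 1) * sin \<theta> powr (2 * \<alpha>)"
proof -
  define u where "u = dunkl_arg x y \<theta>"
  define s where "s = sin \<theta>"
  have s: "0 < s" using assms by (simp add: s_def sin_gt_zero)
  have u: "0 < u" using dunkl_arg_lower[of x y \<theta>] assms by (simp add: u_def)
  have ub: "\<bar>x - y\<bar> \<le> u" "u \<le> x + y"
    using dunkl_arg_lower[of x y \<theta>] dunkl_arg_upper[of x y \<theta>] assms by (auto simp: u_def)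
  have usq: "u\<^sup>2 = x\<^sup>2 + y\<^sup>2 - 2 * x * y * cos \<theta>" by (simp add: u_def dunkl_arg_sq)
  have "(u\<^sup>2 - (x - y)\<^sup>2) * ((x + y)\<^sup>2 - u\<^sup>2) = (2*x*y)\<^sup>2 * (1 - (cos \<theta>)\<^sup>2)"
    unfolding usq by (simp add: power2_eq_square algebra_simps)
  also have "\<dots> = (2*x*y * s)\<^sup>2" by (simp add: s_def sin_squared_eq power_mult_distrib)
  finally have "((u\<^sup>2 - (x - y)\<^sup>2) * ((x + y)\<^sup>2 - u\<^sup>2)) powr (\<alpha> - 1/2) = (2*x*y * s) powr (2*\<alpha> - 1)"
    using powr_powr[of "2*x*y * s" 2 "\<alpha> - 1/2"] assms s by (simp add: algebra_simps)
  also have "\<dots> = 2 powr (2*\<alpha> - 1) * x powr (2*\<alpha> - 1) * y powr (2*\<alpha> - 1) * s powr (2*\<alpha> - 1)"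
    using assms s by (simp add: powr_mult)
  finally have "triangle_kernel \<alpha> x y u * (x * y * s / u)
    = (2 powr (1 - 2*\<alpha>) * 2 powr (2*\<alpha> - 1)) * (x powr (- 2*\<alpha>) * x powr (2*\<alpha> - 1) * x powr 1)
     * (y powr (2*\<alpha> - 1) * y powr 1 * y powr 1) * (s powr (2*\<alpha> - 1) * s powr 1)"
    using ub u assms s unfolding triangle_kernel_def by simp
  also have "\<dots> = y powr (2*\<alpha> + 1) * s powr (2*\<alpha>)"
    using assms s unfolding powr_add[symmetric] by simp
  finally show ?thesis by (simp add: u_def s_def)
qed

text \<open>For fixed \<open>x \<noteq> y\<close> the law of cosines \<open>\<theta> \<mapsto> u\<close> is a smooth increasing change of variables from
\<open>[0, \<pi>]\<close> onto \<open>[\<bar>x - y\<bar>, x + y]\<close>, with \<open>du = x y sin \<theta> / u d\<theta>\<close>.\<close>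

lemma nn_integral_angular_dunkl_arg:
  assumes F[measurable]: "F \<in> borel_measurable borel" and xy: "0 < x" "0 < y" "x \<noteq> y"
  shows "ennreal (y powr (2 * \<alpha> + 1)) * (\<integral>\<^sup>+\<theta>. F (dunkl_arg x y \<theta>) \<partial>angular_measure \<alpha>)
    = (\<integral>\<^sup>+u. ennreal (triangle_kernel \<alpha> x y u) * F u \<partial>lborel)"
proof -
  let ?u = "dunkl_arg x y"
  let ?u' = "\<lambda>\<theta>. x * y * sin \<theta> / ?u \<theta>"
  have upos: "0 < ?u \<theta>" for \<theta> using dunkl_arg_lower[of x y \<theta>] xy by simp
  have u0: "?u 0 = \<bar>x - y\<bar>"
  proof -
    have "x\<^sup>2 + y\<^sup>2 - 2 * x * y = (x - y)\<^sup>2" by (simp add: power2_eq_square algebra_simps)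
    then show ?thesis by (simp add: dunkl_arg_def)
  qed
  have upi: "?u pi = x + y"
  proof -
    have "x\<^sup>2 + y\<^sup>2 + 2 * x * y = (x + y)\<^sup>2" by (simp add: power2_eq_square algebra_simps)
    then show ?thesis using xy by (simp add: dunkl_arg_def)
  qed
  have deriv: "(?u has_real_derivative ?u' \<theta>) (at \<theta>)" for \<theta>
  proof -
    have "0 < x\<^sup>2 + y\<^sup>2 - 2 * x * y * cos \<theta>"
      using upos[of \<theta>] dunkl_arg_sq[of x y \<theta>] zero_less_power[of "?u \<theta>" 2] by linarith
    then show ?thesis
      unfolding dunkl_arg_def by (auto intro!: derivative_eq_intros simp: field_simps)
  qed
  have cont: "continuous_on {0..pi} ?u'"
    using upos by (auto intro!: continuous_intros continuous_at_imp_continuous_on DERIV_isCont[OF deriv] simp: less_imp_neq[THEN not_sym])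
  have "(\<integral>\<^sup>+u. ennreal (triangle_kernel \<alpha> x y u) * F u \<partial>lborel)
     = (\<integral>\<^sup>+u. ennreal (triangle_kernel \<alpha> x y u) * F u * indicator {?u 0..?u pi} u \<partial>lborel)"
    unfolding u0 upi by (intro nn_integral_cong) (auto simp: triangle_kernel_def indicator_def)
  also have "\<dots> = (\<integral>\<^sup>+\<theta>. ennreal (triangle_kernel \<alpha> x y (?u \<theta>)) * F (?u \<theta>) * ennreal (?u' \<theta>) * indicator {0..pi} \<theta> \<partial>lborel)"
    using cont xy by (intro nn_integral_substitution_aux) (auto intro!: deriv divide_nonneg_nonneg mult_nonneg_nonneg sin_ge_zero)
  also have "\<dots> = (\<integral>\<^sup>+\<theta>. ennreal (y powr (2*\<alpha>+1)) * (ennreal (indicator {0..pi} \<theta> * sin \<theta> powr (2 * \<alpha>)) * F (?u \<theta>)) \<partial>lborel)"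
  proof (rule nn_integral_cong_AE)
    have "AE \<theta> in lborel. \<theta> \<noteq> 0 \<and> \<theta> \<noteq> pi"
      by (intro AE_conjI AE_lborel_singleton)
    then show "AE \<theta> in lborel. ennreal (triangle_kernel \<alpha> x y (?u \<theta>)) * F (?u \<theta>) * ennreal (?u' \<theta>) * indicator {0..pi} \<theta> =
      ennreal (y powr (2*\<alpha>+1)) * (ennreal (indicator {0..pi} \<theta> * sin \<theta> powr (2 * \<alpha>)) * F (?u \<theta>))"
    proof eventually_elim
      case (elim \<theta>)
      show ?case
      proof (cases "\<theta> \<in> {0..pi}")
        case True
        with elim have th: "0 < \<theta>" "\<theta> < pi" by auto
        have "ennreal (triangle_kernel \<alpha> x y (?u \<theta>)) * ennreal (?u' \<theta>) = ennreal (y powr (2*\<alpha>+1)) * ennreal (sin \<theta> powr (2*\<alpha>))"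
          using triangle_kernel_dunkl_arg[OF xy th, of \<alpha>] xy th upos[of \<theta>] sin_gt_zero[OF th]
          by (simp flip: ennreal_mult'')
        then show ?thesis using True by (simp add: mult_ac)
      qed auto
    qed
  qed
  also have "\<dots> = ennreal (y powr (2 * \<alpha> + 1)) * (\<integral>\<^sup>+\<theta>. F (?u \<theta>) \<partial>angular_measure \<alpha>)"
    by (subst nn_integral_cmult) (auto simp: nn_integral_angular_measure)
  finally show ?thesis by simp
qed

text \<open>The measure \<open>y\<^sup>2\<^sup>\<alpha>\<^sup>+\<^sup>1 sin\<^sup>2\<^sup>\<alpha> \<theta> dy d\<theta>\<close> is \<open>z\<^sub>2\<^sup>2\<^sup>\<alpha> dz\<close> in polar coordinates on the upper half-plane. Taking
the pole at the origin or at the point \<open>(x, 0)\<close> exchanges \<open>y\<close> with the distance \<open>u\<close> to that point. In terms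
of \<open>y\<close> and \<open>u\<close> this invariance is the symmetry of the triangle kernel.\<close>

lemma nn_integral_dunkl_arg_swap:
  assumes G[measurable]: "G \<in> borel_measurable (borel \<Otimes>\<^sub>M borel)" and x: "0 < x"
  shows "(\<integral>\<^sup>+y. indicator {0<..} y * (ennreal (y powr (2 * \<alpha> + 1)) *
             (\<integral>\<^sup>+\<theta>. G (y, dunkl_arg x y \<theta>) \<partial>angular_measure \<alpha>)) \<partial>lborel)
       = (\<integral>\<^sup>+u. indicator {0<..} u * (ennreal (u powr (2 * \<alpha> + 1)) *
             (\<integral>\<^sup>+\<theta>. G (dunkl_arg x u \<theta>, u) \<partial>angular_measure \<alpha>)) \<partial>lborel)"
proof -
  let ?A = "angular_measure \<alpha>"
  have *: "(\<integral>\<^sup>+y. indicator {0<..} y * (ennreal (y powr (2 * \<alpha> + 1)) *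
             (\<integral>\<^sup>+\<theta>. H (y, dunkl_arg x y \<theta>) \<partial>?A)) \<partial>lborel)
     = (\<integral>\<^sup>+y. (\<integral>\<^sup>+u. indicator {0<..} y * indicator {0<..} u * ennreal (triangle_kernel \<alpha> x y u) * H (y, u) \<partial>lborel) \<partial>lborel)"
    if [measurable]: "H \<in> borel_measurable (borel \<Otimes>\<^sub>M borel)" for H :: "real \<times> real \<Rightarrow> ennreal"
  proof (rule nn_integral_cong_AE)
    have "AE y in lborel. y \<noteq> x" by (rule AE_lborel_singleton)
    then show "AE y in lborel. indicator {0<..} y * (ennreal (y powr (2 * \<alpha> + 1)) *
             (\<integral>\<^sup>+\<theta>. H (y, dunkl_arg x y \<theta>) \<partial>?A))
       = (\<integral>\<^sup>+u. indicator {0<..} y * indicator {0<..} u * ennreal (triangle_kernel \<alpha> x y u) * H (y, u) \<partial>lborel)"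
    proof eventually_elim
      case (elim y)
      show ?case
      proof (cases "y > 0")
        case True
        have "ennreal (y powr (2 * \<alpha> + 1)) * (\<integral>\<^sup>+\<theta>. H (y, dunkl_arg x y \<theta>) \<partial>?A)
           = (\<integral>\<^sup>+u. ennreal (triangle_kernel \<alpha> x y u) * H (y, u) \<partial>lborel)"
          using True elim x by (intro nn_integral_angular_dunkl_arg) auto
        also have "\<dots> = (\<integral>\<^sup>+u. indicator {0<..} u * ennreal (triangle_kernel \<alpha> x y u) * H (y, u) \<partial>lborel)"
        proof (intro nn_integral_cong)
          fix u show "ennreal (triangle_kernel \<alpha> x y u) * H (y, u) = indicator {0<..} u * ennreal (triangle_kernel \<alpha> x y u) * H (y, u)"
          proof (cases "u > 0")
            case False
            then have "triangle_kernel \<alpha> x y u = 0"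
              by (cases "u = 0") (auto simp: triangle_kernel_def indicator_def)
            then show ?thesis by simp
          qed auto
        qed
        finally show ?thesis using True by simp
      qed auto
    qed
  qed
  have k: "triangle_kernel \<alpha> x (snd z) (fst z) = triangle_kernel \<alpha> x (fst z) (snd z)" for z :: "real \<times> real"
    by (rule triangle_kernel_commute)
  have "(\<integral>\<^sup>+y. (\<integral>\<^sup>+u. indicator {0<..} y * indicator {0<..} u * ennreal (triangle_kernel \<alpha> x y u) * G (y, u) \<partial>lborel) \<partial>lborel)
     = (\<integral>\<^sup>+u. (\<integral>\<^sup>+y. indicator {0<..} y * indicator {0<..} u * ennreal (triangle_kernel \<alpha> x y u) * G (y, u) \<partial>lborel) \<partial>lborel)"
  proof -
    have [measurable]: "(\<lambda>(y,u). indicator {0<..} y * indicator {0<..} u * ennreal (triangle_kernel \<alpha> x y u) * G (y, u)) \<in> borel_measurable (borel \<Otimes>\<^sub>M borel)"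
      unfolding split_beta' by measurable
    show ?thesis
      using lborel_pair.Fubini'[of "\<lambda>y u. indicator {0<..} y * indicator {0<..} u * ennreal (triangle_kernel \<alpha> x y u) * G (y, u)"]
      by simp
  qed
  also have "\<dots> = (\<integral>\<^sup>+u. (\<integral>\<^sup>+y. indicator {0<..} u * indicator {0<..} y * ennreal (triangle_kernel \<alpha> x u y) * G (y, u) \<partial>lborel) \<partial>lborel)"
    by (simp add: triangle_kernel_commute[of \<alpha> x] mult_ac)
  also have "\<dots> = (\<integral>\<^sup>+u. indicator {0<..} u * (ennreal (u powr (2 * \<alpha> + 1)) *
             (\<integral>\<^sup>+\<theta>. G (dunkl_arg x u \<theta>, u) \<partial>?A)) \<partial>lborel)"
    using *[of "\<lambda>(u,y). G (y, u)"] by (simp add: split_beta')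
  finally show ?thesis using *[OF G] by simp
qed

section \<open>Translates of balls\<close>

text \<open>The translation of an even function, given by its values on \<open>[0, \<infinity>)\<close>: the odd part of the defining
integrand vanishes and a nonnegative integral remains.\<close>

definition radial_translation :: "real \<Rightarrow> (real \<Rightarrow> ennreal) \<Rightarrow> real \<Rightarrow> real \<Rightarrow> ennreal" where
  "radial_translation \<alpha> G x y =
     (if \<alpha> = - 1 / 2 then G \<bar>x + y\<bar>
      else ennreal (dunkl_const \<alpha>) * (\<integral>\<^sup>+\<theta>. ennreal (1 - cos \<theta>) * G (dunkl_arg x y \<theta>) \<partial>angular_measure \<alpha>))"

definition ball_weight :: "real \<Rightarrow> real \<Rightarrow> real \<Rightarrow> real \<Rightarrow> ennreal" where
  "ball_weight \<alpha> r = radial_translation \<alpha> (indicator {..<r})"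

lemma radial_translation_commute: "radial_translation \<alpha> G x y = radial_translation \<alpha> G y x"
  by (simp add: radial_translation_def dunkl_arg_commute[of x y] add.commute)

lemma radial_translation_minus: "radial_translation \<alpha> G (-x) (-y) = radial_translation \<alpha> G x y"
proof -
  have "\<bar>- x + - y\<bar> = \<bar>x + y\<bar>" by linarith
  then show ?thesis by (simp only: radial_translation_def dunkl_arg_minus)
qed

lemma ball_weight_commute: "ball_weight \<alpha> r x y = ball_weight \<alpha> r y x"
  and ball_weight_minus: "ball_weight \<alpha> r (-x) (-y) = ball_weight \<alpha> r x y"
  by (simp_all add: ball_weight_def radial_translation_minus) (rule radial_translation_commute)

lemma measurable_radial_translation [measurable (raw)]:
  assumes [measurable]: "G \<in> borel_measurable borel" "f \<in> borel_measurable M" "g \<in> borel_measurable M"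
  shows "(\<lambda>z. radial_translation \<alpha> G (f z) (g z)) \<in> borel_measurable M"
proof -
  interpret sigma_finite_measure "angular_measure \<alpha>" by (rule sigma_finite_angular_measure)
  have "(\<lambda>(x,y). radial_translation \<alpha> G x y) \<in> borel_measurable (borel \<Otimes>\<^sub>M borel)"
    unfolding radial_translation_def by measurable
  from measurable_compose[OF measurable_Pair[OF assms(2,3)] this] show ?thesis by simp
qed

lemma measurable_ball_weight [measurable (raw)]:
  assumes [measurable]: "f \<in> borel_measurable M" "g \<in> borel_measurable M"
  shows "(\<lambda>z. ball_weight \<alpha> r (f z) (g z)) \<in> borel_measurable M"
  unfolding ball_weight_def by measurable

lemma radial_translation_mono:
  assumes "\<And>u. 0 \<le> u \<Longrightarrow> G u \<le> H u"
  shows "radial_translation \<alpha> G x y \<le> radial_translation \<alpha> H x y"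
  unfolding radial_translation_def by (auto intro!: mult_left_mono nn_integral_mono assms)

lemma radial_translation_suminf:
  assumes [measurable]: "\<And>n::nat. G n \<in> borel_measurable borel"
  shows "radial_translation \<alpha> (\<lambda>u. \<Sum>n. G n u) x y = (\<Sum>n. radial_translation \<alpha> (G n) x y)"
proof (cases "\<alpha> = -1/2")
  case False
  have "(\<integral>\<^sup>+\<theta>. ennreal (1 - cos \<theta>) * (\<Sum>n. G n (dunkl_arg x y \<theta>)) \<partial>angular_measure \<alpha>)
     = (\<Sum>n. \<integral>\<^sup>+\<theta>. ennreal (1 - cos \<theta>) * G n (dunkl_arg x y \<theta>) \<partial>angular_measure \<alpha>)"
    by (subst nn_integral_suminf[symmetric]) (simp_all only: ennreal_suminf_cmult, measurable)
  then show ?thesis using False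
    by (simp only: radial_translation_def if_False ennreal_suminf_cmult)
qed (simp add: radial_translation_def)

lemma radial_translation_cmult:
  assumes [measurable]: "G \<in> borel_measurable borel"
  shows "radial_translation \<alpha> (\<lambda>u. c * G u) x y = c * radial_translation \<alpha> G x y"
  unfolding radial_translation_def
  by (auto simp: nn_integral_cmult mult_ac)

text \<open>Where the integral defining the translate diverges, the left-hand side is \<open>0\<close> by convention.\<close>

lemma abs_dunkl_translation_even_le:
  assumes K: "K \<in> borel_measurable borel" and even: "\<And>u. K (-u) = K u" and \<alpha>: "\<alpha> \<ge> -1/2"
  shows "ennreal \<bar>dunkl_translation \<alpha> x K y\<bar> \<le> radial_translation \<alpha> (\<lambda>u. ennreal \<bar>K u\<bar>) x y"
proof (cases "\<alpha> = -1/2")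
  case True
  then show ?thesis using even[of "x+y"]
    by (cases "x + y \<ge> 0") (simp_all add: dunkl_translation_def radial_translation_def)
next
  case False
  with \<alpha> have c: "dunkl_const \<alpha> > 0" by (intro dunkl_const_pos) simp
  note [measurable] = K
  define F where "F = (\<lambda>\<theta>. indicator {0..pi} \<theta> * (2 * K (dunkl_arg x y \<theta>) * (1 - cos \<theta>) * sin \<theta> powr (2 * \<alpha>)))"
  have [measurable]: "F \<in> borel_measurable borel" unfolding F_def by measurable
  have eq: "dunkl_translation \<alpha> x K y = dunkl_const \<alpha> / 2 * (\<integral>\<theta>. F \<theta> \<partial>lborel)"
    using False unfolding dunkl_translation_def F_def set_lebesgue_integral_def by (simp add: even)
  have "ennreal \<bar>\<integral>\<theta>. F \<theta> \<partial>lborel\<bar> \<le> (\<integral>\<^sup>+\<theta>. ennreal \<bar>F \<theta>\<bar> \<partial>lborel)"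
  proof (cases "integrable lborel F")
    case True
    then show ?thesis using integral_norm_bound_ennreal[OF True] by simp
  qed (simp add: not_integrable_integral_eq)
  also have "\<dots> = (\<integral>\<^sup>+\<theta>. 2 * (ennreal (indicator {0..pi} \<theta> * sin \<theta> powr (2 * \<alpha>)) * (ennreal (1 - cos \<theta>) * ennreal \<bar>K (dunkl_arg x y \<theta>)\<bar>)) \<partial>lborel)"
    by (intro nn_integral_cong)
       (auto simp: F_def abs_mult indicator_def mult_ac simp flip: ennreal_mult'' ennreal_numeral)
  also have "\<dots> = 2 * (\<integral>\<^sup>+\<theta>. ennreal (1 - cos \<theta>) * ennreal \<bar>K (dunkl_arg x y \<theta>)\<bar> \<partial>angular_measure \<alpha>)"
    by (subst nn_integral_cmult) (auto simp: nn_integral_angular_measure)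
  finally have "ennreal (dunkl_const \<alpha> / 2) * ennreal \<bar>\<integral>\<theta>. F \<theta> \<partial>lborel\<bar>
      \<le> ennreal (dunkl_const \<alpha> / 2) * (2 * (\<integral>\<^sup>+\<theta>. ennreal (1 - cos \<theta>) * ennreal \<bar>K (dunkl_arg x y \<theta>)\<bar> \<partial>angular_measure \<alpha>))"
    by (rule mult_left_mono) simp
  also have "\<dots> = ennreal (dunkl_const \<alpha>) * (\<integral>\<^sup>+\<theta>. ennreal (1 - cos \<theta>) * ennreal \<bar>K (dunkl_arg x y \<theta>)\<bar> \<partial>angular_measure \<alpha>)"
    using c by (simp add: mult.assoc[symmetric] flip: ennreal_mult'' ennreal_numeral)
  finally show ?thesis
    using False c unfolding eq radial_translation_def by (simp add: abs_mult flip: ennreal_mult')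
qed

lemma measurable_dunkl_translation [measurable]:
  assumes [measurable]: "g \<in> borel_measurable borel"
  shows "(\<lambda>(x, y). dunkl_translation \<alpha> x g y) \<in> borel_measurable (borel \<Otimes>\<^sub>M borel)"
  unfolding dunkl_translation_def set_lebesgue_integral_def by measurable

lemma ball_weight_eq_0: 
  assumes "r \<le> \<bar>\<bar>x\<bar> - \<bar>y\<bar>\<bar>"
  shows "ball_weight \<alpha> r x y = 0"
proof -
  have "\<not> dunkl_arg x y \<theta> < r" for \<theta> using dunkl_arg_lower[of x y \<theta>] assms by linarith
  moreover have "\<not> \<bar>x + y\<bar> < r" using assms by linarith
  ultimately show ?thesis unfolding ball_weight_def radial_translation_def by simp
qed

text \<open>If \<open>\<bar>x\<bar> \<ge> 2 r\<close> and \<open>u = dunkl_arg x y \<theta> < r\<close>, then \<open>\<theta>\<close> or \<open>\<pi> - \<theta>\<close> (according to the sign of \<open>x y\<close>) is at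
most of order \<open>r / \<bar>x\<bar>\<close>, so the weight is bounded by the measure of a cap of that radius.\<close>

lemma ball_weight_le:
  assumes \<alpha>: "\<alpha> \<ge> -1/2"
  obtains C :: real where "0 < C"
    "\<And>x r y. 0 < r \<Longrightarrow> ball_weight \<alpha> r x y \<le> ennreal (C * (r / (\<bar>x\<bar> + r)) powr (2 * \<alpha> + 1))"
proof (cases "\<alpha> = -1/2")
  case True
  show ?thesis
    by (rule that[of 1]) (auto simp: True ball_weight_def radial_translation_def indicator_def)
next
  case False
  with \<alpha> have \<alpha>: "\<alpha> > -1/2" by simp
  note c = dunkl_const_pos[OF \<alpha>]
  obtain C1 where C1: "0 < C1" "\<And>\<delta>. 0 < \<delta> \<Longrightarrow> \<delta> \<le> 1 \<Longrightarrow> angular_cap \<alpha> \<delta> \<le> ennreal (C1 * \<delta> powr (2*\<alpha>+1))"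
    using angular_cap_bounds[OF \<alpha>] by metis
  define m where "m = enn2real (emeasure (angular_measure \<alpha>) UNIV)"
  have m: "emeasure (angular_measure \<alpha>) UNIV = ennreal m" "0 \<le> m"
    using finite_angular_measure[OF \<alpha>] by (auto simp: m_def)
  define a where "a = 2 * \<alpha> + 1"
  have a: "a > 0" using \<alpha> by (simp add: a_def)
  define c where "c = dunkl_const \<alpha>"
  have c0: "c > 0" using c by (simp add: c_def)
  show ?thesis
  proof (rule that[of "c * (2 * m * 3 powr a + 4 * C1 * 2 powr a)"])
    show "0 < c * (2 * m * 3 powr a + 4 * C1 * 2 powr a)" using c0 m C1 by (auto intro!: mult_pos_pos add_nonneg_pos)
    fix x r y :: real assume r: "0 < r"
    define \<delta> where "\<delta> = r / (\<bar>x\<bar> + r)"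
    have d: "0 < \<delta>" "\<delta> \<le> 1" using r by (auto simp: \<delta>_def)
    have "(\<integral>\<^sup>+\<theta>. ennreal (1 - cos \<theta>) * indicator {..<r} (dunkl_arg x y \<theta>) \<partial>angular_measure \<alpha>)
       \<le> ennreal ((2 * m * 3 powr a + 4 * C1 * 2 powr a) * \<delta> powr a)"
    proof (cases "\<bar>x\<bar> < 2 * r")
      case True
      have "1 / 3 \<le> \<delta>" using True r by (auto simp: \<delta>_def field_simps)
      then have "(1/3) powr a \<le> \<delta> powr a" using a by (intro powr_mono2) auto
      then have "1 \<le> 3 powr a * \<delta> powr a" by (simp add: powr_divide field_simps)
      have "(\<integral>\<^sup>+\<theta>. ennreal (1 - cos \<theta>) * indicator {..<r} (dunkl_arg x y \<theta>) \<partial>angular_measure \<alpha>)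
        \<le> (\<integral>\<^sup>+\<theta>. 2 \<partial>angular_measure \<alpha>)"
      proof (intro nn_integral_mono)
        fix \<theta>
        have "ennreal (1 - cos \<theta>) \<le> ennreal 2" using cos_ge_minus_one[of \<theta>] by (intro ennreal_leI) linarith
        then show "ennreal (1 - cos \<theta>) * indicator {..<r} (dunkl_arg x y \<theta>) \<le> 2" by (auto simp: indicator_def)
      qed
      also have "\<dots> = ennreal (2 * m)" using m by (simp add: ennreal_mult'')
      also have "2 * m \<le> 2 * m * (3 powr a * \<delta> powr a)" using m \<open>1 \<le> _\<close> by (simp add: mult_le_cancel_left1)
      also have "\<dots> \<le> (2 * m * 3 powr a + 4 * C1 * 2 powr a) * \<delta> powr a"
        using C1 by (simp add: algebra_simps)
      finally show ?thesis by (simp add: ennreal_leI)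
    next
      case False
      have d2: "2 * \<delta> \<le> 1" "0 < 2 * \<delta>" using False r by (auto simp: \<delta>_def field_simps)
      have key: "1 - cos \<theta> < (2*\<delta>)\<^sup>2 \<or> 1 + cos \<theta> < (2*\<delta>)\<^sup>2" if "dunkl_arg x y \<theta> < r" for \<theta>
      proof -
        have xy: "\<bar>x\<bar> - r < \<bar>y\<bar>" using dunkl_arg_lower[of x y \<theta>] that by linarith
        have *: "s < (2*\<delta>)\<^sup>2" if s: "(\<bar>x\<bar> - \<bar>y\<bar>)\<^sup>2 + 2 * \<bar>x\<bar> * \<bar>y\<bar> * s < r\<^sup>2" "0 \<le> s" for s
        proof -
          have "\<bar>x\<bar> \<le> 2 * \<bar>y\<bar>" using xy False by linarith
          then have "\<bar>x\<bar> * \<bar>x\<bar> * s \<le> \<bar>x\<bar> * (2 * \<bar>y\<bar>) * s"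
            using s by (intro mult_right_mono mult_left_mono) auto
          then have "\<bar>x\<bar> * \<bar>x\<bar> * s \<le> 2 * \<bar>x\<bar> * \<bar>y\<bar> * s" by (simp add: mult_ac)
          also have "\<dots> < r\<^sup>2" using s zero_le_power2[of "\<bar>x\<bar> - \<bar>y\<bar>"] by linarith
          finally have "s * (\<bar>x\<bar> * \<bar>x\<bar>) < r\<^sup>2" by (simp only: mult_ac)
          moreover have "0 < \<bar>x\<bar> * \<bar>x\<bar>" using False r by (intro mult_pos_pos) auto
          ultimately have "s < (r / \<bar>x\<bar>)\<^sup>2"
            by (simp only: power2_eq_square times_divide_times_eq pos_less_divide_eq)
          also have "r / \<bar>x\<bar> \<le> 2 * \<delta>" using False r by (auto simp: \<delta>_def field_simps)
          then have "(r / \<bar>x\<bar>)\<^sup>2 \<le> (2 * \<delta>)\<^sup>2" using r by (intro power_mono) auto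
          finally show ?thesis .
        qed
        have sq: "(dunkl_arg x y \<theta>)\<^sup>2 < r\<^sup>2" using that r by (intro power_strict_mono) auto
        have ab: "(\<bar>x\<bar> - \<bar>y\<bar>)\<^sup>2 + 2 * \<bar>x\<bar> * \<bar>y\<bar> * s = x\<^sup>2 + y\<^sup>2 - 2 * (\<bar>x\<bar> * \<bar>y\<bar>) * (1 - s)" for s
          by (simp add: power2_diff algebra_simps)
        show ?thesis
        proof (cases "x * y \<ge> 0")
          case True
          then have "\<bar>x\<bar> * \<bar>y\<bar> = x * y" by (simp flip: abs_mult)
          then have "(\<bar>x\<bar> - \<bar>y\<bar>)\<^sup>2 + 2 * \<bar>x\<bar> * \<bar>y\<bar> * (1 - cos \<theta>) = (dunkl_arg x y \<theta>)\<^sup>2"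
            unfolding ab dunkl_arg_sq by (simp add: algebra_simps)
          with sq *[of "1 - cos \<theta>"] show ?thesis by simp
        next
          case False
          then have "\<bar>x\<bar> * \<bar>y\<bar> = - (x * y)" by (simp flip: abs_mult)
          then have "(\<bar>x\<bar> - \<bar>y\<bar>)\<^sup>2 + 2 * \<bar>x\<bar> * \<bar>y\<bar> * (1 + cos \<theta>) = (dunkl_arg x y \<theta>)\<^sup>2"
            unfolding ab dunkl_arg_sq by (simp add: algebra_simps)
          moreover have "0 \<le> 1 + cos \<theta>" using cos_ge_minus_one[of \<theta>] by linarith
          ultimately show ?thesis using sq *[of "1 + cos \<theta>"] by simp
        qed
      qed
      have "(\<integral>\<^sup>+\<theta>. ennreal (1 - cos \<theta>) * indicator {..<r} (dunkl_arg x y \<theta>) \<partial>angular_measure \<alpha>)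
        \<le> (\<integral>\<^sup>+\<theta>. 2 * (indicator {\<theta>. 1 - cos \<theta> < (2*\<delta>)\<^sup>2} \<theta> + indicator {\<theta>. 1 + cos \<theta> < (2*\<delta>)\<^sup>2} \<theta>) \<partial>angular_measure \<alpha>)"
      proof (intro nn_integral_mono)
        fix \<theta>
        have 2: "ennreal (1 - cos \<theta>) \<le> ennreal 2" using cos_ge_minus_one[of \<theta>] by (intro ennreal_leI) linarith
        show "ennreal (1 - cos \<theta>) * indicator {..<r} (dunkl_arg x y \<theta>) \<le> 
           2 * (indicator {\<theta>. 1 - cos \<theta> < (2*\<delta>)\<^sup>2} \<theta> + indicator {\<theta>. 1 + cos \<theta> < (2*\<delta>)\<^sup>2} \<theta>)"
        proof (cases "dunkl_arg x y \<theta> < r")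
          case True
          from key[OF True] have "(1::ennreal) \<le> indicator {\<theta>. 1 - cos \<theta> < (2*\<delta>)\<^sup>2} \<theta> + indicator {\<theta>. 1 + cos \<theta> < (2*\<delta>)\<^sup>2} \<theta>"
            by (auto simp: indicator_def)
          then have "ennreal 2 * 1 \<le> 2 * (indicator {\<theta>. 1 - cos \<theta> < (2*\<delta>)\<^sup>2} \<theta> + indicator {\<theta>. 1 + cos \<theta> < (2*\<delta>)\<^sup>2} \<theta>)"
            by (intro mult_mono) auto
          with 2 have "ennreal (1 - cos \<theta>) \<le> 2 * (indicator {\<theta>. 1 - cos \<theta> < (2*\<delta>)\<^sup>2} \<theta> + indicator {\<theta>. 1 + cos \<theta> < (2*\<delta>)\<^sup>2} \<theta>)"
            unfolding mult_1_right by (rule order.trans)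
          with True show ?thesis by (simp only: lessThan_iff indicator_simps mult_1_right)
        qed auto
      qed
      also have "\<dots> = 2 * (angular_cap \<alpha> (2*\<delta>) + angular_cap \<alpha> (2*\<delta>))"
        by (subst nn_integral_cmult, simp, subst nn_integral_add, simp, simp, simp only: angular_cap_reflect angular_cap_def)
      also have "\<dots> \<le> 2 * (ennreal (C1 * (2*\<delta>) powr a) + ennreal (C1 * (2*\<delta>) powr a))"
        using C1(2)[OF d2(2) d2(1)] unfolding a_def by (intro mult_left_mono add_mono) auto
      also have "\<dots> = ennreal (4 * C1 * 2 powr a * \<delta> powr a)"
      proof -
        have "2 * (ennreal z + ennreal z) = ennreal (4 * z)" if "0 \<le> z" for z
        proof -
          have "ennreal (4 * z) = ennreal (2 * (z + z))" by simp
          also have "\<dots> = ennreal 2 * ennreal (z + z)"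
            by (rule ennreal_mult) (use that in auto)
          also have "ennreal (z + z) = ennreal z + ennreal z"
            by (rule ennreal_plus) (use that in auto)
          finally show ?thesis by simp
        qed
        from this[of "C1 * (2*\<delta>) powr a"] C1 d show ?thesis by (simp add: powr_mult mult.assoc)
      qed
      also have "\<dots> \<le> ennreal ((2 * m * 3 powr a + 4 * C1 * 2 powr a) * \<delta> powr a)"
        using m by (intro ennreal_leI mult_right_mono) auto
      finally show ?thesis .
    qed
    then have "ennreal c * (\<integral>\<^sup>+\<theta>. ennreal (1 - cos \<theta>) * indicator {..<r} (dunkl_arg x y \<theta>) \<partial>angular_measure \<alpha>)
        \<le> ennreal c * ennreal ((2 * m * 3 powr a + 4 * C1 * 2 powr a) * \<delta> powr a)"
      by (rule mult_left_mono) simp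
    then show "ball_weight \<alpha> r x y \<le> ennreal (c * (2 * m * 3 powr a + 4 * C1 * 2 powr a) * (r / (\<bar>x\<bar> + r)) powr (2 * \<alpha> + 1))"
      using False c0 by (simp add: ball_weight_def radial_translation_def c_def[symmetric] a_def[symmetric] \<delta>_def[symmetric] mult.assoc flip: ennreal_mult')
  qed
qed

text \<open>After replacing \<open>x\<close> by \<open>-x\<close> if necessary, \<open>x y \<le> 0\<close>. Then
\<open>u\<^sup>2 = (\<bar>x\<bar> - \<bar>y\<bar>)\<^sup>2 + 2 \<bar>x y\<bar> (1 + cos \<theta>)\<close>, and the ball of radius \<open>4 r\<close> contains all \<open>u\<close> with \<open>\<theta>\<close> in a
cap around \<open>\<pi>\<close>, where \<open>1 - cos \<theta> \<ge> 1\<close>.\<close>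

lemma ball_weight_pair_ge:
  assumes \<alpha>: "\<alpha> \<ge> -1/2"
  obtains c :: real where "0 < c"
    "\<And>x r y. 0 < r \<Longrightarrow> \<bar>\<bar>x\<bar> - \<bar>y\<bar>\<bar> < 2 * r \<Longrightarrow>
       ennreal (c * (r / (\<bar>x\<bar> + r)) powr (2 * \<alpha> + 1)) \<le> ball_weight \<alpha> (4 * r) x y + ball_weight \<alpha> (4 * r) (-x) y"
proof (cases "\<alpha> = -1/2")
  case True
  show ?thesis
  proof (rule that[of 1])
    fix x r y :: real assume r: "0 < r" "\<bar>\<bar>x\<bar> - \<bar>y\<bar>\<bar> < 2 * r"
    then have "\<bar>x + y\<bar> < 4 * r \<or> \<bar>- x + y\<bar> < 4 * r" by linarith
    then show "ennreal (1 * (r / (\<bar>x\<bar> + r)) powr (2 * \<alpha> + 1)) \<le> ball_weight \<alpha> (4 * r) x y + ball_weight \<alpha> (4 * r) (-x) y"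
      using r by (auto simp: True ball_weight_def radial_translation_def indicator_def)
  qed simp
next
  case False
  with \<alpha> have \<alpha>: "\<alpha> > -1/2" by simp
  note c = dunkl_const_pos[OF \<alpha>]
  obtain c1 where c1: "0 < c1" "\<And>\<delta>. 0 < \<delta> \<Longrightarrow> \<delta> \<le> 1 \<Longrightarrow> ennreal (c1 * \<delta> powr (2*\<alpha>+1)) \<le> angular_cap \<alpha> \<delta>"
    using angular_cap_bounds[OF \<alpha>] by metis
  show ?thesis
  proof (rule that[of "dunkl_const \<alpha> * c1"])
    show "0 < dunkl_const \<alpha> * c1" using c c1 by simp
    fix x r y :: real assume r: "0 < r" "\<bar>\<bar>x\<bar> - \<bar>y\<bar>\<bar> < 2 * r"
    define \<delta> where "\<delta> = r / (\<bar>x\<bar> + r)"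
    have d: "0 < \<delta>" "\<delta> \<le> 1" using r by (auto simp: \<delta>_def)
    have main: "ennreal (dunkl_const \<alpha> * c1 * (r / (\<bar>x\<bar> + r)) powr (2 * \<alpha> + 1)) \<le> ball_weight \<alpha> (4 * r) z y"
      if z: "\<bar>z\<bar> = \<bar>x\<bar>" "z * y \<le> 0" for z
    proof -
      have inc: "1 \<le> 1 - cos \<theta> \<and> dunkl_arg z y \<theta> < 4 * r" if th: "1 + cos \<theta> < \<delta>\<^sup>2" for \<theta>
      proof
        have "\<delta>\<^sup>2 \<le> 1" using d by (simp add: power_le_one)
        then show "1 \<le> 1 - cos \<theta>" using th by linarith
        have ax: "\<bar>x\<bar> * \<bar>y\<bar> = - (z * y)" using z by (metis abs_mult abs_of_nonpos)
        have "x\<^sup>2 = z\<^sup>2" using z by (metis power2_abs)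
        then have "(dunkl_arg z y \<theta>)\<^sup>2 = (\<bar>x\<bar> - \<bar>y\<bar>)\<^sup>2 + 2 * (\<bar>x\<bar> * \<bar>y\<bar>) * (1 + cos \<theta>)"
        proof -
          have "(\<bar>x\<bar> - \<bar>y\<bar>)\<^sup>2 = x\<^sup>2 + y\<^sup>2 - 2 * (\<bar>x\<bar> * \<bar>y\<bar>)" by (simp add: power2_diff)
          then show ?thesis unfolding ax \<open>x\<^sup>2 = z\<^sup>2\<close> dunkl_arg_sq by (simp add: algebra_simps)
        qed
        also have "(\<bar>x\<bar> - \<bar>y\<bar>)\<^sup>2 \<le> (2 * r)\<^sup>2" using r by (intro power2_le_iff_abs_le[THEN iffD2]) auto
        also have "2 * (\<bar>x\<bar> * \<bar>y\<bar>) * (1 + cos \<theta>) \<le> 2 * (\<bar>x\<bar> + r)\<^sup>2 * \<delta>\<^sup>2"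
        proof (intro mult_mono)
          have "\<bar>x\<bar> * \<bar>y\<bar> \<le> \<bar>x\<bar> * (\<bar>x\<bar> + 2 * r)" using r by (intro mult_left_mono) auto
          also have "\<dots> \<le> (\<bar>x\<bar> + r)\<^sup>2" by (simp add: power2_eq_square algebra_simps)
          finally show "\<bar>x\<bar> * \<bar>y\<bar> \<le> (\<bar>x\<bar> + r)\<^sup>2" .
          show "0 \<le> 1 + cos \<theta>" using cos_ge_minus_one[of \<theta>] by linarith
        qed (use th in auto)
        also have "2 * (\<bar>x\<bar> + r)\<^sup>2 * \<delta>\<^sup>2 = 2 * r\<^sup>2" using r by (simp add: \<delta>_def power_divide)
        also have "(2 * r)\<^sup>2 + 2 * r\<^sup>2 < (4 * r)\<^sup>2" using r by (simp add: power_mult_distrib)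
        finally have "(dunkl_arg z y \<theta>)\<^sup>2 < (4 * r)\<^sup>2" by simp
        then show "dunkl_arg z y \<theta> < 4 * r" by (rule power2_less_imp_less) (use r in simp)
      qed
      have "ennreal (c1 * \<delta> powr (2 * \<alpha> + 1)) \<le> angular_cap \<alpha> \<delta>" by (intro c1 d)
      also have "\<dots> = (\<integral>\<^sup>+\<theta>. indicator {\<theta>. 1 + cos \<theta> < \<delta>\<^sup>2} \<theta> \<partial>angular_measure \<alpha>)" by (simp only: angular_cap_reflect)
      also have "\<dots> \<le> (\<integral>\<^sup>+\<theta>. ennreal (1 - cos \<theta>) * indicator {..<4 * r} (dunkl_arg z y \<theta>) \<partial>angular_measure \<alpha>)"
        using inc by (intro nn_integral_mono) (auto simp: indicator_def)
      finally have "ennreal (dunkl_const \<alpha>) * ennreal (c1 * \<delta> powr (2 * \<alpha> + 1)) \<le> ennreal (dunkl_const \<alpha>) * \<dots>"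
        by (rule mult_left_mono) simp
      moreover have "ennreal (dunkl_const \<alpha>) * ennreal (c1 * \<delta> powr (2 * \<alpha> + 1))
          = ennreal (dunkl_const \<alpha> * c1 * \<delta> powr (2 * \<alpha> + 1))"
        using c c1 by (simp add: mult.assoc flip: ennreal_mult)
      ultimately show ?thesis using False
        by (simp only: ball_weight_def radial_translation_def \<delta>_def if_False)
    qed
    show "ennreal (dunkl_const \<alpha> * c1 * (r / (\<bar>x\<bar> + r)) powr (2 * \<alpha> + 1)) \<le> ball_weight \<alpha> (4 * r) x y + ball_weight \<alpha> (4 * r) (-x) y"
    proof (cases "x * y \<le> 0")
      case True
      then show ?thesis using main[of x] by (simp add: add_increasing2)
    next
      case False
      then show ?thesis using main[of "-x"] by (simp add: add_increasing)
    qed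
  qed
qed

lemma ball_weight_0_nonzero:
  assumes \<alpha>: "\<alpha> \<ge> -1/2" and "0 < r" "\<bar>y\<bar> < r / 2"
  shows "ball_weight \<alpha> r 0 y \<noteq> 0"
proof -
  obtain c where c: "0 < c" "\<And>x r y. 0 < r \<Longrightarrow> \<bar>\<bar>x\<bar> - \<bar>y\<bar>\<bar> < 2 * r \<Longrightarrow>
      ennreal (c * (r / (\<bar>x\<bar> + r)) powr (2 * \<alpha> + 1)) \<le> ball_weight \<alpha> (4 * r) x y + ball_weight \<alpha> (4 * r) (-x) y"
    using ball_weight_pair_ge[OF \<alpha>] by metis
  show ?thesis using c(2)[of "r / 4" 0 y] c(1) assms by auto
qed

section \<open>The Dunkl measure\<close>

definition dunkl_density :: "real \<Rightarrow> real \<Rightarrow> real" where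
  "dunkl_density \<alpha> x = \<bar>x\<bar> powr (2 * \<alpha> + 1) / (2 powr (\<alpha> + 1) * Gamma (\<alpha> + 1))"

lemma dunkl_measure_eq: "dunkl_measure \<alpha> = density lborel (\<lambda>x. ennreal (dunkl_density \<alpha> x))"
  by (simp add: dunkl_measure_def dunkl_density_def)

lemma measurable_dunkl_density [measurable]: "dunkl_density \<alpha> \<in> borel_measurable borel"
  unfolding dunkl_density_def by measurable

lemma sets_dunkl_measure [measurable_cong, simp]: "sets (dunkl_measure \<alpha>) = sets borel"
  and space_dunkl_measure [simp]: "space (dunkl_measure \<alpha>) = UNIV"
  by (simp_all add: dunkl_measure_def)

lemma nn_integral_dunkl_measure:
  assumes [measurable]: "F \<in> borel_measurable borel"
  shows "(\<integral>\<^sup>+x. F x \<partial>dunkl_measure \<alpha>) = (\<integral>\<^sup>+x. ennreal (dunkl_density \<alpha> x) * F x \<partial>lborel)"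
  unfolding dunkl_measure_eq by (subst nn_integral_density) auto

lemma sigma_finite_dunkl_measure: "sigma_finite_measure (dunkl_measure \<alpha>)"
  unfolding dunkl_measure_def
  by (subst sigma_finite_measure.sigma_finite_iff_density_finite[OF sigma_finite_lborel]) auto

lemma AE_lborel_imp_AE_dunkl_measure:
  assumes "AE x in lborel. P x"
  shows "AE x in dunkl_measure \<alpha>. P x"
  using assms unfolding dunkl_measure_def by (subst AE_density) auto

lemma nn_integral_dunkl_measure_reflect:
  assumes [measurable]: "F \<in> borel_measurable borel"
  shows "(\<integral>\<^sup>+x. F (- x) \<partial>dunkl_measure \<alpha>) = (\<integral>\<^sup>+x. F x \<partial>dunkl_measure \<alpha>)"
proof -
  let ?M = "dunkl_measure \<alpha>"
  have "(\<integral>\<^sup>+x. F x \<partial>?M)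
     = (\<integral>\<^sup>+x. ennreal (dunkl_density \<alpha> (0 + (-1) * x)) * F (0 + (-1) * x) \<partial>lborel)"
    by (subst nn_integral_dunkl_measure[OF assms], subst nn_integral_real_affine[where c="-1" and t=0]) auto
  also have "\<dots> = (\<integral>\<^sup>+x. ennreal (dunkl_density \<alpha> x) * F (- x) \<partial>lborel)"
    by (simp add: dunkl_density_def)
  also have "\<dots> = (\<integral>\<^sup>+x. F (- x) \<partial>?M)"
    by (subst nn_integral_dunkl_measure) auto
  finally show ?thesis by simp
qed

lemma distr_eq_selfI:
  assumes M: "sets M = sets borel" and [measurable]: "f \<in> borel_measurable M"
    and inv: "\<And>F. F \<in> borel_measurable borel \<Longrightarrow> (\<integral>\<^sup>+x. F (f x) \<partial>M) = (\<integral>\<^sup>+x. F x \<partial>M)"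
  shows "distr M borel f = M"
proof (rule measure_eqI)
  fix A assume "A \<in> sets (distr M borel f)"
  then have [measurable]: "A \<in> sets borel" and A: "A \<in> sets M" using M by simp_all
  have "emeasure (distr M borel f) A = (\<integral>\<^sup>+x. indicator A x \<partial>distr M borel f)"
    by simp
  also have "\<dots> = (\<integral>\<^sup>+x. indicator A (f x) \<partial>M)"
    by (subst nn_integral_distr) auto
  also have "\<dots> = emeasure M A"
    using A by (subst inv) auto
  finally show "emeasure (distr M borel f) A = emeasure M A" .
qed (simp add: M)

lemma distr_dunkl_measure_reflect: "distr (dunkl_measure \<alpha>) borel uminus = dunkl_measure \<alpha>"
  by (rule distr_eq_selfI) (simp_all add: nn_integral_dunkl_measure_reflect)

lemma distr_angular_measure_reflect: "distr (angular_measure \<alpha>) borel (\<lambda>\<theta>. pi - \<theta>) = angular_measure \<alpha>"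
  by (rule distr_eq_selfI) (simp_all add: nn_integral_angular_reflect)

abbreviation ball_integral :: "real \<Rightarrow> real \<Rightarrow> (real \<Rightarrow> ennreal) \<Rightarrow> real \<Rightarrow> ennreal" where
  "ball_integral \<alpha> r h x \<equiv> (\<integral>\<^sup>+y. h y * ball_weight \<alpha> r x y \<partial>dunkl_measure \<alpha>)"

text \<open>The bound on the weight times the measure of \<open>\<bar>\<bar>x\<bar> - \<bar>y\<bar>\<bar> < r\<close>: the powers of \<open>\<bar>x\<bar> + r\<close> cancel.\<close>

lemma nn_integral_ball_weight_le:
  assumes \<alpha>: "\<alpha> \<ge> -1/2"
  obtains C :: real where "0 < C"
    "\<And>x r. 0 < r \<Longrightarrow> (\<integral>\<^sup>+y. ball_weight \<alpha> r x y \<partial>dunkl_measure \<alpha>) \<le> ennreal (C * r powr dunkl_dim \<alpha>)"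
proof -
  let ?M = "dunkl_measure \<alpha>"
  obtain C where C: "0 < C" "\<And>x r y. 0 < r \<Longrightarrow> ball_weight \<alpha> r x y \<le> ennreal (C * (r / (\<bar>x\<bar> + r)) powr (2 * \<alpha> + 1))"
    using ball_weight_le[OF \<alpha>] by metis
  define A where "A = 2 powr (\<alpha> + 1) * Gamma (\<alpha> + 1)"
  have A: "A > 0" using \<alpha> unfolding A_def by (intro mult_pos_pos Gamma_real_pos) auto
  show ?thesis
  proof (rule that[of "4 * C / A"])
    show "0 < 4 * C / A" using C A by simp
    fix x r :: real assume r: "0 < r"
    let ?S = "{- (\<bar>x\<bar> + r) .. - (\<bar>x\<bar> - r)} \<union> {\<bar>x\<bar> - r .. \<bar>x\<bar> + r}"
    let ?K = "C * (r / (\<bar>x\<bar> + r)) powr (2 * \<alpha> + 1) * ((\<bar>x\<bar> + r) powr (2 * \<alpha> + 1) / A)"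
    have K: "?K = C / A * r powr (2 * \<alpha> + 1)" using r by (simp add: powr_divide)
    have "(\<integral>\<^sup>+y. ball_weight \<alpha> r x y \<partial>?M) = (\<integral>\<^sup>+y. ennreal (dunkl_density \<alpha> y) * ball_weight \<alpha> r x y \<partial>lborel)"
      by (subst nn_integral_dunkl_measure) auto
    also have "\<dots> \<le> (\<integral>\<^sup>+y. ennreal ?K * indicator ?S y \<partial>lborel)"
    proof (intro nn_integral_mono)
      fix y
      show "ennreal (dunkl_density \<alpha> y) * ball_weight \<alpha> r x y \<le> ennreal ?K * indicator ?S y"
      proof (cases "r \<le> \<bar>\<bar>x\<bar> - \<bar>y\<bar>\<bar>")
        case True
        then show ?thesis by (simp add: ball_weight_eq_0)
      next
        case False
        then have S: "y \<in> ?S" by auto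
        have "dunkl_density \<alpha> y \<le> (\<bar>x\<bar> + r) powr (2 * \<alpha> + 1) / A"
          unfolding dunkl_density_def A_def[symmetric] using False \<alpha> A by (intro divide_right_mono powr_mono2) auto
        then have "ennreal (dunkl_density \<alpha> y) * ball_weight \<alpha> r x y \<le> ennreal ((\<bar>x\<bar> + r) powr (2 * \<alpha> + 1) / A) * ennreal (C * (r / (\<bar>x\<bar> + r)) powr (2 * \<alpha> + 1))"
          by (intro mult_mono ennreal_leI C r) auto
        also have "\<dots> = ennreal ?K" using C A r by (subst ennreal_mult[symmetric]) (auto simp: mult_ac)
        finally show ?thesis using S by simp
      qed
    qed
    also have "\<dots> = ennreal ?K * emeasure lborel ?S" by (subst nn_integral_cmult_indicator) auto
    also have "emeasure lborel ?S \<le> emeasure lborel {- (\<bar>x\<bar> + r) .. - (\<bar>x\<bar> - r)} + emeasure lborel {\<bar>x\<bar> - r .. \<bar>x\<bar> + r}"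
      by (rule emeasure_subadditive) auto
    also have "\<dots> = ennreal (4 * r)" using r by (simp add: ennreal_plus[symmetric] del: ennreal_plus)
    also have "ennreal ?K * ennreal (4 * r) = ennreal (?K * (4 * r))" using r C A by (subst ennreal_mult) auto
    also have "?K * (4 * r) = 4 * C / A * (r powr (2 * \<alpha> + 1) * r powr 1)" unfolding K using r by simp
    also have "\<dots> = 4 * C / A * r powr dunkl_dim \<alpha>"
      unfolding powr_add[symmetric] by (simp add: dunkl_dim_def add.commute)
    finally show "(\<integral>\<^sup>+y. ball_weight \<alpha> r x y \<partial>?M) \<le> ennreal (4 * C / A * r powr dunkl_dim \<alpha>)"
      by (simp add: mult_left_mono)
  qed
qed

lemma nn_integral_dunkl_arg_symmetric:
  assumes G[measurable]: "G \<in> borel_measurable (borel \<Otimes>\<^sub>M borel)" and x: "0 < x"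
  shows "(\<integral>\<^sup>+y. indicator {0<..} y * (\<integral>\<^sup>+\<theta>. G (y, dunkl_arg x y \<theta>) \<partial>angular_measure \<alpha>) \<partial>dunkl_measure \<alpha>)
       = (\<integral>\<^sup>+u. indicator {0<..} u * (\<integral>\<^sup>+\<theta>. G (dunkl_arg x u \<theta>, u) \<partial>angular_measure \<alpha>) \<partial>dunkl_measure \<alpha>)"
proof -
  let ?M = "dunkl_measure \<alpha>"
  interpret A: sigma_finite_measure "angular_measure \<alpha>" by (rule sigma_finite_angular_measure)
  define A where "A = 2 powr (\<alpha> + 1) * Gamma (\<alpha> + 1)"
  have *: "(\<integral>\<^sup>+y. indicator {0<..} y * H y \<partial>?M)
     = ennreal (1 / A) * (\<integral>\<^sup>+y. indicator {0<..} y * (ennreal (y powr (2 * \<alpha> + 1)) * H y) \<partial>lborel)"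
    if [measurable]: "H \<in> borel_measurable borel" for H :: "real \<Rightarrow> ennreal"
  proof -
    have "(\<integral>\<^sup>+y. indicator {0<..} y * H y \<partial>?M) = (\<integral>\<^sup>+y. ennreal (dunkl_density \<alpha> y) * (indicator {0<..} y * H y) \<partial>lborel)"
      by (subst nn_integral_dunkl_measure) auto
    also have "\<dots> = (\<integral>\<^sup>+y. ennreal (1 / A) * (indicator {0<..} y * (ennreal (y powr (2 * \<alpha> + 1)) * H y)) \<partial>lborel)"
    proof (intro nn_integral_cong)
      fix y :: real
      have "ennreal (y powr (2 * \<alpha> + 1) / A) = ennreal (1 / A) * ennreal (y powr (2 * \<alpha> + 1))"
        by (subst ennreal_mult''[symmetric]) auto
      then show "ennreal (dunkl_density \<alpha> y) * (indicator {0<..} y * H y) = ennreal (1 / A) * (indicator {0<..} y * (ennreal (y powr (2 * \<alpha> + 1)) * H y))"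
        by (auto simp: dunkl_density_def A_def[symmetric] indicator_def mult.assoc)
    qed
    also have "\<dots> = ennreal (1 / A) * (\<integral>\<^sup>+y. indicator {0<..} y * (ennreal (y powr (2 * \<alpha> + 1)) * H y) \<partial>lborel)"
      by (subst nn_integral_cmult) auto
    finally show ?thesis .
  qed
  show ?thesis
    by (subst (1 2) *) (measurable, simp only: nn_integral_dunkl_arg_swap[OF G x])
qed

lemma nn_integral_dunkl_measure_fold:
  assumes [measurable]: "F \<in> borel_measurable borel"
  shows "(\<integral>\<^sup>+x. F x \<partial>dunkl_measure \<alpha>) = (\<integral>\<^sup>+x. indicator {0<..} x * (F x + F (- x)) \<partial>dunkl_measure \<alpha>)"
proof -
  let ?M = "dunkl_measure \<alpha>"
  have "(\<integral>\<^sup>+x. F x \<partial>?M) = (\<integral>\<^sup>+x. indicator {0<..} x * F x + indicator {0<..} (- x) * F x \<partial>?M)"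
  proof (rule nn_integral_cong_AE)
    have "AE x in ?M. x \<noteq> 0" by (intro AE_lborel_imp_AE_dunkl_measure AE_lborel_singleton)
    then show "AE x in ?M. F x = indicator {0<..} x * F x + indicator {0<..} (- x) * F x"
      by eventually_elim (auto simp: indicator_def)
  qed
  also have "\<dots> = (\<integral>\<^sup>+x. indicator {0<..} x * F x \<partial>?M) + (\<integral>\<^sup>+x. indicator {0<..} (- x) * F x \<partial>?M)"
    by (subst nn_integral_add) auto
  also have "(\<integral>\<^sup>+x. indicator {0<..} (- x) * F x \<partial>?M) = (\<integral>\<^sup>+x. indicator {0<..} x * F (- x) \<partial>?M)"
    using nn_integral_dunkl_measure_reflect[of "\<lambda>x. indicator {0<..} x * F (- x)" \<alpha>] by simp
  also have "(\<integral>\<^sup>+x. indicator {0<..} x * F x \<partial>?M) + \<dots> = (\<integral>\<^sup>+x. indicator {0<..} x * (F x + F (- x)) \<partial>?M)"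
    by (subst nn_integral_add[symmetric]) (auto simp: distrib_left)
  finally show ?thesis .
qed

section \<open>Duality of translation and ball averages\<close>

definition translation_integrand :: "(real \<Rightarrow> real) \<Rightarrow> real \<Rightarrow> real \<Rightarrow> real \<Rightarrow> real" where
  "translation_integrand h x y \<theta> =
     (let u = dunkl_arg x y \<theta> in
       (h u + h (- u) + (x + y) / u * (h u - h (- u))) * (1 - cos \<theta>))"

lemma measurable_translation_integrand [measurable (raw)]:
  assumes [measurable]: "h \<in> borel_measurable borel" "f \<in> borel_measurable M" "g \<in> borel_measurable M"
  shows "(\<lambda>z. translation_integrand h x (f z) (g z)) \<in> borel_measurable M"
  unfolding translation_integrand_def Let_def by measurable

lemma dunkl_translation_eq_angular:
  assumes [measurable]: "h \<in> borel_measurable borel" and "\<alpha> \<noteq> -1/2"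
  shows "dunkl_translation \<alpha> x h y = dunkl_const \<alpha> / 2 * (\<integral>\<theta>. translation_integrand h x y \<theta> \<partial>angular_measure \<alpha>)"
proof -
  have "(\<integral>\<theta>. translation_integrand h x y \<theta> \<partial>angular_measure \<alpha>)
     = (\<integral>\<theta>. (indicator {0..pi} \<theta> * sin \<theta> powr (2 * \<alpha>)) *\<^sub>R translation_integrand h x y \<theta> \<partial>lborel)"
    unfolding angular_measure_def by (intro integral_density) auto
  also have "\<dots> = (LBINT \<theta>:{0..pi}.
           (h (dunkl_arg x y \<theta>) + h (- dunkl_arg x y \<theta>)
             + (x + y) / dunkl_arg x y \<theta> * (h (dunkl_arg x y \<theta>) - h (- dunkl_arg x y \<theta>)))
           * (1 - cos \<theta>) * sin \<theta> powr (2 * \<alpha>))"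
    unfolding set_lebesgue_integral_def translation_integrand_def Let_def
    by (intro Bochner_Integration.integral_cong) auto
  finally show ?thesis using assms(2) by (simp add: dunkl_translation_def)
qed

text \<open>The factor \<open>1 - cos \<theta>\<close> compensates the singularity of \<open>(x + y) / u\<close> at \<open>u = 0\<close>, because
\<open>4 u\<^sup>2 - (x + y)\<^sup>2 (1 - cos \<theta>)\<^sup>2 = (x + y)\<^sup>2 sin\<^sup>2 \<theta> + 2 (x - y)\<^sup>2 (1 + cos \<theta>)\<close>.\<close>

lemma abs_sum_mult_one_minus_cos_le: "\<bar>x + y\<bar> * (1 - cos \<theta>) \<le> 2 * dunkl_arg x y \<theta>"
proof (rule power2_le_imp_le)
  have c1: "0 \<le> 1 + cos \<theta>" using cos_ge_minus_one[of \<theta>] by linarith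
  have "0 \<le> (x + y)\<^sup>2 * ((1 - cos \<theta>) * (1 + cos \<theta>)) + 2 * (x - y)\<^sup>2 * (1 + cos \<theta>)"
    using c1 by (intro add_nonneg_nonneg[OF mult_nonneg_nonneg mult_nonneg_nonneg] mult_nonneg_nonneg[of "1 - cos \<theta>"]) auto
  also have "\<dots> = 4 * (x\<^sup>2 + y\<^sup>2 - 2 * x * y * cos \<theta>) - (x + y)\<^sup>2 * (1 - cos \<theta>)\<^sup>2"
    by (simp add: power2_eq_square algebra_simps)
  finally show "(\<bar>x + y\<bar> * (1 - cos \<theta>))\<^sup>2 \<le> (2 * dunkl_arg x y \<theta>)\<^sup>2"
    by (simp add: power_mult_distrib dunkl_arg_sq)
qed simp

lemma abs_translation_integrand_le:
  assumes "\<And>u. 0 \<le> h u"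
  shows "\<bar>translation_integrand h x y \<theta>\<bar> \<le> 4 * (h (dunkl_arg x y \<theta>) + h (- dunkl_arg x y \<theta>))"
proof -
  define u where "u = dunkl_arg x y \<theta>"
  define s where "s = h u + h (- u)"
  define t where "t = h u - h (- u)"
  have s: "0 \<le> s" "\<bar>t\<bar> \<le> s" using assms[of u] assms[of "-u"] by (auto simp: s_def t_def)
  have c: "0 \<le> 1 - cos \<theta>" "1 - cos \<theta> \<le> 2" using cos_ge_minus_one[of \<theta>] by (simp, linarith)
  have q: "\<bar>(x + y) / u\<bar> * (1 - cos \<theta>) \<le> 2"
    using abs_sum_mult_one_minus_cos_le[of x y \<theta>] dunkl_arg_nonneg[of x y \<theta>]
    by (cases "u = 0") (auto simp: u_def[symmetric] field_simps)
  have ring_eq: "(s + q * t) * k = s * k + t * (q * k)" for q k by algebra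
  have "translation_integrand h x y \<theta> = (s + (x + y) / u * t) * (1 - cos \<theta>)"
    by (simp add: translation_integrand_def Let_def u_def s_def t_def)
  then have "\<bar>translation_integrand h x y \<theta>\<bar> = \<bar>s * (1 - cos \<theta>) + t * ((x + y) / u * (1 - cos \<theta>))\<bar>"
    by (simp only: ring_eq)
  also have "\<dots> \<le> s * (1 - cos \<theta>) + \<bar>t\<bar> * (\<bar>(x + y) / u\<bar> * (1 - cos \<theta>))"
    using s c by (intro order.trans[OF abs_triangle_ineq]) (simp add: abs_mult)
  also have "\<dots> \<le> s * 2 + s * 2" using s c q by (intro add_mono mult_mono) auto
  finally show ?thesis by (simp add: s_def u_def)
qed

text \<open>The cosine of the angle opposite to the side \<open>y\<close> in a triangle with sides \<open>x\<close>, \<open>y\<close>, \<open>u\<close>.\<close>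

definition side_cos :: "real \<Rightarrow> real \<Rightarrow> real \<Rightarrow> real" where
  "side_cos x y u = (x\<^sup>2 + u\<^sup>2 - y\<^sup>2) / (2 * x * u)"

lemma side_cos_bounds:
  assumes "0 < x" 
  shows "\<bar>side_cos x y (dunkl_arg x y \<theta>)\<bar> \<le> 1"
proof -
  define u where "u = dunkl_arg x y \<theta>"
  have "(x - y * cos \<theta>)\<^sup>2 \<le> (x - y * cos \<theta>)\<^sup>2 + (y * sin \<theta>)\<^sup>2" by simp
  also have "\<dots> = x\<^sup>2 - 2 * x * y * cos \<theta> + y\<^sup>2 * ((cos \<theta>)\<^sup>2 + (sin \<theta>)\<^sup>2)"
    by algebra
  also have "\<dots> = u\<^sup>2" by (simp add: u_def dunkl_arg_sq)
  finally have le: "\<bar>x - y * cos \<theta>\<bar> \<le> u" using dunkl_arg_nonneg[of x y \<theta>]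
    by (simp add: u_def abs_le_square_iff[symmetric])
  have "x\<^sup>2 + u\<^sup>2 - y\<^sup>2 = 2 * x * (x - y * cos \<theta>)"
    unfolding u_def dunkl_arg_sq by (simp add: power2_eq_square algebra_simps)
  then have "side_cos x y u = (x - y * cos \<theta>) / u" using assms by (simp add: side_cos_def)
  then show ?thesis using le unfolding u_def[symmetric]
    by (cases "u = 0") (simp_all add: abs_divide)
qed

lemma side_cos_dunkl_arg:
  assumes "0 < x" "0 < u"
  shows "side_cos x (dunkl_arg x u \<theta>) u = cos \<theta>"
  using assms by (simp add: side_cos_def dunkl_arg_sq)

text \<open>The translation integrand is not nonnegative for \<open>h \<ge> 0\<close>, but its sum over \<open>(y, \<theta>)\<close> and
\<open>(-y, \<pi> - \<theta>)\<close>, which share the same \<open>u\<close>, is: the coefficients of \<open>h u\<close> and \<open>h (-u)\<close> are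
\<open>2 (1 \<plusminus> cos \<theta>')\<close>, where \<open>\<theta>'\<close> is the angle between the sides \<open>x\<close> and \<open>u\<close>.\<close>

lemma translation_integrand_pair:
  assumes "0 < x"
  shows "translation_integrand h x y \<theta> + translation_integrand h x (- y) (pi - \<theta>)
    = 2 * (h (dunkl_arg x y \<theta>) * (1 + side_cos x y (dunkl_arg x y \<theta>))
       + h (- dunkl_arg x y \<theta>) * (1 - side_cos x y (dunkl_arg x y \<theta>)))"
proof -
  define u where "u = dunkl_arg x y \<theta>"
  have "x\<^sup>2 + u\<^sup>2 - y\<^sup>2 = 2 * x * (x - y * cos \<theta>)"
    unfolding u_def dunkl_arg_sq by (simp add: power2_eq_square algebra_simps)
  then have q: "side_cos x y u = (x - y * cos \<theta>) / u" using assms by (simp add: side_cos_def)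
  define a b v where "a = h u" and "b = h (- u)" and "v = inverse u"
  show ?thesis
    unfolding translation_integrand_def dunkl_arg_reflect Let_def u_def[symmetric] q
      a_def[symmetric] b_def[symmetric] divide_inverse v_def[symmetric]
    by (simp add: algebra_simps)
qed

lemma measurable_side_cos [measurable (raw)]:
  assumes [measurable]: "f \<in> borel_measurable M" "g \<in> borel_measurable M"
  shows "(\<lambda>z. side_cos x (f z) (g z)) \<in> borel_measurable M"
  unfolding side_cos_def by measurable

lemma integral_dunkl_measure_fold:
  fixes f :: "real \<Rightarrow> real"
  assumes f[simp]: "integrable (dunkl_measure \<alpha>) f"
  shows "integrable (dunkl_measure \<alpha>) (\<lambda>x. indicator {0<..} x * (f x + f (- x)))"
    and "(\<integral>x. f x \<partial>dunkl_measure \<alpha>) = (\<integral>x. indicator {0<..} x * (f x + f (- x)) \<partial>dunkl_measure \<alpha>)"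
proof -
  let ?M = "dunkl_measure \<alpha>"
  have [measurable]: "f \<in> borel_measurable borel" using borel_measurable_integrable[OF f] by simp
  have fm: "integrable ?M (\<lambda>x. f (- x))"
    using integrable_distr_eq[of uminus ?M borel f] f by (simp add: distr_dunkl_measure_reflect)
  have i: "integrable ?M (\<lambda>x. indicator {0<..} x * f x)" "integrable ?M (\<lambda>x. indicator {0<..} x * f (- x))"
    "integrable ?M (\<lambda>x. indicator {0<..} (- x) * f x)"
  proof -
    have "indicator {0<..} (- x) = (indicator {..<0} x :: real)" for x :: real by (simp add: indicator_def)
    then show "integrable ?M (\<lambda>x. indicator {0<..} x * f x)" "integrable ?M (\<lambda>x. indicator {0<..} x * f (- x))"
      "integrable ?M (\<lambda>x. indicator {0<..} (- x) * f x)"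
      using integrable_mult_indicator[OF _ f, of "{0<..}"] integrable_mult_indicator[OF _ fm, of "{0<..}"]
        integrable_mult_indicator[OF _ f, of "{..<0}"] by simp_all
  qed
  show "integrable ?M (\<lambda>x. indicator {0<..} x * (f x + f (- x)))"
    using Bochner_Integration.integrable_add[OF i(1,2)] by (simp add: distrib_left)
  have "(\<integral>x. f x \<partial>?M) = (\<integral>x. indicator {0<..} x * f x + indicator {0<..} (- x) * f x \<partial>?M)"
  proof (rule integral_cong_AE)
    have "AE x in ?M. x \<noteq> 0" by (intro AE_lborel_imp_AE_dunkl_measure AE_lborel_singleton)
    then show "AE x in ?M. f x = indicator {0<..} x * f x + indicator {0<..} (- x) * f x"
      by eventually_elim (auto simp: indicator_def)
  qed auto
  also have "\<dots> = (\<integral>x. indicator {0<..} x * f x \<partial>?M) + (\<integral>x. indicator {0<..} (- x) * f x \<partial>?M)"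
    by (rule Bochner_Integration.integral_add) (rule i)+
  also have "(\<integral>x. indicator {0<..} (- x) * f x \<partial>?M) = (\<integral>x. indicator {0<..} x * f (- x) \<partial>?M)"
    using integral_distr[of uminus ?M borel "\<lambda>x. indicator {0<..} x * f (- x)"]
    by (simp add: distr_dunkl_measure_reflect)
  also have "(\<integral>x. indicator {0<..} x * f x \<partial>?M) + \<dots> = (\<integral>x. indicator {0<..} x * (f x + f (- x)) \<partial>?M)"
    using i by (subst Bochner_Integration.integral_add[symmetric]) (auto simp: distrib_left)
  finally show "(\<integral>x. f x \<partial>?M) = (\<integral>x. indicator {0<..} x * (f x + f (- x)) \<partial>?M)" .
qed

text \<open>Local integrability of a nonnegative function, in the form used with nonnegative integrals.\<close>

definition locally_finite :: "real \<Rightarrow> (real \<Rightarrow> real) \<Rightarrow> bool" where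
  "locally_finite \<alpha> h \<longleftrightarrow> (\<forall>R. (\<integral>\<^sup>+u. ennreal (h u) * indicator {-R..R} u \<partial>dunkl_measure \<alpha>) < \<infinity>)"

text \<open>Folding the integral over \<open>y\<close> onto the half-line makes the integrand nonnegative
(\<open>translation_integrand_pair\<close>). Exchanging the sides \<open>y\<close> and \<open>u\<close> turns it into
\<open>h u (1 + cos \<theta>) + h (-u) (1 - cos \<theta>)\<close> on the set where the new third side is below \<open>r\<close>, and the integral over
\<open>\<theta>\<close> consists of the weights at \<open>u\<close> and \<open>-u\<close>.\<close>

lemma dunkl_duality_pos:
  assumes \<alpha>: "\<alpha> > -1/2" and x: "0 < x"
    and h[measurable]: "h \<in> borel_measurable borel" and h0: "\<And>u. 0 \<le> h u"
    and loc: "locally_finite \<alpha> h"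
  shows "set_integrable (dunkl_measure \<alpha>) (ball 0 r) (dunkl_translation \<alpha> x h)"
    and "ennreal (LINT y:ball 0 r|dunkl_measure \<alpha>. dunkl_translation \<alpha> x h y)
       = (\<integral>\<^sup>+u. ennreal (h u) * ball_weight \<alpha> r (- x) u \<partial>dunkl_measure \<alpha>)"
    and "0 \<le> (LINT y:ball 0 r|dunkl_measure \<alpha>. dunkl_translation \<alpha> x h y)"
proof -
  let ?M = "dunkl_measure \<alpha>" and ?A = "angular_measure \<alpha>"
  interpret M: sigma_finite_measure ?M by (rule sigma_finite_dunkl_measure)
  interpret A: sigma_finite_measure ?A by (rule sigma_finite_angular_measure)
  interpret P: pair_sigma_finite ?M ?A ..
  define c where "c = dunkl_const \<alpha>"
  have c: "c > 0" using dunkl_const_pos[OF \<alpha>] by (simp add: c_def)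
  define m where "m = enn2real (emeasure ?A UNIV)"
  have m: "emeasure ?A UNIV = ennreal m" "0 \<le> m"
    using finite_angular_measure[OF \<alpha>] by (auto simp: m_def)
  have bw: "ball_weight \<alpha> r z u = ennreal c * (\<integral>\<^sup>+\<theta>. ennreal (1 - cos \<theta>) * indicator {..<r} (dunkl_arg z u \<theta>) \<partial>?A)" for z u
    using \<alpha> by (simp add: ball_weight_def radial_translation_def c_def)
  define E where "E = (\<lambda>(y, \<theta>). indicator (ball 0 r) y * (c / 2 * translation_integrand h x y \<theta>))"
  have [measurable]: "ball (0::real) r \<in> sets borel" by simp
  have Em[measurable]: "E \<in> borel_measurable (?M \<Otimes>\<^sub>M ?A)" unfolding E_def by measurable
  define k where "k = (\<lambda>u. ennreal (h u) + ennreal (h (- u)))"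
  have [measurable]: "k \<in> borel_measurable borel" unfolding k_def by measurable
  \<comment> \<open>The set of possible third sides \<open>u\<close> is bounded, so the local integrability of \<open>h\<close> suffices.\<close>
  have kfin: "(\<integral>\<^sup>+u. indicator {0<..} u * (indicator {..<x + r} u * k u) \<partial>?M) < \<infinity>"
  proof -
    have "(\<integral>\<^sup>+u. indicator {0<..} u * (indicator {..<x + r} u * k u) \<partial>?M)
       \<le> (\<integral>\<^sup>+u. ennreal (h u) * indicator {-(x + r)..x + r} u + ennreal (h (- u)) * indicator {-(x + r)..x + r} (- u) \<partial>?M)"
      by (intro nn_integral_mono) (auto simp: indicator_def k_def)
    also have "\<dots> = (\<integral>\<^sup>+u. ennreal (h u) * indicator {-(x + r)..x + r} u \<partial>?M) + (\<integral>\<^sup>+u. ennreal (h u) * indicator {-(x + r)..x + r} u \<partial>?M)"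
      using nn_integral_dunkl_measure_reflect[of "\<lambda>u. ennreal (h u) * indicator {-(x + r)..x + r} u" \<alpha>]
      by (subst nn_integral_add) auto
    also have "\<dots> < \<infinity>" using loc[unfolded locally_finite_def, rule_format, of "x + r"] by simp
    finally show ?thesis .
  qed
  \<comment> \<open>Absolute integrability justifies the use of Fubini's theorem for the signed integrand.\<close>
  have Eint: "integrable (?M \<Otimes>\<^sub>M ?A) E"
  proof (rule integrableI_bounded)
    let ?F = "\<lambda>y. indicator (ball 0 r) y * (\<integral>\<^sup>+\<theta>. k (dunkl_arg x y \<theta>) \<partial>?A)"
    have "(\<integral>\<^sup>+z. ennreal (norm (E z)) \<partial>(?M \<Otimes>\<^sub>M ?A)) = (\<integral>\<^sup>+y. \<integral>\<^sup>+\<theta>. ennreal (norm (E (y, \<theta>))) \<partial>?A \<partial>?M)"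
      by (subst A.nn_integral_fst[symmetric]) auto
    also have "\<dots> \<le> (\<integral>\<^sup>+y. \<integral>\<^sup>+\<theta>. ennreal (2 * c) * (indicator (ball 0 r) y * k (dunkl_arg x y \<theta>)) \<partial>?A \<partial>?M)"
    proof (intro nn_integral_mono)
      fix y \<theta>
      let ?u = "dunkl_arg x y \<theta>"
      have "\<bar>c / 2 * translation_integrand h x y \<theta>\<bar> \<le> c / 2 * (4 * (h ?u + h (- ?u)))"
        using abs_translation_integrand_le[of h x y \<theta>, OF h0] c by (simp add: abs_mult)
      then have "ennreal \<bar>c / 2 * translation_integrand h x y \<theta>\<bar> \<le> ennreal (2 * c * (h ?u + h (- ?u)))"
        by (intro ennreal_leI) (simp add: distrib_left mult_ac)
      also have "\<dots> = ennreal (2 * c) * k ?u" using h0 c by (simp add: k_def ennreal_mult ennreal_plus)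
      finally show "ennreal (norm (E (y, \<theta>))) \<le> ennreal (2 * c) * (indicator (ball 0 r) y * k ?u)"
        by (auto simp: E_def indicator_def)
    qed
    also have "\<dots> = ennreal (2 * c) * (\<integral>\<^sup>+y. ?F y \<partial>?M)"
      by (simp add: nn_integral_cmult)
    also have "(\<integral>\<^sup>+y. ?F y \<partial>?M) = (\<integral>\<^sup>+y. indicator {0<..} y * (?F y + ?F (- y)) \<partial>?M)"
      by (intro nn_integral_dunkl_measure_fold) measurable
    also have "\<dots> = (\<integral>\<^sup>+y. 2 * (indicator {0<..} y * ?F y) \<partial>?M)"
    proof (intro nn_integral_cong)
      fix y
      have "(\<integral>\<^sup>+\<theta>. k (dunkl_arg x (- y) \<theta>) \<partial>?A) = (\<integral>\<^sup>+\<theta>. k (dunkl_arg x (- y) (pi - \<theta>)) \<partial>?A)"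
        by (rule nn_integral_angular_reflect[symmetric]) measurable
      also have "\<dots> = (\<integral>\<^sup>+\<theta>. k (dunkl_arg x y \<theta>) \<partial>?A)" by (simp add: dunkl_arg_reflect)
      finally have "?F (- y) = ?F y" by (simp add: indicator_def)
      then show "indicator {0<..} y * (?F y + ?F (- y)) = 2 * (indicator {0<..} y * ?F y)"
        by (simp add: mult_2 distrib_left)
    qed
    also have "\<dots> = 2 * (\<integral>\<^sup>+y. indicator {0<..} y * (\<integral>\<^sup>+\<theta>. (\<lambda>(y, u). indicator (ball 0 r) y * k u) (y, dunkl_arg x y \<theta>) \<partial>?A) \<partial>?M)"
      by (simp add: nn_integral_cmult)
    also have "(\<integral>\<^sup>+y. indicator {0<..} y * (\<integral>\<^sup>+\<theta>. (\<lambda>(y, u). indicator (ball 0 r) y * k u) (y, dunkl_arg x y \<theta>) \<partial>?A) \<partial>?M)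
      = (\<integral>\<^sup>+u. indicator {0<..} u * (\<integral>\<^sup>+\<theta>. (\<lambda>(y, u). indicator (ball 0 r) y * k u) (dunkl_arg x u \<theta>, u) \<partial>?A) \<partial>?M)"
      by (rule nn_integral_dunkl_arg_symmetric[OF _ x]) measurable
    also have "\<dots> \<le> (\<integral>\<^sup>+u. ennreal m * (indicator {0<..} u * (indicator {..<x + r} u * k u)) \<partial>?M)"
    proof (intro nn_integral_mono)
      fix u
      have "(\<integral>\<^sup>+\<theta>. indicator (ball 0 r) (dunkl_arg x u \<theta>) * k u \<partial>?A) \<le> (\<integral>\<^sup>+\<theta>. indicator {..<x + r} u * k u \<partial>?A)"
      proof (intro nn_integral_mono)
        fix \<theta>
        show "indicator (ball 0 r) (dunkl_arg x u \<theta>) * k u \<le> indicator {..<x + r} u * k u"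
          using dunkl_arg_lower[of x u \<theta>] x by (auto simp: indicator_def dist_real_def)
      qed
      also have "\<dots> = ennreal m * (indicator {..<x + r} u * k u)" using m by (simp add: mult_ac)
      finally show "indicator {0<..} u * (\<integral>\<^sup>+\<theta>. (\<lambda>(y, u). indicator (ball 0 r) y * k u) (dunkl_arg x u \<theta>, u) \<partial>?A)
        \<le> ennreal m * (indicator {0<..} u * (indicator {..<x + r} u * k u))"
        by (auto simp: indicator_def)
    qed
    also have "\<dots> = ennreal m * (\<integral>\<^sup>+u. indicator {0<..} u * (indicator {..<x + r} u * k u) \<partial>?M)"
      by (subst nn_integral_cmult) auto
    finally have "(\<integral>\<^sup>+z. ennreal (norm (E z)) \<partial>(?M \<Otimes>\<^sub>M ?A)) \<le> ennreal (2 * c) * (2 * (ennreal m * (\<integral>\<^sup>+u. indicator {0<..} u * (indicator {..<x + r} u * k u) \<partial>?M)))"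
      by (simp add: mult_left_mono)
    also have "\<dots> < \<infinity>" using kfin by (simp add: ennreal_mult_less_top)
    finally show "(\<integral>\<^sup>+z. ennreal (norm (E z)) \<partial>(?M \<Otimes>\<^sub>M ?A)) < \<infinity>" .
  qed (rule Em)
  have tau: "indicator (ball 0 r) y *\<^sub>R dunkl_translation \<alpha> x h y = (\<integral>\<theta>. E (y, \<theta>) \<partial>?A)" for y
    using \<alpha> by (simp add: dunkl_translation_eq_angular E_def c_def)
  show "set_integrable ?M (ball 0 r) (dunkl_translation \<alpha> x h)"
    unfolding set_integrable_def tau by (rule P.integrable_fst'[OF Eint])
  define g where "g = (\<lambda>y. \<integral>\<theta>. E (y, \<theta>) \<partial>?A)"
  have gi: "integrable ?M g" unfolding g_def by (rule P.integrable_fst'[OF Eint])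
  have L: "(LINT y:ball 0 r|?M. dunkl_translation \<alpha> x h y) = (\<integral>y. indicator {0<..} y * (g y + g (- y)) \<partial>?M)"
    unfolding set_lebesgue_integral_def tau g_def[symmetric] by (rule integral_dunkl_measure_fold(2)[OF gi])
  define G where "G = (\<lambda>(y, u). indicator (ball 0 r) y * ennreal (c * (h u * (1 + side_cos x y u) + h (- u) * (1 - side_cos x y u))))"
  have Gm[measurable]: "G \<in> borel_measurable (borel \<Otimes>\<^sub>M borel)" unfolding G_def by measurable
  have AE1: "AE y in ?M. integrable ?A (\<lambda>\<theta>. E (y, \<theta>))" by (rule P.AE_integrable_fst'[OF Eint])
  have AE2: "AE y in ?M. integrable ?A (\<lambda>\<theta>. E (- y, \<theta>))"
  proof (rule AE_distrD[of uminus ?M borel "\<lambda>y. integrable ?A (\<lambda>\<theta>. E (y, \<theta>))"])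
    show "AE y in distr ?M borel uminus. integrable ?A (\<lambda>\<theta>. E (y, \<theta>))"
      unfolding distr_dunkl_measure_reflect by (rule AE1)
  qed simp
  have AE3: "AE y in ?M. 0 \<le> indicator {0<..} y * (g y + g (- y)) \<and>
      ennreal (indicator {0<..} y * (g y + g (- y))) = indicator {0<..} y * (\<integral>\<^sup>+\<theta>. G (y, dunkl_arg x y \<theta>) \<partial>?A)"
    using AE1 AE2
  proof eventually_elim
    case (elim y)
    show ?case
    proof (cases "y > 0")
      case True
      let ?H = "\<lambda>\<theta>. h (dunkl_arg x y \<theta>) * (1 + side_cos x y (dunkl_arg x y \<theta>)) + h (- dunkl_arg x y \<theta>) * (1 - side_cos x y (dunkl_arg x y \<theta>))"
      have [measurable]: "(\<lambda>\<theta>. E (- y, \<theta>)) \<in> borel_measurable borel" unfolding E_def by measurable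
      have i2: "integrable ?A (\<lambda>\<theta>. E (- y, pi - \<theta>))"
        using integrable_distr_eq[of "\<lambda>\<theta>. pi - \<theta>" ?A borel "\<lambda>\<theta>. E (- y, \<theta>)"] elim
        by (simp add: distr_angular_measure_reflect)
      have "g (- y) = (\<integral>\<theta>. E (- y, pi - \<theta>) \<partial>?A)"
        unfolding g_def using integral_distr[of "\<lambda>\<theta>. pi - \<theta>" ?A borel "\<lambda>\<theta>. E (- y, \<theta>)"]
        by (simp add: distr_angular_measure_reflect)
      then have sum: "g y + g (- y) = (\<integral>\<theta>. E (y, \<theta>) + E (- y, pi - \<theta>) \<partial>?A)"
        using elim i2 by (simp add: g_def)
      have pair: "E (y, \<theta>) + E (- y, pi - \<theta>) = indicator (ball 0 r) y * (c * ?H \<theta>)" for \<theta>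
      proof -
        have "E (y, \<theta>) + E (- y, pi - \<theta>) = indicator (ball 0 r) y * (c / 2 * (translation_integrand h x y \<theta> + translation_integrand h x (- y) (pi - \<theta>)))"
          by (simp add: E_def indicator_def distrib_left)
        moreover have "c / 2 * (2 * v) = c * v" for v by simp
        ultimately show ?thesis by (simp only: translation_integrand_pair[OF x])
      qed
      have pos: "0 \<le> c * ?H \<theta>" for \<theta>
        using side_cos_bounds[OF x, of y \<theta>] c h0
        by (intro mult_nonneg_nonneg[OF _ add_nonneg_nonneg[OF mult_nonneg_nonneg mult_nonneg_nonneg]]) (auto simp: abs_le_iff)
      have pos': "0 \<le> E (y, \<theta>) + E (- y, pi - \<theta>)" for \<theta>
        unfolding pair using pos[of \<theta>] by (simp add: indicator_def)
      have "ennreal (g y + g (- y)) = (\<integral>\<^sup>+\<theta>. ennreal (E (y, \<theta>) + E (- y, pi - \<theta>)) \<partial>?A)"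
        unfolding sum using elim i2 pos' by (intro nn_integral_eq_integral[symmetric]) auto
      also have "\<dots> = (\<integral>\<^sup>+\<theta>. G (y, dunkl_arg x y \<theta>) \<partial>?A)"
        unfolding pair by (intro nn_integral_cong) (auto simp: G_def indicator_def)
      finally have "ennreal (g y + g (- y)) = (\<integral>\<^sup>+\<theta>. G (y, dunkl_arg x y \<theta>) \<partial>?A)" .
      moreover have "0 \<le> g y + g (- y)" unfolding sum using pos' by (intro integral_nonneg_AE) auto
      ultimately show ?thesis using True by simp
    qed auto
  qed
  show "0 \<le> (LINT y:ball 0 r|?M. dunkl_translation \<alpha> x h y)"
    unfolding L using AE3 by (intro integral_nonneg_AE) auto
  have "ennreal (LINT y:ball 0 r|?M. dunkl_translation \<alpha> x h y) = (\<integral>\<^sup>+y. ennreal (indicator {0<..} y * (g y + g (- y))) \<partial>?M)"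
    unfolding L using AE3 by (intro nn_integral_eq_integral[symmetric] integral_dunkl_measure_fold(1)[OF gi]) auto
  also have "\<dots> = (\<integral>\<^sup>+y. indicator {0<..} y * (\<integral>\<^sup>+\<theta>. G (y, dunkl_arg x y \<theta>) \<partial>?A) \<partial>?M)"
    using AE3 by (intro nn_integral_cong_AE) auto
  also have "\<dots> = (\<integral>\<^sup>+u. indicator {0<..} u * (\<integral>\<^sup>+\<theta>. G (dunkl_arg x u \<theta>, u) \<partial>?A) \<partial>?M)"
    by (rule nn_integral_dunkl_arg_symmetric[OF Gm x])
  also have "\<dots> = (\<integral>\<^sup>+u. indicator {0<..} u * (ennreal (h u) * ball_weight \<alpha> r (- x) u + ennreal (h (- u)) * ball_weight \<alpha> r (- x) (- u)) \<partial>?M)"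
  proof (intro nn_integral_cong)
    fix u
    show "indicator {0<..} u * (\<integral>\<^sup>+\<theta>. G (dunkl_arg x u \<theta>, u) \<partial>?A) =
      indicator {0<..} u * (ennreal (h u) * ball_weight \<alpha> r (- x) u + ennreal (h (- u)) * ball_weight \<alpha> r (- x) (- u))"
    proof (cases "u > 0")
      case True
      have split: "ennreal (c * (p * a + q * b)) = ennreal p * (ennreal c * ennreal a) + ennreal q * (ennreal c * ennreal b)"
        if "0 \<le> p" "0 \<le> q" "0 \<le> a" "0 \<le> b" for p q a b
      proof -
        have "c * (p * a + q * b) = p * (c * a) + q * (c * b)" by algebra
        then show ?thesis using that c by (simp add: ennreal_plus ennreal_mult)
      qed
      let ?i = "\<lambda>\<theta>. indicator {..<r} (dunkl_arg x u \<theta>) :: ennreal"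
      have "(\<integral>\<^sup>+\<theta>. G (dunkl_arg x u \<theta>, u) \<partial>?A)
        = (\<integral>\<^sup>+\<theta>. ennreal (h u) * (ennreal c * (ennreal (1 + cos \<theta>) * ?i \<theta>)) + ennreal (h (- u)) * (ennreal c * (ennreal (1 - cos \<theta>) * ?i \<theta>)) \<partial>?A)"
      proof (intro nn_integral_cong)
        fix \<theta> :: real
        have "0 \<le> 1 + cos \<theta>" "0 \<le> 1 - cos \<theta>" using cos_ge_minus_one[of \<theta>] by (linarith, simp)
        then have "ennreal (c * (h u * (1 + cos \<theta>) + h (- u) * (1 - cos \<theta>))) = ennreal (h u) * (ennreal c * ennreal (1 + cos \<theta>)) + ennreal (h (- u)) * (ennreal c * ennreal (1 - cos \<theta>))"
          using split[of "h u" "h (- u)" "1 + cos \<theta>" "1 - cos \<theta>"] h0 by blast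
        then show "G (dunkl_arg x u \<theta>, u) = ennreal (h u) * (ennreal c * (ennreal (1 + cos \<theta>) * ?i \<theta>)) + ennreal (h (- u)) * (ennreal c * (ennreal (1 - cos \<theta>) * ?i \<theta>))"
          using True by (simp add: G_def side_cos_dunkl_arg[OF x] indicator_def)
      qed
      also have "\<dots> = ennreal (h u) * (ennreal c * (\<integral>\<^sup>+\<theta>. ennreal (1 + cos \<theta>) * ?i \<theta> \<partial>?A)) + ennreal (h (- u)) * (ennreal c * (\<integral>\<^sup>+\<theta>. ennreal (1 - cos \<theta>) * ?i \<theta> \<partial>?A))"
        by (subst nn_integral_add) (auto simp: nn_integral_cmult)
      also have "(\<integral>\<^sup>+\<theta>. ennreal (1 + cos \<theta>) * ?i \<theta> \<partial>?A) = (\<integral>\<^sup>+\<theta>. ennreal (1 + cos (pi - \<theta>)) * ?i (pi - \<theta>) \<partial>?A)"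
        by (rule nn_integral_angular_reflect[symmetric]) measurable
      also have "\<dots> = (\<integral>\<^sup>+\<theta>. ennreal (1 - cos \<theta>) * indicator {..<r} (dunkl_arg (- x) u \<theta>) \<partial>?A)"
        by (simp add: dunkl_arg_def)
      also have "(\<integral>\<^sup>+\<theta>. ennreal (1 - cos \<theta>) * ?i \<theta> \<partial>?A) = (\<integral>\<^sup>+\<theta>. ennreal (1 - cos \<theta>) * indicator {..<r} (dunkl_arg (- x) (- u) \<theta>) \<partial>?A)"
        by (simp add: dunkl_arg_minus)
      finally show ?thesis using True by (simp add: bw)
    qed auto
  qed
  also have "\<dots> = (\<integral>\<^sup>+u. ennreal (h u) * ball_weight \<alpha> r (- x) u \<partial>?M)"
    by (rule nn_integral_dunkl_measure_fold[symmetric]) measurable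
  finally show "ennreal (LINT y:ball 0 r|?M. dunkl_translation \<alpha> x h y)
       = (\<integral>\<^sup>+u. ennreal (h u) * ball_weight \<alpha> r (- x) u \<partial>?M)" .
qed

lemma set_integral_eq_nn_integral:
  fixes f :: "'a \<Rightarrow> real"
  assumes [measurable]: "f \<in> borel_measurable M" "A \<in> sets M"
    and nonneg: "AE x in M. 0 \<le> f x"
    and V: "(\<integral>\<^sup>+x. indicator A x * ennreal (f x) \<partial>M) = V" "V < \<infinity>"
  shows "set_integrable M A f" "ennreal (LINT x:A|M. f x) = V" "0 \<le> (LINT x:A|M. f x)"
proof -
  have nn: "AE x in M. 0 \<le> indicator A x *\<^sub>R f x" using nonneg by eventually_elim (simp add: indicator_def)
  have V': "(\<integral>\<^sup>+x. ennreal (indicator A x *\<^sub>R f x) \<partial>M) = V"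
    unfolding V(1)[symmetric] by (intro nn_integral_cong) (auto simp: indicator_def)
  show i: "set_integrable M A f" unfolding set_integrable_def
  proof (rule integrableI_bounded)
    have "(\<integral>\<^sup>+x. ennreal (norm (indicator A x *\<^sub>R f x)) \<partial>M) = (\<integral>\<^sup>+x. ennreal (indicator A x *\<^sub>R f x) \<partial>M)"
      using nn by (intro nn_integral_cong_AE) auto
    then show "(\<integral>\<^sup>+x. ennreal (norm (indicator A x *\<^sub>R f x)) \<partial>M) < \<infinity>" using V V' by simp
  qed measurable
  show "ennreal (LINT x:A|M. f x) = V"
    unfolding set_lebesgue_integral_def V'[symmetric]
    using i nn by (intro nn_integral_eq_integral[symmetric]) (auto simp: set_integrable_def)
  show "0 \<le> (LINT x:A|M. f x)" unfolding set_lebesgue_integral_def using nn by (rule integral_nonneg_AE)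
qed

lemma measurable_dunkl_translation_fixed [measurable]:
  assumes [measurable]: "g \<in> borel_measurable borel"
  shows "dunkl_translation \<alpha> x g \<in> borel_measurable borel"
  using measurable_compose[OF measurable_Pair1'[of x borel borel] measurable_dunkl_translation[OF assms, of \<alpha>]]
  by simp

lemma weighted_integral_finite:
  assumes \<alpha>: "\<alpha> \<ge> -1/2" and h[measurable]: "h \<in> borel_measurable borel" and loc: "locally_finite \<alpha> h"
    and r: "0 < r"
  shows "ball_integral \<alpha> r (\<lambda>u. ennreal (h u)) x < \<infinity>"
proof -
  let ?M = "dunkl_measure \<alpha>"
  obtain C where C: "0 < C" "\<And>x r y. 0 < r \<Longrightarrow> ball_weight \<alpha> r x y \<le> ennreal (C * (r / (\<bar>x\<bar> + r)) powr (2 * \<alpha> + 1))"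
    using ball_weight_le[OF \<alpha>] by metis
  let ?K = "ennreal (C * (r / (\<bar>x\<bar> + r)) powr (2 * \<alpha> + 1))"
  have "ball_integral \<alpha> r (\<lambda>u. ennreal (h u)) x
    \<le> (\<integral>\<^sup>+u. ?K * (ennreal (h u) * indicator {- (\<bar>x\<bar> + r)..\<bar>x\<bar> + r} u) \<partial>?M)"
  proof (intro nn_integral_mono)
    fix u
    show "ennreal (h u) * ball_weight \<alpha> r x u \<le> ?K * (ennreal (h u) * indicator {- (\<bar>x\<bar> + r)..\<bar>x\<bar> + r} u)"
    proof (cases "r \<le> \<bar>\<bar>x\<bar> - \<bar>u\<bar>\<bar>")
      case True
      then show ?thesis by (simp add: ball_weight_eq_0)
    next
      case False
      then have "u \<in> {- (\<bar>x\<bar> + r)..\<bar>x\<bar> + r}" by auto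
      moreover have "ennreal (h u) * ball_weight \<alpha> r x u \<le> ennreal (h u) * ?K"
        by (intro mult_left_mono C r) auto
      ultimately show ?thesis by (simp add: mult.commute)
    qed
  qed
  also have "\<dots> = ?K * (\<integral>\<^sup>+u. ennreal (h u) * indicator {- (\<bar>x\<bar> + r)..\<bar>x\<bar> + r} u \<partial>?M)"
    by (subst nn_integral_cmult) auto
  also have "\<dots> < \<infinity>"
    using loc[unfolded locally_finite_def, rule_format, of "\<bar>x\<bar> + r"] by (simp add: ennreal_mult_less_top)
  finally show ?thesis .
qed

text \<open>For \<open>\<alpha> = -1/2\<close> the translation is \<open>h (x + y)\<close> and the measure is a multiple of Lebesgue measure, so
duality is the substitution \<open>u = x + y\<close>.\<close>

lemma dunkl_duality_minus_half:
  assumes h[measurable]: "h \<in> borel_measurable borel" and h0: "\<And>u. 0 \<le> h u"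
    and loc: "locally_finite (-1/2) h" and r: "0 < r"
  shows "set_integrable (dunkl_measure (-1/2)) (ball 0 r) (dunkl_translation (-1/2) x h)"
    and "ennreal (LINT y:ball 0 r|dunkl_measure (-1/2). dunkl_translation (-1/2) x h y)
       = (\<integral>\<^sup>+u. ennreal (h u) * ball_weight (-1/2) r (- x) u \<partial>dunkl_measure (-1/2))"
    and "0 \<le> (LINT y:ball 0 r|dunkl_measure (-1/2). dunkl_translation (-1/2) x h y)"
proof -
  let ?M = "dunkl_measure (-1/2)"
  define d where "d = dunkl_density (-1/2) 1"
  have [measurable]: "ball (0::real) r \<in> sets borel" by simp
  have M: "(\<integral>\<^sup>+y. F y \<partial>?M) = (\<integral>\<^sup>+y. ennreal d * F y \<partial>lborel)" if [measurable]: "F \<in> borel_measurable borel" for F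
  proof -
    have "AE y in lborel. y \<noteq> (0::real)" by (rule AE_lborel_singleton)
    then have "AE y in lborel. ennreal (dunkl_density (-1/2) y) * F y = ennreal d * F y"
      by eventually_elim (simp add: dunkl_density_def d_def)
    then show ?thesis
      unfolding nn_integral_dunkl_measure[OF that] by (rule nn_integral_cong_AE)
  qed
  have tr: "dunkl_translation (-1/2) x h = (\<lambda>y. h (x + y))" by (simp add: dunkl_translation_def fun_eq_iff)
  have "(\<integral>\<^sup>+y. indicator (ball 0 r) y * ennreal (dunkl_translation (-1/2) x h y) \<partial>?M)
     = (\<integral>\<^sup>+y. ennreal d * (indicator (ball 0 r) y * ennreal (h (x + y))) \<partial>lborel)"
    by (subst M) (measurable, simp only: tr)
  also have "\<dots> = (\<integral>\<^sup>+u. ennreal d * (indicator (ball 0 r) (- x + u) * ennreal (h u)) \<partial>lborel)"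
    by (subst nn_integral_real_affine[where c=1 and t="- x"]) auto
  also have "\<dots> = (\<integral>\<^sup>+u. ennreal (h u) * ball_weight (-1/2) r (- x) u \<partial>?M)"
    by (subst M, measurable, intro nn_integral_cong)
       (auto simp: ball_weight_def radial_translation_def indicator_def)
  finally have V: "(\<integral>\<^sup>+y. indicator (ball 0 r) y * ennreal (dunkl_translation (-1/2) x h y) \<partial>?M)
     = (\<integral>\<^sup>+u. ennreal (h u) * ball_weight (-1/2) r (- x) u \<partial>?M)" .
  have nn: "AE y in ?M. 0 \<le> dunkl_translation (-1/2) x h y" unfolding tr by (simp add: h0)
  note * = set_integral_eq_nn_integral[OF _ _ nn V weighted_integral_finite[OF _ h loc r]]
  show "set_integrable ?M (ball 0 r) (dunkl_translation (-1/2) x h)"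
    "ennreal (LINT y:ball 0 r|?M. dunkl_translation (-1/2) x h y) = (\<integral>\<^sup>+u. ennreal (h u) * ball_weight (-1/2) r (- x) u \<partial>?M)"
    "0 \<le> (LINT y:ball 0 r|?M. dunkl_translation (-1/2) x h y)"
    by (rule *; simp)+
qed

text \<open>At \<open>x = 0\<close> the third side is \<open>\<bar>y\<bar>\<close> for every angle. The same constant \<open>\<kappa>\<close> (its
value is 1) therefore appears in the translate and in the weight.\<close>

lemma dunkl_translation_0:
  assumes \<alpha>: "\<alpha> > -1/2" and [measurable]: "h \<in> borel_measurable borel"
  obtains \<kappa> where "0 \<le> \<kappa>" "\<And>y. y \<noteq> 0 \<Longrightarrow> dunkl_translation \<alpha> 0 h y = \<kappa> * h y"
    "\<And>r y. ball_weight \<alpha> r 0 y = ennreal \<kappa> * indicator (ball 0 r) y"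
proof -
  let ?A = "angular_measure \<alpha>"
  define c where "c = dunkl_const \<alpha>"
  have c: "c > 0" using dunkl_const_pos[OF \<alpha>] by (simp add: c_def)
  have i: "integrable ?A (\<lambda>\<theta>. 1 - cos \<theta>)"
  proof (rule integrableI_bounded)
    have "(\<integral>\<^sup>+\<theta>. ennreal (norm (1 - cos \<theta>)) \<partial>?A) \<le> (\<integral>\<^sup>+\<theta>. ennreal 2 \<partial>?A)"
    proof (intro nn_integral_mono ennreal_leI)
      fix \<theta> :: real show "norm (1 - cos \<theta>) \<le> 2" using cos_ge_minus_one[of \<theta>] cos_le_one[of \<theta>] by (simp add: abs_le_iff)
    qed
    also have "\<dots> < \<infinity>" using finite_angular_measure[OF \<alpha>] by (simp add: ennreal_mult_less_top)
    finally show "(\<integral>\<^sup>+\<theta>. ennreal (norm (1 - cos \<theta>)) \<partial>?A) < \<infinity>" .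
  qed simp
  define \<kappa> where "\<kappa> = c * (\<integral>\<theta>. 1 - cos \<theta> \<partial>?A)"
  have nn: "(\<integral>\<^sup>+\<theta>. ennreal (1 - cos \<theta>) \<partial>?A) = ennreal (\<integral>\<theta>. 1 - cos \<theta> \<partial>?A)"
    using i by (intro nn_integral_eq_integral) auto
  have I0: "0 \<le> (\<integral>\<theta>. 1 - cos \<theta> \<partial>?A)" by (intro integral_nonneg_AE) auto
  have arg: "dunkl_arg 0 y \<theta> = \<bar>y\<bar>" for y \<theta> by (simp add: dunkl_arg_def)
  show ?thesis
  proof (rule that[of \<kappa>])
    show "0 \<le> \<kappa>" using c I0 by (simp add: \<kappa>_def)
    fix y :: real assume y: "y \<noteq> 0"
    have "translation_integrand h 0 y \<theta> = 2 * h y * (1 - cos \<theta>)" for \<theta>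
      using y by (cases "y > 0") (simp_all add: translation_integrand_def Let_def arg)
    then show "dunkl_translation \<alpha> 0 h y = \<kappa> * h y"
      using \<alpha> by (simp add: dunkl_translation_eq_angular \<kappa>_def c_def)
  next
    fix r y :: real
    have "ball_weight \<alpha> r 0 y = ennreal c * (\<integral>\<^sup>+\<theta>. ennreal (1 - cos \<theta>) * indicator (ball 0 r) y \<partial>?A)"
      using \<alpha> by (auto simp: ball_weight_def radial_translation_def c_def arg indicator_def)
    also have "\<dots> = ennreal \<kappa> * indicator (ball 0 r) y"
      using c I0 by (subst nn_integral_multc) (auto simp: nn \<kappa>_def ennreal_mult mult.assoc)
    finally show "ball_weight \<alpha> r 0 y = ennreal \<kappa> * indicator (ball 0 r) y" .
  qed
qed

lemma dunkl_translation_reflect: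
  "dunkl_translation \<alpha> (- x) (\<lambda>u. h (- u)) (- y) = dunkl_translation \<alpha> x h y"
proof -
  have *: "(h (- u) + h (- (- u)) + (- x + - y) / u * (h (- u) - h (- (- u)))) = (h u + h (- u) + (x + y) / u * (h u - h (- u)))" for u
  proof -
    have "(- x + - y) / u = - ((x + y) / u)" by (simp add: minus_divide_left)
    then show ?thesis by (simp add: algebra_simps)
  qed
  show ?thesis unfolding dunkl_translation_def dunkl_arg_minus * by (simp add: add.commute)
qed

text \<open>The case \<open>x < 0\<close> reduces to \<open>x > 0\<close> by replacing \<open>h\<close> with \<open>h (- \<cdot>)\<close>.\<close>

theorem dunkl_duality:
  assumes \<alpha>: "\<alpha> \<ge> -1/2"
    and h[measurable]: "h \<in> borel_measurable borel" and h0: "\<And>u. 0 \<le> h u"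
    and loc: "locally_finite \<alpha> h" and r: "0 < r"
  shows "set_integrable (dunkl_measure \<alpha>) (ball 0 r) (dunkl_translation \<alpha> x h)"
    and "ennreal (LINT y:ball 0 r|dunkl_measure \<alpha>. dunkl_translation \<alpha> x h y)
       = ball_integral \<alpha> r (\<lambda>u. ennreal (h u)) (- x)"
    and "0 \<le> (LINT y:ball 0 r|dunkl_measure \<alpha>. dunkl_translation \<alpha> x h y)"
proof -
  let ?M = "dunkl_measure \<alpha>"
  have [measurable]: "ball (0::real) r \<in> sets borel" by simp
  have "set_integrable ?M (ball 0 r) (dunkl_translation \<alpha> x h) \<and>
    ennreal (LINT y:ball 0 r|?M. dunkl_translation \<alpha> x h y) = ball_integral \<alpha> r (\<lambda>u. ennreal (h u)) (- x) \<and>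
    0 \<le> (LINT y:ball 0 r|?M. dunkl_translation \<alpha> x h y)"
  proof (cases "\<alpha> = -1/2")
    case True
    then show ?thesis using dunkl_duality_minus_half[OF h h0 _ r] loc by simp
  next
    case False
    with \<alpha> have \<alpha>': "\<alpha> > -1/2" by simp
    consider "x > 0" | "x = 0" | "x < 0" by linarith
    then show ?thesis
    proof cases
      case 1
      then show ?thesis using dunkl_duality_pos[OF \<alpha>' 1 h h0 loc] by simp
    next
      case 2
      obtain \<kappa> where \<kappa>: "0 \<le> \<kappa>" "\<And>y. y \<noteq> 0 \<Longrightarrow> dunkl_translation \<alpha> 0 h y = \<kappa> * h y"
        "\<And>r y. ball_weight \<alpha> r 0 y = ennreal \<kappa> * indicator (ball 0 r) y"
        using dunkl_translation_0[OF \<alpha>' h] by metis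
      have n0: "AE x in ?M. x \<noteq> 0" by (intro AE_lborel_imp_AE_dunkl_measure AE_lborel_singleton)
      then have nn: "AE y in ?M. 0 \<le> dunkl_translation \<alpha> 0 h y" using \<kappa> h0 by auto
      have V: "(\<integral>\<^sup>+y. indicator (ball 0 r) y * ennreal (dunkl_translation \<alpha> 0 h y) \<partial>?M)
        = ball_integral \<alpha> r (\<lambda>u. ennreal (h u)) 0"
        using n0 by (intro nn_integral_cong_AE, eventually_elim) (simp add: \<kappa> h0 ennreal_mult mult_ac)
      show ?thesis 
        using set_integral_eq_nn_integral[OF _ _ nn V weighted_integral_finite[OF \<alpha> h loc r]] 2 by simp
    next
      case 3
      define h' where "h' = (\<lambda>u. h (- u))"
      have h'[measurable]: "h' \<in> borel_measurable borel" and h'0: "\<And>u. 0 \<le> h' u" using h0 by (simp_all add: h'_def)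
      have loc': "locally_finite \<alpha> h'"
        unfolding locally_finite_def
      proof
        fix R
        have "(\<integral>\<^sup>+u. ennreal (h' u) * indicator {-R..R} u \<partial>?M) = (\<integral>\<^sup>+u. ennreal (h (- u)) * indicator {-R..R} (- u) \<partial>?M)"
          by (intro nn_integral_cong) (auto simp: h'_def indicator_def)
        also have "\<dots> = (\<integral>\<^sup>+u. ennreal (h u) * indicator {-R..R} u \<partial>?M)"
          by (rule nn_integral_dunkl_measure_reflect) measurable
        finally show "(\<integral>\<^sup>+u. ennreal (h' u) * indicator {-R..R} u \<partial>?M) < \<infinity>" using loc by (simp add: locally_finite_def)
      qed
      from 3 have x': "- x > 0" by simp
      note D = dunkl_duality_pos[OF \<alpha>' x' h' h'0 loc', of r]
      define f where "f = (\<lambda>y. indicator (ball 0 r) y *\<^sub>R dunkl_translation \<alpha> (- x) h' y)"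
      have [measurable]: "f \<in> borel_measurable borel" unfolding f_def by measurable
      have eq: "indicator (ball 0 r) y *\<^sub>R dunkl_translation \<alpha> x h y = f (- y)" for y
        unfolding f_def h'_def using dunkl_translation_reflect[of \<alpha> x h y] by (simp add: indicator_def)
      have fi: "integrable ?M f" using D(1) by (simp add: set_integrable_def f_def)
      have "integrable ?M (\<lambda>y. f (- y))"
        using integrable_distr_eq[of uminus ?M borel f] fi by (simp add: distr_dunkl_measure_reflect)
      moreover have "(\<integral>y. f (- y) \<partial>?M) = (\<integral>y. f y \<partial>?M)"
        using integral_distr[of uminus ?M borel f] by (simp add: distr_dunkl_measure_reflect)
      ultimately have 1: "set_integrable ?M (ball 0 r) (dunkl_translation \<alpha> x h)"
        "(LINT y:ball 0 r|?M. dunkl_translation \<alpha> x h y) = (LINT y:ball 0 r|?M. dunkl_translation \<alpha> (- x) h' y)"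
        unfolding set_integrable_def set_lebesgue_integral_def eq by (simp_all add: f_def)
      have "ball_integral \<alpha> r (\<lambda>u. ennreal (h' u)) x = (\<integral>\<^sup>+u. ennreal (h (- u)) * ball_weight \<alpha> r (- x) (- u) \<partial>?M)"
        by (simp add: h'_def ball_weight_minus)
      also have "\<dots> = ball_integral \<alpha> r (\<lambda>u. ennreal (h u)) (- x)"
        by (rule nn_integral_dunkl_measure_reflect) measurable
      finally show ?thesis using D(2,3) 1 by simp
    qed
  qed
  then show "set_integrable ?M (ball 0 r) (dunkl_translation \<alpha> x h)"
    "ennreal (LINT y:ball 0 r|?M. dunkl_translation \<alpha> x h y) = ball_integral \<alpha> r (\<lambda>u. ennreal (h u)) (- x)"
    "0 \<le> (LINT y:ball 0 r|?M. dunkl_translation \<alpha> x h y)" by auto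
qed

section \<open>Dyadic kernels and means\<close>

lemma ennreal_term_le_suminf: "f n \<le> (\<Sum>n. f n)" for f :: "nat \<Rightarrow> ennreal"
  using sum_le_suminf[of f "{n}"] by simp

lemma power_decay_sum:
  fixes \<epsilon> :: real assumes "0 < \<epsilon>"
  shows "summable (\<lambda>n::nat. 2 powr (- \<epsilon> * real (n div 2)))"
proof (rule summable_comparison_test')
  have "norm (2 powr (- \<epsilon> / 2)) < (1::real)" using assms by (simp add: powr_less_one)
  then show "summable (\<lambda>n. 2 powr (\<epsilon> / 2) * (2 powr (- \<epsilon> / 2)) ^ n)"
    by (intro summable_mult summable_geometric)
  fix n :: nat
  have "real n \<le> 2 * real (n div 2) + 1" by linarith
  then have "- \<epsilon> * real (n div 2) \<le> \<epsilon> / 2 + (- \<epsilon> / 2) * real n"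
    using assms mult_left_mono[of "real n" "2 * real (n div 2) + 1" "\<epsilon> / 2"] by (simp add: algebra_simps)
  then have "2 powr (- \<epsilon> * real (n div 2)) \<le> 2 powr (\<epsilon> / 2 + (- \<epsilon> / 2) * real n)" by (rule powr_mono) simp
  also have "\<dots> = 2 powr (\<epsilon> / 2) * (2 powr (- \<epsilon> / 2)) ^ n"
    unfolding powr_add by (simp add: powr_powr flip: powr_realpow)
  finally show "norm (2 powr (- \<epsilon> * real (n div 2))) \<le> 2 powr (\<epsilon> / 2) * (2 powr (- \<epsilon> / 2)) ^ n" by simp
qed

text \<open>If \<open>2\<^sup>k\<^sup>-\<^sup>1 \<le> u < 2\<^sup>k\<close>, the left-hand side is at most a constant times \<open>2\<^sup>k\<^sup>(\<^sup>\<beta>\<^sup>-\<^sup>d\<^sup>)\<close> for \<open>k < 0\<close> and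
\<open>2\<^sup>k\<^sup>(\<^sup>\<beta>\<^sup>-\<^sup>\<gamma>\<^sup>-\<^sup>d\<^sup>)\<close> for \<open>k \<ge> 0\<close>. Compared with \<open>2\<^sup>k\<^sup>(\<^sup>b\<^sup>-\<^sup>d\<^sup>)\<close> this decays geometrically in \<open>\<bar>k\<bar>\<close>. The integers \<open>k\<close>
are enumerated by the natural numbers with \<open>\<bar>k\<bar> = n div 2\<close>.\<close>

lemma dyadic_kernel_bound:
  fixes \<beta> \<gamma> b d :: real
  assumes "\<beta> < d" "b < \<beta>" "\<beta> - \<gamma> < b" "0 \<le> \<gamma>"
  obtains \<Lambda> R :: "nat \<Rightarrow> real" where "\<And>n. 0 < R n" "\<And>n. 0 < \<Lambda> n" "summable \<Lambda>"
    "\<And>u. 0 \<le> u \<Longrightarrow> ennreal (u powr (\<beta> - d) / (1 + u) powr \<gamma>)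
        \<le> (\<Sum>n. ennreal (\<Lambda> n * R n powr (b - d)) * indicator {..<R n} u)"
proof -
  define \<epsilon> where "\<epsilon> = min (\<beta> - b) (b - \<beta> + \<gamma>)"
  have eps: "0 < \<epsilon>" "\<epsilon> \<le> \<beta> - b" "\<epsilon> \<le> b - \<beta> + \<gamma>" using assms by (auto simp: \<epsilon>_def)
  define e where "e = (\<lambda>n::nat. if even n then real (n div 2) else - real (n div 2))"
  define R where "R = (\<lambda>n. 2 powr e n)"
  define \<Lambda> where "\<Lambda> = (\<lambda>n. 2 powr (d - \<beta> + \<gamma>) * 2 powr (- \<epsilon> * real (n div 2)))"
  show ?thesis
  proof (rule that[of R \<Lambda>])
    show "0 < R n" "0 < \<Lambda> n" for n by (simp_all add: R_def \<Lambda>_def)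
    show "summable \<Lambda>" unfolding \<Lambda>_def by (intro summable_mult power_decay_sum eps)
    fix u :: real assume u: "0 \<le> u"
    show "ennreal (u powr (\<beta> - d) / (1 + u) powr \<gamma>)
        \<le> (\<Sum>n. ennreal (\<Lambda> n * R n powr (b - d)) * indicator {..<R n} u)"
    proof (cases "u = 0")
      case False
      with u have u: "0 < u" by simp
      define k where "k = \<lfloor>log 2 u\<rfloor> + 1"
      \<comment> \<open>The index that enumerates \<open>k\<close>.\<close>
      define n where "n = (if 0 \<le> k then 2 * nat k else 2 * nat (- k) + 1)"
      have en: "e n = real_of_int k" and n2: "real (n div 2) = \<bar>real_of_int k\<bar>"
        by (auto simp: e_def n_def)
      have "real_of_int k - 1 \<le> log 2 u" "log 2 u < real_of_int k" unfolding k_def by linarith+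
      then have lo: "2 powr (k - 1) \<le> u" and hi: "u < 2 powr k"
        using u by (simp_all add: le_log_iff log_less_iff)
      have "u powr (\<beta> - d) \<le> (2 powr (k - 1)) powr (\<beta> - d)"
        using lo assms by (intro powr_mono2') auto
      then have u1: "u powr (\<beta> - d) \<le> 2 powr ((k - 1) * (\<beta> - d))" by (simp add: powr_powr)
      have "u powr (\<beta> - d) / (1 + u) powr \<gamma> \<le> 2 powr ((d - \<beta> + \<gamma>) + (- \<epsilon> * \<bar>real_of_int k\<bar>) + k * (b - d))"
      proof (cases "0 \<le> k")
        case True
        have "(1 + u) powr (- \<gamma>) \<le> u powr (- \<gamma>)" using u assms by (intro powr_mono2') auto
        also have "\<dots> \<le> (2 powr (k - 1)) powr (- \<gamma>)" using lo assms by (intro powr_mono2') auto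
        finally have "(1 + u) powr (- \<gamma>) \<le> 2 powr ((k - 1) * (- \<gamma>))" by (simp only: powr_powr)
        then have "u powr (\<beta> - d) * (1 + u) powr (- \<gamma>) \<le> 2 powr ((k - 1) * (\<beta> - d)) * 2 powr ((k - 1) * (- \<gamma>))"
          by (intro mult_mono u1) auto
        also have "\<dots> = 2 powr ((d - \<beta> + \<gamma>) + k * (\<beta> - d - \<gamma>))" 
          unfolding powr_add[symmetric] by (simp add: algebra_simps)
        also have "\<dots> \<le> 2 powr ((d - \<beta> + \<gamma>) + (- \<epsilon> * \<bar>real_of_int k\<bar>) + k * (b - d))"
        proof (intro powr_mono)
          have "real_of_int k * \<epsilon> \<le> k * (b - \<beta> + \<gamma>)" using True eps by (intro mult_left_mono) auto
          then show "(d - \<beta> + \<gamma>) + k * (\<beta> - d - \<gamma>) \<le> (d - \<beta> + \<gamma>) + (- \<epsilon> * \<bar>real_of_int k\<bar>) + k * (b - d)"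
            using True by (simp add: algebra_simps)
        qed simp
        finally show ?thesis by (simp add: powr_minus_divide)
      next
        case False
        have "u powr (\<beta> - d) / (1 + u) powr \<gamma> \<le> u powr (\<beta> - d) / 1"
          using u assms by (intro divide_left_mono ge_one_powr_ge_zero) auto
        also have "\<dots> \<le> 2 powr ((k - 1) * (\<beta> - d))" using u1 by simp
        also have "\<dots> \<le> 2 powr ((d - \<beta> + \<gamma>) + (- \<epsilon> * \<bar>real_of_int k\<bar>) + k * (b - d))"
        proof (intro powr_mono)
          have "real_of_int k * (\<beta> - b) \<le> k * \<epsilon>" using False eps by (intro mult_left_mono_neg) auto
          then show "(k - 1) * (\<beta> - d) \<le> (d - \<beta> + \<gamma>) + (- \<epsilon> * \<bar>real_of_int k\<bar>) + k * (b - d)"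
            using False assms(4) by (simp add: algebra_simps)
        qed simp
        finally show ?thesis .
      qed
      also have "\<dots> = \<Lambda> n * R n powr (b - d)"
        unfolding powr_add \<Lambda>_def R_def n2 en by (simp add: powr_powr)
      finally have "ennreal (u powr (\<beta> - d) / (1 + u) powr \<gamma>) \<le> ennreal (\<Lambda> n * R n powr (b - d)) * indicator {..<R n} u"
        using hi by (simp add: R_def en ennreal_leI)
      also have "\<dots> \<le> (\<Sum>n. ennreal (\<Lambda> n * R n powr (b - d)) * indicator {..<R n} u)"
        by (rule ennreal_term_le_suminf)
      finally show ?thesis .
    qed simp
  qed
qed

text \<open>Hoelder's inequality against a weight of mass at most \<open>A\<close>, up to the factor \<open>2\<^sup>p\<close>: integrate
\<open>g \<le> s + s\<^sup>1\<^sup>-\<^sup>p g\<^sup>p\<close> and choose the \<open>s\<close> that balances the two terms. It serves both for integrals over the line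
and for series.\<close>

lemma weighted_power_mean:
  fixes g :: "'a \<Rightarrow> real" and w :: "'a \<Rightarrow> ennreal"
  assumes [measurable]: "g \<in> borel_measurable M" "w \<in> borel_measurable M"
    and g0: "\<And>x. 0 \<le> g x" and p: "1 < p" and A: "0 < A" and I: "0 \<le> I"
    and wA: "(\<integral>\<^sup>+x. w x \<partial>M) \<le> ennreal A"
    and gI: "(\<integral>\<^sup>+x. ennreal (g x powr p) * w x \<partial>M) \<le> ennreal I"
  obtains X where "0 \<le> X" "(\<integral>\<^sup>+x. ennreal (g x) * w x \<partial>M) = ennreal X"
    "X powr p \<le> 2 powr p * A powr (p - 1) * I"
proof -
  let ?X = "\<integral>\<^sup>+x. ennreal (g x) * w x \<partial>M"
  have bound: "?X \<le> ennreal (s * A + s powr (1 - p) * I)" if s: "0 < s" for s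
  proof -
    have "?X \<le> (\<integral>\<^sup>+x. ennreal s * w x + ennreal (s powr (1 - p)) * (ennreal (g x powr p) * w x) \<partial>M)"
    proof (intro nn_integral_mono)
      fix x
      have "g x \<le> s + s powr (1 - p) * g x powr p"
      proof (cases "g x \<le> s")
        case False
        then have gx: "0 < g x" using s by linarith
        have "1 = (g x) powr (1 - p) * g x powr (p - 1)" using gx by (simp flip: powr_add)
        also have "\<dots> \<le> s powr (1 - p) * g x powr (p - 1)" using False s p by (intro mult_right_mono powr_mono2') auto
        finally have "g x * 1 \<le> g x * (s powr (1 - p) * g x powr (p - 1))" using gx by (intro mult_left_mono) auto
        also have "\<dots> = s powr (1 - p) * (g x powr 1 * g x powr (p - 1))" using gx by simp
        also have "\<dots> = s powr (1 - p) * g x powr p" unfolding powr_add[symmetric] by simp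
        finally show ?thesis using s by simp
      qed (simp add: add_increasing2)
      then have "ennreal (g x) \<le> ennreal (s + s powr (1 - p) * g x powr p)" by (rule ennreal_leI)
      also have "\<dots> = ennreal s + ennreal (s powr (1 - p)) * ennreal (g x powr p)"
        using s by (simp add: ennreal_plus ennreal_mult)
      finally have "ennreal (g x) \<le> ennreal s + ennreal (s powr (1 - p)) * ennreal (g x powr p)" .
      from mult_right_mono[OF this, of "w x"]
      show "ennreal (g x) * w x \<le> ennreal s * w x + ennreal (s powr (1 - p)) * (ennreal (g x powr p) * w x)"
        by (simp add: distrib_right mult.assoc)
    qed
    also have "\<dots> = ennreal s * (\<integral>\<^sup>+x. w x \<partial>M) + ennreal (s powr (1 - p)) * (\<integral>\<^sup>+x. ennreal (g x powr p) * w x \<partial>M)"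
      by (subst nn_integral_add) (auto simp: nn_integral_cmult)
    also have "\<dots> \<le> ennreal s * ennreal A + ennreal (s powr (1 - p)) * ennreal I"
      by (intro add_mono mult_left_mono wA gI) auto
    also have "\<dots> = ennreal (s * A + s powr (1 - p) * I)"
      using s A I by (subst (1 2) ennreal_mult[symmetric]) (auto simp: ennreal_plus)
    finally show ?thesis .
  qed
  define X where "X = enn2real ?X"
  have "?X < \<infinity>" using bound[of 1] by (simp add: le_less_trans)
  then have X: "?X = ennreal X" "0 \<le> X" by (auto simp: X_def)
  have Xs: "X \<le> s * A + s powr (1 - p) * I" if "0 < s" for s
    using bound[OF that] that A I unfolding X by (subst (asm) ennreal_le_iff) auto
  have "X powr p \<le> 2 powr p * A powr (p - 1) * I"
  proof (cases "I = 0")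
    case True
    have "X \<le> 0"
    proof (rule field_le_epsilon)
      fix e :: real assume "0 < e"
      then show "X \<le> 0 + e" using Xs[of "e / A"] A True by simp
    qed
    then show ?thesis using X True by simp
  next
    case False
    with I have I: "0 < I" by simp
    \<comment> \<open>With this \<open>s\<close> both terms of the bound are equal.\<close>
    define s where "s = (I / A) powr (1 / p)"
    have s: "0 < s" using I A by (simp add: s_def)
    have 1: "s * A = I powr (1/p) * A powr (1 - 1/p)"
    proof -
      have "s * A = (I powr (1/p) / A powr (1/p)) * A powr 1" using I A by (simp add: s_def powr_divide)
      also have "\<dots> = I powr (1/p) * A powr (1 - 1/p)" using A by (simp add: powr_diff)
      finally show ?thesis .
    qed
    have 2: "s powr (1 - p) * I = I powr (1/p) * A powr (1 - 1/p)"
    proof -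
      have "1 / p * (1 - p) = 1/p - 1" using p by (simp add: field_simps)
      then have "s powr (1 - p) = (I / A) powr (1/p - 1)" by (simp add: s_def powr_powr)
      also have "\<dots> * I = I powr (1/p - 1) * I powr 1 / A powr (1/p - 1)" using I A by (simp add: powr_divide)
      also have "\<dots> = I powr (1/p) * A powr (1 - 1/p)"
        unfolding powr_add[symmetric] using I A by (simp add: divide_powr_uminus)
      finally show ?thesis .
    qed
    have "X \<le> 2 * (I powr (1/p) * A powr (1 - 1/p))" using Xs[OF s] unfolding 1 2 by simp
    then have "X powr p \<le> (2 * (I powr (1/p) * A powr (1 - 1/p))) powr p" using X p by (intro powr_mono2) auto
    also have "\<dots> = 2 powr p * (I powr (1/p * p) * A powr ((1 - 1/p) * p))" using I A by (simp only: powr_mult powr_powr)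
    also have "1 / p * p = 1" using p by simp
    also have "(1 - 1 / p) * p = p - 1" using p by (simp add: left_diff_distrib)
    also have "2 powr p * (I powr 1 * A powr (p - 1)) = 2 powr p * A powr (p - 1) * I" using I by simp
    finally show ?thesis .
  qed
  then show ?thesis using that X by blast
qed

text \<open>For \<open>r \<le> R\<close> the inner average is bounded uniformly by the assumption at scale \<open>R\<close>. For \<open>R < r\<close> the order of
integration is exchanged: the inner integral \<open>\<integral> w\<^sub>R(x, y) w\<^sub>r(z, x) d\<mu>(x)\<close> is at most
\<open>C R\<^sup>d (r / (\<bar>z\<bar> + r))\<^sup>2\<^sup>\<alpha>\<^sup>+\<^sup>1\<close>, vanishes unless \<open>\<bar>\<bar>z\<bar> - \<bar>y\<bar>\<bar> < 2 r\<close>, and so is dominated by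
\<open>w\<^sub>4\<^sub>r(z, y) + w\<^sub>4\<^sub>r(-z, y)\<close>.\<close>

lemma double_average_le:
  assumes \<alpha>: "\<alpha> \<ge> -1/2"
  obtains C :: real where "0 < C"
    "\<And>(h::real \<Rightarrow> ennreal) B D R r z. h \<in> borel_measurable borel \<Longrightarrow> 0 < R \<Longrightarrow> 0 < r \<Longrightarrow> 0 \<le> D \<Longrightarrow>
      (\<And>r. 0 < r \<Longrightarrow> 0 \<le> B r) \<Longrightarrow> (\<And>r s. 0 < r \<Longrightarrow> r \<le> s \<Longrightarrow> B s \<le> D * B r) \<Longrightarrow>
      (\<And>x r. 0 < r \<Longrightarrow> ball_integral \<alpha> r h x \<le> ennreal (B r * r powr dunkl_dim \<alpha>)) \<Longrightarrow>
      ball_integral \<alpha> r (\<lambda>x. ball_integral \<alpha> R h x) z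
       \<le> ennreal (C * D * R powr dunkl_dim \<alpha> * (B r * r powr dunkl_dim \<alpha>))"
proof -
  let ?d = "dunkl_dim \<alpha>" and ?M = "dunkl_measure \<alpha>"
  obtain C1 where C1: "0 < C1" "\<And>x r y. 0 < r \<Longrightarrow> ball_weight \<alpha> r x y \<le> ennreal (C1 * (r / (\<bar>x\<bar> + r)) powr (2 * \<alpha> + 1))"
    using ball_weight_le[OF \<alpha>] by metis
  obtain c where c: "0 < c" "\<And>x r y. 0 < r \<Longrightarrow> \<bar>\<bar>x\<bar> - \<bar>y\<bar>\<bar> < 2 * r \<Longrightarrow>
       ennreal (c * (r / (\<bar>x\<bar> + r)) powr (2 * \<alpha> + 1)) \<le> ball_weight \<alpha> (4 * r) x y + ball_weight \<alpha> (4 * r) (-x) y"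
    using ball_weight_pair_ge[OF \<alpha>] by metis
  obtain C2 where C2: "0 < C2" "\<And>x r. 0 < r \<Longrightarrow> (\<integral>\<^sup>+y. ball_weight \<alpha> r x y \<partial>?M) \<le> ennreal (C2 * r powr dunkl_dim \<alpha>)"
    using nn_integral_ball_weight_le[OF \<alpha>] by metis
  interpret M: sigma_finite_measure ?M by (rule sigma_finite_dunkl_measure)
  interpret P: pair_sigma_finite ?M ?M ..
  define K where "K = C1 / c * C2"
  have K: "0 < K" using C1 c C2 by (simp add: K_def)
  show ?thesis
  proof (rule that[of "C2 + 2 * K * 4 powr ?d"])
    show "0 < C2 + 2 * K * 4 powr ?d" using C2 K by (simp add: add_pos_nonneg)
    fix h :: "real \<Rightarrow> ennreal" and B :: "real \<Rightarrow> real" and D R r z :: real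
    assume h[measurable]: "h \<in> borel_measurable borel" and R: "0 < R" and r: "0 < r" and D: "0 \<le> D"
      and B: "\<And>r. 0 < r \<Longrightarrow> 0 \<le> B r" and BD: "\<And>r s. 0 < r \<Longrightarrow> r \<le> s \<Longrightarrow> B s \<le> D * B r"
      and hB: "\<And>x r. 0 < r \<Longrightarrow> ball_integral \<alpha> r h x \<le> ennreal (B r * r powr ?d)"
    note B[OF r, simp] D[simp]
    show "ball_integral \<alpha> r (\<lambda>x. ball_integral \<alpha> R h x) z
       \<le> ennreal ((C2 + 2 * K * 4 powr ?d) * D * R powr ?d * (B r * r powr ?d))"
    proof (cases "r \<le> R")
      case True
      have "ball_integral \<alpha> r (\<lambda>x. ball_integral \<alpha> R h x) z
        \<le> ball_integral \<alpha> r (\<lambda>x. ennreal (D * B r * R powr ?d)) z"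
      proof (intro nn_integral_mono mult_right_mono)
        fix x
        have "B R * R powr ?d \<le> D * B r * R powr ?d" using BD[OF r True] by (intro mult_right_mono) auto
        then show "ball_integral \<alpha> R h x \<le> ennreal (D * B r * R powr ?d)"
          using hB[OF R, of x] by (meson ennreal_leI order.trans)
      qed simp
      also have "\<dots> = ennreal (D * B r * R powr ?d) * (\<integral>\<^sup>+x. ball_weight \<alpha> r z x \<partial>?M)"
        by (subst nn_integral_cmult) auto
      also have "\<dots> \<le> ennreal (D * B r * R powr ?d) * ennreal (C2 * r powr ?d)"
        by (intro mult_left_mono C2 r) auto
      also have "\<dots> = ennreal (D * B r * R powr ?d * (C2 * r powr ?d))"
        using C2 by (subst ennreal_mult) auto
      also have "\<dots> \<le> ennreal ((C2 + 2 * K * 4 powr ?d) * D * R powr ?d * (B r * r powr ?d))"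
        using K by (intro ennreal_leI) (simp add: algebra_simps)
      finally show ?thesis .
    next
      case False
      have inner: "ball_integral \<alpha> r (\<lambda>x. ball_weight \<alpha> R x y) z
        \<le> ennreal (K * R powr ?d) * (ball_weight \<alpha> (4 * r) z y + ball_weight \<alpha> (4 * r) (- z) y)" for y
      proof (cases "\<bar>\<bar>z\<bar> - \<bar>y\<bar>\<bar> < 2 * r")
        case True
        let ?v = "(r / (\<bar>z\<bar> + r)) powr (2 * \<alpha> + 1)"
        have "ball_integral \<alpha> r (\<lambda>x. ball_weight \<alpha> R x y) z
          \<le> ball_integral \<alpha> R (\<lambda>x. ennreal (C1 * ?v)) y"
          by (intro nn_integral_mono, subst ball_weight_commute, subst mult.commute)
             (intro mult_right_mono C1 r, simp)
        also have "\<dots> = ennreal (C1 * ?v) * (\<integral>\<^sup>+x. ball_weight \<alpha> R y x \<partial>?M)"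
          by (subst nn_integral_cmult) auto
        also have "\<dots> \<le> ennreal (C1 * ?v) * ennreal (C2 * R powr ?d)" by (intro mult_left_mono C2 R) auto
        also have "\<dots> = ennreal (K * R powr ?d) * ennreal (c * ?v)"
          using C1 C2 c by (subst (1 2) ennreal_mult[symmetric]) (auto simp: K_def)
        also have "\<dots> \<le> ennreal (K * R powr ?d) * (ball_weight \<alpha> (4 * r) z y + ball_weight \<alpha> (4 * r) (- z) y)"
          by (intro mult_left_mono c r True) auto
        finally show ?thesis .
      next
        case out: False
        have zero: "ball_weight \<alpha> R x y * ball_weight \<alpha> r z x = 0" for x
        proof (cases "R \<le> \<bar>\<bar>x\<bar> - \<bar>y\<bar>\<bar>")
          case True
          show ?thesis unfolding ball_weight_eq_0[OF True] by simp
        next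
          case in_R: False
          have "r \<le> \<bar>c' - a'\<bar>" if "2 * r \<le> \<bar>c' - b'\<bar>" "\<bar>a' - b'\<bar> < R" "R < r" for a' b' c' :: real
            using that by linarith
          from this[of "\<bar>z\<bar>" "\<bar>y\<bar>" "\<bar>x\<bar>"] have "r \<le> \<bar>\<bar>z\<bar> - \<bar>x\<bar>\<bar>"
            using out False in_R by (simp only: not_less not_le)
          then show ?thesis by (simp only: ball_weight_eq_0 mult_zero_right)
        qed
        show ?thesis unfolding zero by simp
      qed
      have "ball_integral \<alpha> r (\<lambda>x. ball_integral \<alpha> R h x) z
        = (\<integral>\<^sup>+x. (\<integral>\<^sup>+y. h y * (ball_weight \<alpha> R x y * ball_weight \<alpha> r z x) \<partial>?M) \<partial>?M)"
        by (intro nn_integral_cong, subst nn_integral_multc[symmetric]) (auto simp: mult.assoc)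
      also have "\<dots> = (\<integral>\<^sup>+y. (\<integral>\<^sup>+x. h y * (ball_weight \<alpha> R x y * ball_weight \<alpha> r z x) \<partial>?M) \<partial>?M)"
        by (rule P.Fubini'[symmetric]) measurable
      also have "\<dots> = (\<integral>\<^sup>+y. h y * ball_integral \<alpha> r (\<lambda>x. ball_weight \<alpha> R x y) z \<partial>?M)"
        by (intro nn_integral_cong nn_integral_cmult) measurable
      also have "\<dots> \<le> (\<integral>\<^sup>+y. h y * (ennreal (K * R powr ?d) * (ball_weight \<alpha> (4 * r) z y + ball_weight \<alpha> (4 * r) (- z) y)) \<partial>?M)"
        by (intro nn_integral_mono mult_left_mono inner) auto
      also have "\<dots> = (\<integral>\<^sup>+y. ennreal (K * R powr ?d) * (h y * ball_weight \<alpha> (4 * r) z y + h y * ball_weight \<alpha> (4 * r) (- z) y) \<partial>?M)"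
        by (simp add: distrib_left mult_ac)
      also have "\<dots> = ennreal (K * R powr ?d) * (ball_integral \<alpha> (4 * r) h z + ball_integral \<alpha> (4 * r) h (- z))"
        by (simp add: nn_integral_cmult nn_integral_add)
      also have "\<dots> \<le> ennreal (K * R powr ?d) * (ennreal (B (4 * r) * (4 * r) powr ?d) + ennreal (B (4 * r) * (4 * r) powr ?d))"
        using r by (intro mult_left_mono add_mono hB) auto
      also have "\<dots> = ennreal (K * R powr ?d * (2 * (B (4 * r) * (4 * r) powr ?d)))"
        using r K B[of "4 * r"] by (subst ennreal_plus[symmetric]) (auto simp: ennreal_mult[symmetric])
      also have "\<dots> \<le> ennreal (K * R powr ?d * (2 * (D * B r * (4 * r) powr ?d)))"
        using r K BD[OF r, of "4 * r"] by (intro ennreal_leI mult_left_mono mult_right_mono) auto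
      also have "\<dots> \<le> ennreal ((C2 + 2 * K * 4 powr ?d) * D * R powr ?d * (B r * r powr ?d))"
        using C2 r by (intro ennreal_leI) (simp add: algebra_simps powr_mult)
      finally show ?thesis .
    qed
  qed
qed

section \<open>Estimates at a single scale\<close>

lemma locally_finite_if_weighted_finite:
  assumes \<alpha>: "\<alpha> \<ge> -1/2" and h[measurable]: "h \<in> borel_measurable borel"
    and fin: "\<And>r. 0 < r \<Longrightarrow> ball_integral \<alpha> r (\<lambda>u. ennreal (h u)) 0 < \<infinity>"
  shows "locally_finite \<alpha> h"
  unfolding locally_finite_def
proof
  fix R :: real
  obtain c where c: "0 < c" "\<And>x r y. 0 < r \<Longrightarrow> \<bar>\<bar>x\<bar> - \<bar>y\<bar>\<bar> < 2 * r \<Longrightarrow>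
       ennreal (c * (r / (\<bar>x\<bar> + r)) powr (2 * \<alpha> + 1)) \<le> ball_weight \<alpha> (4 * r) x y + ball_weight \<alpha> (4 * r) (-x) y"
    using ball_weight_pair_ge[OF \<alpha>] by metis
  define r where "r = \<bar>R\<bar> + 1"
  have r: "0 < r" by (simp add: r_def)
  have "ennreal c * (\<integral>\<^sup>+u. ennreal (h u) * indicator {-R..R} u \<partial>dunkl_measure \<alpha>)
    = (\<integral>\<^sup>+u. ennreal c * (ennreal (h u) * indicator {-R..R} u) \<partial>dunkl_measure \<alpha>)"
    by (subst nn_integral_cmult) auto
  also have "\<dots> \<le> (\<integral>\<^sup>+u. 2 * (ennreal (h u) * ball_weight \<alpha> (4 * r) 0 u) \<partial>dunkl_measure \<alpha>)"
  proof (intro nn_integral_mono)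
    fix u :: real
    show "ennreal c * (ennreal (h u) * indicator {-R..R} u) \<le> 2 * (ennreal (h u) * ball_weight \<alpha> (4 * r) 0 u)"
    proof (cases "u \<in> {-R..R}")
      case True
      then have "\<bar>\<bar>0\<bar> - \<bar>u\<bar>\<bar> < 2 * r" by (auto simp: r_def)
      \<comment> \<open>At \<open>x = 0\<close> the two weights of the pair coincide.\<close>
      from c(2)[OF r this] have "ennreal c \<le> ball_weight \<alpha> (4 * r) 0 u + ball_weight \<alpha> (4 * r) 0 u"
        using r by simp
      then have "ennreal c \<le> 2 * ball_weight \<alpha> (4 * r) 0 u" by (simp only: mult_2)
      from mult_right_mono[OF this, of "ennreal (h u)"]
      have "ennreal c * ennreal (h u) \<le> 2 * (ennreal (h u) * ball_weight \<alpha> (4 * r) 0 u)"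
        by (simp only: mult.assoc mult.commute[of "ball_weight \<alpha> (4 * r) 0 u"]) simp
      then show ?thesis using True by simp
    qed simp
  qed
  also have "\<dots> = 2 * ball_integral \<alpha> (4 * r) (\<lambda>u. ennreal (h u)) 0"
    by (subst nn_integral_cmult) auto
  also have "\<dots> < \<infinity>" using fin[of "4 * r"] r by (simp add: ennreal_mult_less_top)
  finally have *: "ennreal c * (\<integral>\<^sup>+u. ennreal (h u) * indicator {-R..R} u \<partial>dunkl_measure \<alpha>) < \<infinity>" .
  show "(\<integral>\<^sup>+u. ennreal (h u) * indicator {-R..R} u \<partial>dunkl_measure \<alpha>) < \<infinity>"
    using * c(1) by (auto simp: ennreal_mult_less_top)
qed

lemma locally_p_integrable_iff:
  fixes f :: "real \<Rightarrow> complex"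
  shows "locally_p_integrable \<alpha> p f \<longleftrightarrow> f \<in> borel_measurable borel \<and> locally_finite \<alpha> (\<lambda>u. norm (f u) powr p)"
proof (cases "f \<in> borel_measurable borel")
  case [measurable]: True
  have iff: "set_integrable (dunkl_measure \<alpha>) S (\<lambda>u. norm (f u) powr p)
      \<longleftrightarrow> (\<integral>\<^sup>+u. ennreal (norm (f u) powr p) * indicator S u \<partial>dunkl_measure \<alpha>) < \<infinity>"
    if [measurable]: "S \<in> sets borel" for S
  proof -
    have "(\<integral>\<^sup>+u. ennreal (norm (f u) powr p) * indicator S u \<partial>dunkl_measure \<alpha>)
      = (\<integral>\<^sup>+u. ennreal (norm (indicator S u *\<^sub>R (norm (f u) powr p))) \<partial>dunkl_measure \<alpha>)"
      by (intro nn_integral_cong) (auto simp: indicator_def)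
    then show ?thesis unfolding set_integrable_def integrable_iff_bounded by simp
  qed
  show ?thesis
  proof
    assume "locally_p_integrable \<alpha> p f"
    then have "set_integrable (dunkl_measure \<alpha>) {-R..R} (\<lambda>u. norm (f u) powr p)" for R
      unfolding locally_p_integrable_def by blast
    then show "f \<in> borel_measurable borel \<and> locally_finite \<alpha> (\<lambda>u. norm (f u) powr p)"
      unfolding locally_finite_def using iff by simp
  next
    assume R: "f \<in> borel_measurable borel \<and> locally_finite \<alpha> (\<lambda>u. norm (f u) powr p)"
    show "locally_p_integrable \<alpha> p f"
      unfolding locally_p_integrable_def
    proof (intro conjI allI impI)
      fix S :: "real set" assume S: "compact S"
      then have [measurable]: "S \<in> sets borel" by (simp add: borel_compact)
      obtain B where B: "\<And>x. x \<in> S \<Longrightarrow> \<bar>x\<bar> \<le> B" using compact_imp_bounded[OF S] by (auto simp: bounded_iff)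
      have "(\<integral>\<^sup>+u. ennreal (norm (f u) powr p) * indicator S u \<partial>dunkl_measure \<alpha>)
        \<le> (\<integral>\<^sup>+u. ennreal (norm (f u) powr p) * indicator {-B..B} u \<partial>dunkl_measure \<alpha>)"
        using B by (intro nn_integral_mono mult_left_mono) (auto simp: indicator_def abs_le_iff minus_le_iff)
      also have "\<dots> < \<infinity>" using R by (simp add: locally_finite_def)
      finally show "set_integrable (dunkl_measure \<alpha>) S (\<lambda>x. norm (f x) powr p)" by (simp add: iff)
    qed simp
  qed
qed (simp add: locally_p_integrable_def)

text \<open>With \<open>Y = R\<^sup>-\<^sup>d X\<close>, Hoelder's inequality bounds \<open>Y\<^sup>p\<close> by the average of \<open>\<bar>f\<bar>\<^sup>p\<close>, hence also \<open>Y\<close> by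
\<open>N \<phi>(R) \<le> N C0 R\<^sup>\<nu>\<close>. Writing \<open>Y\<^sup>q = Y\<^sup>q\<^sup>-\<^sup>p Y\<^sup>p\<close> and using each bound once leaves the power
\<open>R\<^sup>b\<^sup>q\<^sup>+\<^sup>\<nu>\<^sup>(\<^sup>q\<^sup>-\<^sup>p\<^sup>) = 1\<close>.\<close>

lemma single_scale_bound:
  assumes \<alpha>: "\<alpha> \<ge> -1/2" and p: "1 < p" "p \<le> q" and C0: "0 < C0" and bq: "b * q + \<nu> * (q - p) = 0"
  obtains C :: real where "0 < C"
    "\<And>(f::real \<Rightarrow> complex) N \<phi> R x. f \<in> borel_measurable borel \<Longrightarrow> 0 < R \<Longrightarrow> 0 \<le> N \<Longrightarrow> 0 < \<phi> R \<Longrightarrow>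
      \<phi> R \<le> C0 * R powr \<nu> \<Longrightarrow>
      ball_integral \<alpha> R (\<lambda>y. ennreal (norm (f y) powr p)) x
        \<le> ennreal ((N * \<phi> R) powr p * R powr dunkl_dim \<alpha>) \<Longrightarrow>
      \<exists>X\<ge>0. ball_integral \<alpha> R (\<lambda>y. ennreal (norm (f y))) x = ennreal X \<and>
        ennreal ((R powr (b - dunkl_dim \<alpha>) * X) powr q)
          \<le> ennreal (C * N powr (q - p)) * (ennreal (R powr (- dunkl_dim \<alpha>)) *
              ball_integral \<alpha> R (\<lambda>y. ennreal (norm (f y) powr p)) x)"
proof -
  let ?d = "dunkl_dim \<alpha>" and ?M = "dunkl_measure \<alpha>"
  obtain C2 where C2: "0 < C2" "\<And>x r. 0 < r \<Longrightarrow> (\<integral>\<^sup>+y. ball_weight \<alpha> r x y \<partial>?M) \<le> ennreal (C2 * r powr dunkl_dim \<alpha>)"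
    using nn_integral_ball_weight_le[OF \<alpha>] by metis
  define K where "K = 2 powr p * C2 powr (p - 1)"
  have K: "0 < K" using C2 by (simp add: K_def)
  define K' where "K' = (K powr (1 / p) * C0) powr (q - p) * K"
  show ?thesis
  proof (rule that[of K'])
    show "0 < K'" using K C0 by (simp add: K'_def)
    fix f :: "real \<Rightarrow> complex" and N R x :: real and \<phi> :: "real \<Rightarrow> real"
    assume [measurable]: "f \<in> borel_measurable borel" and R: "0 < R" and N: "0 \<le> N" and phi: "0 < \<phi> R" "\<phi> R \<le> C0 * R powr \<nu>"
      and le: "ball_integral \<alpha> R (\<lambda>y. ennreal (norm (f y) powr p)) x \<le> ennreal ((N * \<phi> R) powr p * R powr ?d)"
    define J where "J = enn2real (ball_integral \<alpha> R (\<lambda>y. ennreal (norm (f y) powr p)) x)"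
    have J: "ball_integral \<alpha> R (\<lambda>y. ennreal (norm (f y) powr p)) x = ennreal J" "0 \<le> J"
      using le by (auto simp: J_def le_less_trans)
    have JN: "J \<le> (N * \<phi> R) powr p * R powr ?d" using le unfolding J(1) by (subst (asm) ennreal_le_iff) auto
    obtain X where X: "0 \<le> X" "ball_integral \<alpha> R (\<lambda>y. ennreal (norm (f y))) x = ennreal X"
      "X powr p \<le> 2 powr p * (C2 * R powr ?d) powr (p - 1) * J"
      using weighted_power_mean[of "\<lambda>y. norm (f y)" ?M "ball_weight \<alpha> R x" p "C2 * R powr ?d" J] C2 R p J
      by (auto simp del: powr_mult)
    have main: "(R powr (b - ?d) * X) powr q \<le> K' * N powr (q - p) * (R powr (- ?d) * J)"
    proof (cases "X = 0")
      case True
      then show ?thesis using J K C0 by (simp add: K'_def)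
    next
      case False
      with X have X0: "0 < X" by simp
      define Y where "Y = R powr (- ?d) * X"
      have Y: "0 < Y" using X0 R by (simp add: Y_def)
      have Yp: "Y powr p \<le> K * (R powr (- ?d) * J)"
      proof -
        have "Y powr p = R powr (- ?d * p) * X powr p" using X0 by (simp add: Y_def powr_mult powr_powr)
        also have "\<dots> \<le> R powr (- ?d * p) * (2 powr p * (C2 * R powr ?d) powr (p - 1) * J)"
          by (intro mult_left_mono X) auto
        also have "\<dots> = K * (R powr (- ?d * p) * R powr (?d * (p - 1)) * J)"
          using C2 by (simp add: K_def powr_mult powr_powr)
        also have "R powr (- ?d * p) * R powr (?d * (p - 1)) = R powr (- ?d)"
          unfolding powr_add[symmetric] by (simp add: algebra_simps)
        finally show ?thesis by simp
      qed
      have "R powr (- ?d) * J \<le> R powr (- ?d) * ((N * \<phi> R) powr p * R powr ?d)" by (intro mult_left_mono JN) auto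
      also have "\<dots> = (N * \<phi> R) powr p" using R by (simp add: powr_minus field_simps)
      finally have "K * (R powr (- ?d) * J) \<le> K * (N * \<phi> R) powr p" using K by (intro mult_left_mono) auto
      with Yp have "Y powr p \<le> K * (N * \<phi> R) powr p" by linarith
      then have "(Y powr p) powr (1 / p) \<le> (K * (N * \<phi> R) powr p) powr (1 / p)" using p by (intro powr_mono2) auto
      then have "Y \<le> K powr (1 / p) * (N * \<phi> R)" using p Y K N phi by (simp add: powr_powr powr_mult)
      also have "\<dots> \<le> K powr (1 / p) * (N * (C0 * R powr \<nu>))" using phi N by (intro mult_left_mono) auto
      finally have Yle: "Y \<le> (K powr (1 / p) * C0) * N * R powr \<nu>" by (simp add: mult_ac)
      have "Y powr (q - p) \<le> ((K powr (1 / p) * C0) * N * R powr \<nu>) powr (q - p)" using Yle Y p by (intro powr_mono2) auto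
      also have "\<dots> = (K powr (1 / p) * C0) powr (q - p) * N powr (q - p) * R powr (\<nu> * (q - p))"
        using K C0 N by (simp only: powr_mult powr_powr)
      finally have Yq: "Y powr (q - p) \<le> (K powr (1 / p) * C0) powr (q - p) * N powr (q - p) * R powr (\<nu> * (q - p))" .
      have "R powr (b - ?d) * X = R powr b * Y" using R by (simp add: Y_def powr_diff powr_minus field_simps)
      then have "(R powr (b - ?d) * X) powr q = R powr (b * q) * Y powr q" using Y by (simp add: powr_mult powr_powr)
      also have "Y powr q = Y powr (q - p) * Y powr p" by (simp flip: powr_add)
      also have "R powr (b * q) * \<dots> \<le> R powr (b * q) * (((K powr (1 / p) * C0) powr (q - p) * N powr (q - p) * R powr (\<nu> * (q - p))) * (K * (R powr (- ?d) * J)))"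
        by (intro mult_left_mono mult_mono Yq Yp) auto
      also have "\<dots> = (R powr (b * q) * R powr (\<nu> * (q - p))) * (K' * N powr (q - p) * (R powr (- ?d) * J))"
        by (simp add: K'_def mult_ac)
      also have "R powr (b * q) * R powr (\<nu> * (q - p)) = 1" using R unfolding powr_add[symmetric] bq by simp
      finally show ?thesis by simp
    qed
    show "\<exists>X\<ge>0. ball_integral \<alpha> R (\<lambda>y. ennreal (norm (f y))) x = ennreal X \<and>
        ennreal ((R powr (b - ?d) * X) powr q)
          \<le> ennreal (K' * N powr (q - p)) * (ennreal (R powr (- ?d)) *
              ball_integral \<alpha> R (\<lambda>y. ennreal (norm (f y) powr p)) x)"
    proof (intro exI[of _ X] conjI X)
      have "ennreal ((R powr (b - ?d) * X) powr q) \<le> ennreal (K' * N powr (q - p) * (R powr (- ?d) * J))" by (rule ennreal_leI[OF main])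
      also have "\<dots> = ennreal (K' * N powr (q - p)) * (ennreal (R powr (- ?d)) * ennreal J)"
        using K C0 J by (simp add: ennreal_mult K'_def)
      finally show "ennreal ((R powr (b - ?d) * X) powr q)
          \<le> ennreal (K' * N powr (q - p)) * (ennreal (R powr (- ?d)) *
              ball_integral \<alpha> R (\<lambda>y. ennreal (norm (f y) powr p)) x)" unfolding J(1) .
    qed
  qed
qed

lemma translated_kernel_le:
  assumes \<alpha>: "\<alpha> \<ge> -1/2"
    and L: "\<And>u. 0 \<le> u \<Longrightarrow> ennreal (u powr (\<beta> - dunkl_dim \<alpha>) / (1 + u) powr \<gamma>)
        \<le> (\<Sum>n. ennreal (a n) * indicator {..<R n} u)"
  shows "ennreal \<bar>dunkl_translation \<alpha> x (bessel_riesz_kernel \<alpha> \<beta> \<gamma>) y\<bar> \<le> (\<Sum>n. ennreal (a n) * ball_weight \<alpha> (R n) x y)"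
proof -
  have [measurable]: "bessel_riesz_kernel \<alpha> \<beta> \<gamma> \<in> borel_measurable borel"
    unfolding bessel_riesz_kernel_def by measurable
  have "ennreal \<bar>dunkl_translation \<alpha> x (bessel_riesz_kernel \<alpha> \<beta> \<gamma>) y\<bar> \<le> radial_translation \<alpha> (\<lambda>u. ennreal \<bar>bessel_riesz_kernel \<alpha> \<beta> \<gamma> u\<bar>) x y"
    by (rule abs_dunkl_translation_even_le[OF _ _ \<alpha>]) (simp_all add: bessel_riesz_kernel_def)
  also have "\<dots> \<le> radial_translation \<alpha> (\<lambda>u. \<Sum>n. ennreal (a n) * indicator {..<R n} u) x y"
    using L by (intro radial_translation_mono) (simp add: bessel_riesz_kernel_def)
  also have "\<dots> = (\<Sum>n. ennreal (a n) * ball_weight \<alpha> (R n) x y)"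
    by (subst radial_translation_suminf) (auto simp: radial_translation_cmult ball_weight_def)
  finally show ?thesis .
qed

lemma measurable_bessel_riesz_integrand:
  assumes [measurable]: "f \<in> borel_measurable borel"
  shows "(\<lambda>(x, y). bessel_riesz_integrand \<alpha> \<beta> \<gamma> f x y) \<in> borel_measurable (borel \<Otimes>\<^sub>M borel)"
proof -
  have K: "bessel_riesz_kernel \<alpha> \<beta> \<gamma> \<in> borel_measurable borel"
    unfolding bessel_riesz_kernel_def by measurable
  note [measurable] = measurable_dunkl_translation[OF K, of \<alpha>, unfolded split_beta']
  show ?thesis unfolding bessel_riesz_integrand_def split_beta' by measurable
qed

lemma measurable_bessel_riesz_operator:
  assumes "f \<in> borel_measurable borel"
  shows "bessel_riesz_operator \<alpha> \<beta> \<gamma> f \<in> borel_measurable borel"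
proof -
  interpret M: sigma_finite_measure "dunkl_measure \<alpha>" by (rule sigma_finite_dunkl_measure)
  note [measurable] = measurable_bessel_riesz_integrand[OF assms, of \<alpha> \<beta> \<gamma>]
  show ?thesis unfolding bessel_riesz_operator_def by measurable
qed

section \<open>The Bessel-Riesz operator on Morrey spaces\<close>

text \<open>Let \<open>T(x)\<close> be the \<open>\<Lambda>\<close>-weighted sum over the dyadic scales of the averages of \<open>\<bar>f\<bar>\<^sup>p\<close>. By
\<open>double_average_le\<close> the integral of \<open>T\<close> against every weight is finite with the desired bound, so \<open>T\<close> is finite
almost everywhere. Where it is finite, the single-scale bounds and convexity of \<open>x\<^sup>q\<close> show that the operator
converges absolutely and that its \<open>q\<close>-th power is at most a multiple of \<open>N\<^sup>q\<^sup>-\<^sup>p T\<close>.\<close>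

lemma bessel_riesz_weighted_bound:
  assumes \<alpha>: "\<alpha> \<ge> -1/2" and \<beta>: "\<beta> < dunkl_dim \<alpha>" "b < \<beta>" "\<beta> - \<gamma> < b" and \<gamma>: "0 \<le> \<gamma>"
    and p: "1 < p" "p \<le> q" and C0: "0 < C0" and D: "0 < D" and bq: "b * q + \<nu> * (q - p) = 0"
  obtains C :: real where "0 < C"
    "\<And>(f::real \<Rightarrow> complex) N \<phi>. f \<in> borel_measurable borel \<Longrightarrow> 0 \<le> N \<Longrightarrow> (\<And>r. 0 < r \<Longrightarrow> 0 < \<phi> r) \<Longrightarrow>
      (\<And>r. 0 < r \<Longrightarrow> \<phi> r \<le> C0 * r powr \<nu>) \<Longrightarrow> (\<And>r s. 0 < r \<Longrightarrow> r \<le> s \<Longrightarrow> \<phi> s \<le> D * \<phi> r) \<Longrightarrow>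
      (\<And>x r. 0 < r \<Longrightarrow> ball_integral \<alpha> r (\<lambda>y. ennreal (norm (f y) powr p)) x
        \<le> ennreal ((N * \<phi> r) powr p * r powr dunkl_dim \<alpha>)) \<Longrightarrow>
      (AE x in dunkl_measure \<alpha>. integrable (dunkl_measure \<alpha>) (bessel_riesz_integrand \<alpha> \<beta> \<gamma> f x)) \<and>
      (\<forall>z r. 0 < r \<longrightarrow> ball_integral \<alpha> r (\<lambda>x. ennreal (norm (bessel_riesz_operator \<alpha> \<beta> \<gamma> f x) powr q)) z
        \<le> ennreal (C * (N powr q * \<phi> r powr p * r powr dunkl_dim \<alpha>)))"
proof -
  let ?d = "dunkl_dim \<alpha>" and ?M = "dunkl_measure \<alpha>"
  interpret M: sigma_finite_measure ?M by (rule sigma_finite_dunkl_measure)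
  obtain \<Lambda> R :: "nat \<Rightarrow> real" where R: "\<And>n. 0 < R n" and L: "\<And>n. 0 < \<Lambda> n" "summable \<Lambda>"
    and kernel: "\<And>u. 0 \<le> u \<Longrightarrow> ennreal (u powr (\<beta> - ?d) / (1 + u) powr \<gamma>)
        \<le> (\<Sum>n. ennreal (\<Lambda> n * R n powr (b - ?d)) * indicator {..<R n} u)"
    by (rule dyadic_kernel_bound[OF \<beta> \<gamma>]) (rule that)
  show ?thesis
  proof (cases rule: single_scale_bound[OF \<alpha> p C0 bq])
  case C1: (1 C1)
  show ?thesis
  proof (cases rule: double_average_le[OF \<alpha>])
  case C2: (1 C2)
  define l where "l = (\<Sum>n. \<Lambda> n)"
  have l: "0 < l" unfolding l_def using L by (intro suminf_pos) auto
  have lsum: "(\<Sum>n. ennreal (\<Lambda> n)) = ennreal l"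
    unfolding l_def using L by (intro suminf_ennreal2) (auto intro: less_imp_le)
  define K where "K = 2 powr q * l powr (q - 1) * C1"
  have K: "0 < K" using l C1 by (simp add: K_def)
  show ?thesis
  proof (rule that[of "K * (l * C2 * D powr p)"])
    show "0 < K * (l * C2 * D powr p)" using K l C2 D by simp
    fix f :: "real \<Rightarrow> complex" and N :: real and \<phi> :: "real \<Rightarrow> real"
    let ?g = "bessel_riesz_operator \<alpha> \<beta> \<gamma> f" and ?integrand = "bessel_riesz_integrand \<alpha> \<beta> \<gamma> f"
    assume f[measurable]: "f \<in> borel_measurable borel" and N: "0 \<le> N" and phi: "\<And>r. 0 < r \<Longrightarrow> 0 < \<phi> r"
      "\<And>r. 0 < r \<Longrightarrow> \<phi> r \<le> C0 * r powr \<nu>" "\<And>r s. 0 < r \<Longrightarrow> r \<le> s \<Longrightarrow> \<phi> s \<le> D * \<phi> r"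
      and fN: "\<And>x r. 0 < r \<Longrightarrow> ball_integral \<alpha> r (\<lambda>y. ennreal (norm (f y) powr p)) x
        \<le> ennreal ((N * \<phi> r) powr p * r powr ?d)"
    define G where "G = (\<lambda>n x. \<integral>\<^sup>+y. ennreal (norm (f y) powr p) * ball_weight \<alpha> (R n) x y \<partial>?M)"
    have [measurable]: "G n \<in> borel_measurable borel" for n unfolding G_def by measurable
    define T where "T = (\<lambda>x. \<Sum>n. ennreal (\<Lambda> n) * (ennreal (R n powr (- ?d)) * G n x))"
    have [measurable]: "T \<in> borel_measurable borel" unfolding T_def by measurable
    have Tint: "ball_integral \<alpha> r (\<lambda>x. T x) z \<le> ennreal (l * C2 * D powr p * ((N * \<phi> r) powr p * r powr ?d))"
      if r: "0 < r" for r z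
    proof -
      let ?E = "C2 * D powr p * ((N * \<phi> r) powr p * r powr ?d)"
      have E: "0 \<le> ?E" using C2 by simp
      have "ball_integral \<alpha> r (\<lambda>x. T x) z
        = (\<integral>\<^sup>+x. (\<Sum>n. ennreal (\<Lambda> n) * (ennreal (R n powr (- ?d)) * (G n x * ball_weight \<alpha> r z x))) \<partial>?M)"
        unfolding T_def by (simp only: ennreal_suminf_multc[symmetric] mult.assoc)
      also have "\<dots> = (\<Sum>n. \<integral>\<^sup>+x. ennreal (\<Lambda> n) * (ennreal (R n powr (- ?d)) * (G n x * ball_weight \<alpha> r z x)) \<partial>?M)"
        by (intro nn_integral_suminf) measurable
      also have "\<dots> = (\<Sum>n. ennreal (\<Lambda> n) * (ennreal (R n powr (- ?d)) * ball_integral \<alpha> r (\<lambda>x. G n x) z))"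
        by (simp add: nn_integral_cmult)
      also have "\<dots> \<le> (\<Sum>n. ennreal (\<Lambda> n) * ennreal ?E)"
      proof (intro suminf_le mult_left_mono)
        fix n
        have "ball_integral \<alpha> r (\<lambda>x. G n x) z \<le> ennreal (C2 * D powr p * R n powr ?d * ((N * \<phi> r) powr p * r powr ?d))"
          unfolding G_def
        proof (rule C2(2))
          fix r s :: real assume rs: "0 < r" "r \<le> s"
          have "(N * \<phi> s) powr p \<le> (D * (N * \<phi> r)) powr p"
            using mult_left_mono[OF phi(3)[OF rs] N] phi(1)[of s] N rs p
            by (intro powr_mono2) (auto simp: mult.left_commute)
          then show "(N * \<phi> s) powr p \<le> D powr p * (N * \<phi> r) powr p"
            using phi(1)[of r] N rs D by (simp add: powr_mult)
        qed (use R r fN in auto)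
        then have "ennreal (R n powr (- ?d)) * ball_integral \<alpha> r (\<lambda>x. G n x) z \<le>
           ennreal (R n powr (- ?d)) * ennreal (C2 * D powr p * R n powr ?d * ((N * \<phi> r) powr p * r powr ?d))"
          by (rule mult_left_mono) simp
        also have "\<dots> = ennreal ((R n powr (- ?d) * R n powr ?d) * ?E)"
          using C2 by (subst ennreal_mult[symmetric]) (auto simp: mult_ac)
        also have "R n powr (- ?d) * R n powr ?d = 1" using R[of n] by (simp flip: powr_add)
        finally show "ennreal (R n powr (- ?d)) * ball_integral \<alpha> r (\<lambda>x. G n x) z \<le> ennreal ?E" by simp
      qed auto
      also have "\<dots> = ennreal l * ennreal ?E" by (simp only: ennreal_suminf_multc lsum)
      also have "\<dots> = ennreal (l * C2 * D powr p * ((N * \<phi> r) powr p * r powr ?d))"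
        using l E by (subst ennreal_mult[symmetric]) (auto simp: mult.assoc)
      finally show ?thesis .
    qed
    have Tfin: "AE x in ?M. T x < \<infinity>"
    proof -
      have "AE x in ?M. \<bar>x\<bar> < 2 * real (Suc k) \<longrightarrow> T x < \<infinity>" for k
      proof -
        define r where "r = 4 * real (Suc k)"
        have r: "0 < r" by (simp add: r_def)
        have "ball_integral \<alpha> r (\<lambda>x. T x) 0 \<noteq> \<infinity>"
          using Tint[OF r, of 0] by (auto simp: top_unique)
        then have "AE x in ?M. T x * ball_weight \<alpha> r 0 x \<noteq> \<infinity>"
          by (intro nn_integral_PInf_AE) auto
        then show ?thesis
        proof eventually_elim
          case (elim x)
          then have "T x < \<infinity>" if "\<bar>x\<bar> < r / 2"
            using ball_weight_0_nonzero[OF \<alpha> r that] by (auto simp: ennreal_mult_eq_top_iff less_top)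
          then show ?case by (simp add: r_def)
        qed
      qed
      then have "AE x in ?M. \<forall>k. \<bar>x\<bar> < 2 * real (Suc k) \<longrightarrow> T x < \<infinity>" unfolding AE_all_countable by blast
      then show ?thesis
      proof eventually_elim
        case (elim x)
        obtain k where "\<bar>x\<bar> < real k" using reals_Archimedean2 by blast
        then have "\<bar>x\<bar> < 2 * real (Suc k)" by simp
        then show ?case using elim by blast
      qed
    qed
    have point: "integrable ?M (?integrand x) \<and>
        ennreal (norm (?g x) powr q) \<le> ennreal (K * N powr (q - p)) * T x"
      if Tx: "T x < \<infinity>" for x
    proof -
      have "\<exists>X\<ge>0. ball_integral \<alpha> (R n) (\<lambda>y. ennreal (norm (f y))) x = ennreal X \<and>
        ennreal ((R n powr (b - ?d) * X) powr q) \<le> ennreal (C1 * N powr (q - p)) * (ennreal (R n powr (- ?d)) * G n x)" for n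
        unfolding G_def by (rule C1(2)[of f "R n" N \<phi>, OF f R N phi(1) phi(2) fN]) (rule R)+
      then obtain X where X: "\<And>n. 0 \<le> X n" "\<And>n. ball_integral \<alpha> (R n) (\<lambda>y. ennreal (norm (f y))) x = ennreal (X n)"
        "\<And>n. ennreal ((R n powr (b - ?d) * X n) powr q) \<le> ennreal (C1 * N powr (q - p)) * (ennreal (R n powr (- ?d)) * G n x)"
        by metis
      define g where "g = (\<lambda>n. R n powr (b - ?d) * X n)"
      have g0: "0 \<le> g n" for n using X by (simp add: g_def)
      define I where "I = enn2real (ennreal (C1 * N powr (q - p)) * T x)"
      have I: "ennreal (C1 * N powr (q - p)) * T x = ennreal I" "0 \<le> I"
        using Tx by (auto simp: I_def ennreal_mult_less_top)
      have gI: "(\<Sum>n. ennreal (g n powr q) * ennreal (\<Lambda> n)) \<le> ennreal I"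
      proof -
        have "(\<Sum>n. ennreal (g n powr q) * ennreal (\<Lambda> n)) \<le> (\<Sum>n. ennreal (C1 * N powr (q - p)) * (ennreal (\<Lambda> n) * (ennreal (R n powr (- ?d)) * G n x)))"
        proof (intro suminf_le)
          fix n
          have "ennreal (\<Lambda> n) * ennreal (g n powr q) \<le> ennreal (\<Lambda> n) * (ennreal (C1 * N powr (q - p)) * (ennreal (R n powr (- ?d)) * G n x))"
            unfolding g_def by (intro mult_left_mono X) auto
          then show "ennreal (g n powr q) * ennreal (\<Lambda> n) \<le> ennreal (C1 * N powr (q - p)) * (ennreal (\<Lambda> n) * (ennreal (R n powr (- ?d)) * G n x))"
            by (simp only: mult_ac)
        qed auto
        also have "\<dots> = ennreal I" by (simp only: ennreal_suminf_cmult I(1)[symmetric] T_def)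
        finally show ?thesis .
      qed
      obtain J where J: "0 \<le> J" "(\<Sum>n. ennreal (g n) * ennreal (\<Lambda> n)) = ennreal J" "J powr q \<le> 2 powr q * l powr (q - 1) * I"
        using weighted_power_mean[of g "count_space UNIV" "\<lambda>n. ennreal (\<Lambda> n)" q l I] g0 p l I gI lsum
        by (auto simp: nn_integral_count_space_nat)
      have int: "(\<integral>\<^sup>+y. ennreal (norm (?integrand x y)) \<partial>?M) \<le> ennreal J"
      proof -
        have "(\<integral>\<^sup>+y. ennreal (norm (?integrand x y)) \<partial>?M)
          \<le> (\<integral>\<^sup>+y. (\<Sum>n. ennreal (\<Lambda> n * R n powr (b - ?d)) * (ennreal (norm (f y)) * ball_weight \<alpha> (R n) x y)) \<partial>?M)"
        proof (intro nn_integral_mono)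
          fix y
          have "ennreal (norm (?integrand x y)) = ennreal (norm (f y)) * ennreal \<bar>dunkl_translation \<alpha> x (bessel_riesz_kernel \<alpha> \<beta> \<gamma>) y\<bar>"
            by (simp add: bessel_riesz_integrand_def norm_mult ennreal_mult)
          also have "\<dots> \<le> ennreal (norm (f y)) * (\<Sum>n. ennreal (\<Lambda> n * R n powr (b - ?d)) * ball_weight \<alpha> (R n) x y)"
            by (intro mult_left_mono translated_kernel_le[OF \<alpha> kernel]) auto
          also have "\<dots> = (\<Sum>n. ennreal (\<Lambda> n * R n powr (b - ?d)) * (ennreal (norm (f y)) * ball_weight \<alpha> (R n) x y))"
            by (simp only: ennreal_suminf_cmult[symmetric] mult.left_commute)
          finally show "ennreal (norm (?integrand x y)) \<le> \<dots>" .
        qed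
        also have "\<dots> = (\<Sum>n. \<integral>\<^sup>+y. ennreal (\<Lambda> n * R n powr (b - ?d)) * (ennreal (norm (f y)) * ball_weight \<alpha> (R n) x y) \<partial>?M)"
          by (intro nn_integral_suminf) measurable
        also have "\<dots> = (\<Sum>n. ennreal (\<Lambda> n * R n powr (b - ?d)) * ennreal (X n))"
          by (simp add: nn_integral_cmult X(2))
        also have "\<dots> = (\<Sum>n. ennreal (g n) * ennreal (\<Lambda> n))"
          using L X(1) by (intro suminf_cong) (simp add: g_def less_imp_le mult_ac flip: ennreal_mult)
        finally show ?thesis unfolding J(2) .
      qed
      have meas: "?integrand x \<in> borel_measurable ?M"
        using measurable_compose[OF measurable_Pair1'[of x borel borel] measurable_bessel_riesz_integrand[OF f]] by simp
      have integ: "integrable ?M (?integrand x)"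
        by (rule integrableI_bounded[OF meas]) (rule le_less_trans[OF int], simp)
      have "ennreal (norm (?g x)) \<le> ennreal J"
        unfolding bessel_riesz_operator_def by (rule order.trans[OF integral_norm_bound_ennreal[OF integ] int])
      then have "norm (?g x) \<le> J" using J by simp
      then have "norm (?g x) powr q \<le> J powr q" using p by (intro powr_mono2) auto
      also have "\<dots> \<le> 2 powr q * l powr (q - 1) * I" by (rule J)
      finally have "ennreal (norm (?g x) powr q) \<le> ennreal (2 powr q * l powr (q - 1) * I)" by (rule ennreal_leI)
      also have "\<dots> = ennreal (2 powr q * l powr (q - 1)) * (ennreal (C1 * N powr (q - p)) * T x)"
        unfolding I(1) using I(2) by (rule ennreal_mult'')
      also have "\<dots> = ennreal (K * N powr (q - p)) * T x"
        using C1 N by (simp add: K_def mult.assoc[symmetric] flip: ennreal_mult)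
      finally show ?thesis using integ by simp
    qed
    show "(AE x in ?M. integrable ?M (?integrand x)) \<and>
      (\<forall>z r. 0 < r \<longrightarrow> ball_integral \<alpha> r (\<lambda>x. ennreal (norm (?g x) powr q)) z
        \<le> ennreal (K * (l * C2 * D powr p) * (N powr q * \<phi> r powr p * r powr ?d)))"
    proof (intro conjI allI impI)
      show "AE x in ?M. integrable ?M (?integrand x)"
        using Tfin by eventually_elim (use point in blast)
      fix z r :: real assume r: "0 < r"
      have "ball_integral \<alpha> r (\<lambda>x. ennreal (norm (?g x) powr q)) z
        \<le> (\<integral>\<^sup>+x. ennreal (K * N powr (q - p)) * (T x * ball_weight \<alpha> r z x) \<partial>?M)"
      proof (rule nn_integral_mono_AE)
        show "AE x in ?M. ennreal (norm (?g x) powr q) * ball_weight \<alpha> r z x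
          \<le> ennreal (K * N powr (q - p)) * (T x * ball_weight \<alpha> r z x)"
          using Tfin
        proof eventually_elim
          case (elim x)
          then show ?case using mult_right_mono[OF conjunct2[OF point[OF elim]], of "ball_weight \<alpha> r z x"]
            by (simp only: mult.assoc zero_le)
        qed
      qed
      also have "\<dots> = ennreal (K * N powr (q - p)) * ball_integral \<alpha> r (\<lambda>x. T x) z"
        by (subst nn_integral_cmult) auto
      also have "\<dots> \<le> ennreal (K * N powr (q - p)) * ennreal (l * C2 * D powr p * ((N * \<phi> r) powr p * r powr ?d))"
        by (intro mult_left_mono Tint r) auto
      also have "\<dots> = ennreal (K * N powr (q - p) * (l * C2 * D powr p * ((N * \<phi> r) powr p * r powr ?d)))"
        using K l C2 by (subst ennreal_mult) auto
      also have "K * N powr (q - p) * (l * C2 * D powr p * ((N * \<phi> r) powr p * r powr ?d))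
        = K * (l * C2 * D powr p) * ((N powr (q - p) * N powr p) * \<phi> r powr p * r powr ?d)"
        using N phi(1)[OF r] by (simp add: powr_mult mult_ac)
      also have "N powr (q - p) * N powr p = N powr q" by (simp flip: powr_add)
      finally show "ball_integral \<alpha> r (\<lambda>x. ennreal (norm (?g x) powr q)) z
        \<le> ennreal (K * (l * C2 * D powr p) * (N powr q * \<phi> r powr p * r powr ?d))" .
    qed
  qed
  qed
  qed
qed

text \<open>The ball of radius \<open>1\<close> with \<open>x = 0\<close> already contributes a positive amount to the supremum. The hypothesis
\<open>s (d - \<beta>) < d\<close> makes \<open>K\<^sup>s\<close> locally integrable; a divergent integral would have the value \<open>0\<close>.\<close>

lemma kernel_morrey_norm_pos:
  assumes \<alpha>: "\<alpha> \<ge> -1/2" and s: "1 \<le> s" and \<beta>: "s * (dunkl_dim \<alpha> - \<beta>) < dunkl_dim \<alpha>" and \<gamma>: "0 \<le> \<gamma>"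
  obtains k :: real where "0 < k" "ennreal k \<le> dunkl_morrey_norm \<alpha> s t (bessel_riesz_kernel \<alpha> \<beta> \<gamma>)"
proof -
  let ?M = "dunkl_measure \<alpha>" and ?K = "bessel_riesz_kernel \<alpha> \<beta> \<gamma>"
  define h where "h = (\<lambda>u. norm (?K u) powr s)"
  have [measurable]: "?K \<in> borel_measurable borel" unfolding bessel_riesz_kernel_def by measurable
  have h[measurable]: "h \<in> borel_measurable borel" unfolding h_def by measurable
  define A where "A = 2 powr (\<alpha> + 1) * Gamma (\<alpha> + 1)"
  have A: "A > 0" using \<alpha> unfolding A_def by (intro mult_pos_pos Gamma_real_pos) auto
  define a where "a = s * (\<beta> - dunkl_dim \<alpha>) + (2 * \<alpha> + 1)"
  have a: "a > -1" using \<beta> by (simp add: a_def dunkl_dim_def algebra_simps)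
  have hle: "h u \<le> \<bar>u\<bar> powr (s * (\<beta> - dunkl_dim \<alpha>))" for u
  proof -
    have "norm (?K u) \<le> \<bar>u\<bar> powr (\<beta> - dunkl_dim \<alpha>) / 1"
      unfolding bessel_riesz_kernel_def using \<gamma> by (simp, intro divide_left_mono[of 1, simplified] ge_one_powr_ge_zero) auto
    then have "h u \<le> (\<bar>u\<bar> powr (\<beta> - dunkl_dim \<alpha>)) powr s" unfolding h_def using s by (intro powr_mono2) auto
    then show ?thesis by (simp add: powr_powr mult.commute)
  qed
  have loc: "locally_finite \<alpha> h"
    unfolding locally_finite_def
  proof
    fix R :: real
    let ?F = "\<lambda>u. ennreal (indicator {0..\<bar>R\<bar>} u * u powr a)"
    have "(\<integral>\<^sup>+u. ennreal (h u) * indicator {-R..R} u \<partial>?M) = (\<integral>\<^sup>+u. ennreal (dunkl_density \<alpha> u) * (ennreal (h u) * indicator {-R..R} u) \<partial>lborel)"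
      by (subst nn_integral_dunkl_measure) auto
    also have "\<dots> \<le> (\<integral>\<^sup>+u. ennreal (1 / A) * (?F u + ?F (0 + (-1) * u)) \<partial>lborel)"
    proof (intro nn_integral_mono)
      fix u :: real
      show "ennreal (dunkl_density \<alpha> u) * (ennreal (h u) * indicator {-R..R} u) \<le> ennreal (1 / A) * (?F u + ?F (0 + (-1) * u))"
      proof (cases "u \<in> {-R..R}")
        case True
        have "dunkl_density \<alpha> u * h u \<le> (\<bar>u\<bar> powr (2 * \<alpha> + 1) / A) * \<bar>u\<bar> powr (s * (\<beta> - dunkl_dim \<alpha>))"
          unfolding dunkl_density_def A_def[symmetric] using A by (intro mult_left_mono hle) auto
        also have "\<dots> = 1 / A * \<bar>u\<bar> powr a" by (simp add: a_def powr_add)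
        finally have "ennreal (dunkl_density \<alpha> u * h u) \<le> ennreal (1 / A * \<bar>u\<bar> powr a)" by (rule ennreal_leI)
        also have "ennreal (1 / A * \<bar>u\<bar> powr a) = ennreal (1 / A) * ennreal (\<bar>u\<bar> powr a)" by (rule ennreal_mult'') simp
        also have "ennreal (\<bar>u\<bar> powr a) \<le> ?F u + ?F (0 + (-1) * u)"
          using True by (cases "0 \<le> u") (auto simp: indicator_def)
        finally have "ennreal (dunkl_density \<alpha> u * h u) \<le> ennreal (1 / A) * (?F u + ?F (0 + (-1) * u))" by (simp add: mult_left_mono)
        then show ?thesis using True by (simp add: ennreal_mult'' h_def)
      qed simp
    qed
    also have "\<dots> = ennreal (1 / A) * ((\<integral>\<^sup>+u. ?F u \<partial>lborel) + (\<integral>\<^sup>+u. ?F (0 + (-1) * u) \<partial>lborel))"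
      by (subst nn_integral_cmult, measurable, subst nn_integral_add) auto
    also have "(\<integral>\<^sup>+u. ?F (0 + (-1) * u) \<partial>lborel) = (\<integral>\<^sup>+u. ?F u \<partial>lborel)"
      by (subst nn_integral_real_affine[of ?F "-1" 0]) auto
    also have "(\<integral>\<^sup>+u. ?F u \<partial>lborel) = ennreal (\<bar>R\<bar> powr (a + 1) / (a + 1))" by (rule nn_integral_powr_from_0[OF a]) simp
    also have "ennreal (1 / A) * (ennreal (\<bar>R\<bar> powr (a + 1) / (a + 1)) + ennreal (\<bar>R\<bar> powr (a + 1) / (a + 1))) < \<infinity>"
      by (simp add: ennreal_mult_less_top)
    finally show "(\<integral>\<^sup>+u. ennreal (h u) * indicator {-R..R} u \<partial>?M) < \<infinity>" .
  qed
  have h0: "0 \<le> h u" for u by (simp add: h_def)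
  define I where "I = (LINT y:ball 0 1|?M. dunkl_translation \<alpha> 0 h y)"
  note D = dunkl_duality[OF \<alpha> h h0 loc, of 1 0, folded I_def]
  have I0: "0 \<le> I" and I: "ennreal I = ball_integral \<alpha> 1 (\<lambda>u. ennreal (h u)) 0"
    using D(2,3) by simp_all
  have "I \<noteq> 0"
  proof
    assume "I = 0"
    then have "AE u in ?M. ennreal (h u) * ball_weight \<alpha> 1 0 u = 0"
      using I by (subst (asm) eq_commute) (simp add: nn_integral_0_iff_AE)
    then have vanish: "AE u in lborel. 0 < ennreal (dunkl_density \<alpha> u) \<longrightarrow> ennreal (h u) * ball_weight \<alpha> 1 0 u = 0"
      unfolding dunkl_measure_eq by (subst (asm) AE_density) auto
    have pos: "\<not> (0 < ennreal (dunkl_density \<alpha> u) \<longrightarrow> ennreal (h u) * ball_weight \<alpha> 1 0 u = 0)" if u: "u \<in> {0<..<1/2}" for u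
    proof -
      have "0 < dunkl_density \<alpha> u" unfolding dunkl_density_def A_def[symmetric] using u A by simp
      moreover have "0 < h u" using u by (simp add: h_def bessel_riesz_kernel_def)
      moreover have "ball_weight \<alpha> 1 0 u \<noteq> 0" using ball_weight_0_nonzero[OF \<alpha>, of 1 u] u by simp
      ultimately show ?thesis by auto
    qed
    from vanish have "AE u in lborel. u \<notin> {0<..<1/2::real}"
      by eventually_elim (use pos in blast)
    then have "emeasure lborel {0<..<1/2::real} = 0"
      by (intro AE_iff_null_sets[THEN iffD2, THEN null_setsD1]) auto
    then show False by simp
  qed
  with I0 have Ipos: "0 < I" by simp
  show ?thesis
  proof (rule that[of "I powr (1 / s)"])
    show "0 < I powr (1 / s)" using Ipos by simp
    have "ennreal (I powr (1 / s)) = ennreal (1 powr (dunkl_dim \<alpha> * (1 / t - 1 / s)) *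
         (LINT y:ball 0 1|?M. dunkl_translation \<alpha> 0 (\<lambda>z. norm (?K z) powr s) y) powr (1 / s))"
      by (simp add: I_def h_def)
    also have "\<dots> \<le> dunkl_morrey_norm \<alpha> s t ?K"
      unfolding dunkl_morrey_norm_def by (rule SUP_upper2[of 1], simp, rule SUP_upper2[of 0]) simp_all
    finally show "ennreal (I powr (1 / s)) \<le> dunkl_morrey_norm \<alpha> s t ?K" .
  qed
qed

theorem theorem4p2:
  fixes \<alpha> \<beta> \<gamma> p s t t' \<nu> C\<^sub>0 q :: real and \<phi> \<psi> :: "real \<Rightarrow> real"
  assumes "\<alpha> \<ge> - 1 / 2"
    and "0 < \<beta>" and "\<beta> < dunkl_dim \<alpha>"
    and "\<gamma> > 0"
    and "1 < p"
    and "dunkl_dim \<alpha> / (dunkl_dim \<alpha> + \<gamma> - \<beta>) < s"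
    and "1 \<le> s" and "s \<le> t"
    and "t < dunkl_dim \<alpha> / (dunkl_dim \<alpha> - \<beta>)"
    and "\<And>r. r > 0 \<Longrightarrow> \<phi> r > 0"
    and "\<phi> \<in> borel_measurable (lebesgue_on {0<..})"
    and "almost_decreasing \<phi>"
    and "almost_increasing (\<lambda>r. r powr (dunkl_dim \<alpha> / p) * \<phi> r)"
    and "\<nu> < - \<beta>" and "C\<^sub>0 > 0"
    and "\<And>r. r > 0 \<Longrightarrow> \<phi> r \<le> C\<^sub>0 * r powr \<nu>"
    and "t \<noteq> 1 \<Longrightarrow> 1 / t + 1 / t' = 1"
    and "q = (if t = 1 then p else \<nu> * t' * p / (\<nu> * t' + dunkl_dim \<alpha>))"
    and "\<psi> = (\<lambda>r. \<phi> r powr (p / q))"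
  shows "\<exists>C>0. \<forall>f \<in> gen_dunkl_morrey_space \<alpha> p \<phi>.
           (AE x in dunkl_measure \<alpha>.
              integrable (dunkl_measure \<alpha>) (bessel_riesz_integrand \<alpha> \<beta> \<gamma> f x)) \<and>
           bessel_riesz_operator \<alpha> \<beta> \<gamma> f \<in> gen_dunkl_morrey_space \<alpha> q \<psi> \<and>
           gen_dunkl_morrey_norm \<alpha> q \<psi> (bessel_riesz_operator \<alpha> \<beta> \<gamma> f)
             \<le> ennreal C * dunkl_morrey_norm \<alpha> s t (bessel_riesz_kernel \<alpha> \<beta> \<gamma>)
                 * gen_dunkl_morrey_norm \<alpha> p \<phi> f"
proof -
  let ?d = "dunkl_dim \<alpha>" and ?M = "dunkl_measure \<alpha>"
  have \<alpha>: "\<alpha> \<ge> -1/2" using assms(1) by simp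
  have d: "0 < ?d" using \<alpha> by (simp add: dunkl_dim_def)
  have t: "1 \<le> t" using assms by simp
  have p: "1 < p" and \<gamma>: "0 \<le> \<gamma>" using assms by simp_all
  note phi = assms(10) and phi_nu = assms(16)
  define b where "b = ?d * (1 - 1 / t)"
  have b0: "0 \<le> b" using t d by (simp add: b_def)
  have b\<beta>: "b < \<beta>"
  proof -
    have "t * (?d - \<beta>) < ?d" using assms(9,3) by (simp add: pos_less_divide_eq)
    then have "?d - \<beta> < ?d / t" using t by (simp add: field_simps)
    then show ?thesis by (simp add: b_def algebra_simps)
  qed
  have b\<gamma>: "\<beta> - \<gamma> < b"
  proof -
    have pos: "0 < ?d + \<gamma> - \<beta>" using assms by simp
    have "?d < t * (?d + \<gamma> - \<beta>)"
    proof -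
      have "?d < s * (?d + \<gamma> - \<beta>)" using assms(6) pos by (simp add: pos_divide_less_eq)
      also have "\<dots> \<le> t * (?d + \<gamma> - \<beta>)" using assms(8) pos by (intro mult_right_mono) auto
      finally show ?thesis .
    qed
    then have "?d / t < ?d + \<gamma> - \<beta>" using t by (simp add: field_simps)
    then show ?thesis by (simp add: b_def algebra_simps)
  qed
  have nub: "\<nu> + b < 0" using b\<beta> assms(14) by simp
  \<comment> \<open>Since \<open>b = d / t'\<close> for \<open>t \<noteq> 1\<close> and \<open>b = 0\<close> for \<open>t = 1\<close>, one formula covers both cases.\<close>
  have q: "q = \<nu> * p / (\<nu> + b)"
  proof (cases "t = 1")
    case True
    then show ?thesis using assms(18) nub by (simp add: b_def)
  next
    case False
    with t have t1: "1 < t" by simp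
    have e: "1 / t' = 1 - 1 / t" using assms(17)[OF False] by simp
    have "1 / t < 1" using t1 by simp
    with e have "0 < 1 / t'" by linarith
    then have t': "0 < t'" by simp
    have bt: "b = ?d / t'" unfolding b_def e[symmetric] by simp
    have "t' * b = ?d" using bt t' by simp
    then have "\<nu> * t' + ?d = t' * (\<nu> + b)" by (simp add: algebra_simps)
    then have "\<nu> * t' * p / (\<nu> * t' + ?d) = (t' * (\<nu> * p)) / (t' * (\<nu> + b))"
      by (simp only: mult_ac)
    also have "\<dots> = \<nu> * p / (\<nu> + b)" using t' by simp
    finally show ?thesis using assms(18) False by simp
  qed
  have qb: "q * (\<nu> + b) = \<nu> * p" using q nub by simp
  have bq: "b * q + \<nu> * (q - p) = 0" using qb by (simp add: algebra_simps)
  have pq: "p \<le> q"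
  proof -
    have "q * (\<nu> + b) \<le> p * (\<nu> + b)" using qb b0 p by (simp add: algebra_simps)
    then show ?thesis using nub by simp
  qed
  have q1: "1 < q" using p pq by simp
  obtain D0 where D0: "0 < D0" "\<And>r s. 0 < r \<Longrightarrow> r \<le> s \<Longrightarrow> D0 * \<phi> s \<le> \<phi> r"
    using assms(12) unfolding almost_decreasing_def by blast
  define D where "D = 1 / D0"
  have D: "0 < D" "\<And>r s. 0 < r \<Longrightarrow> r \<le> s \<Longrightarrow> \<phi> s \<le> D * \<phi> r"
    using D0 by (auto simp: D_def field_simps)
  have "s * (?d - \<beta>) < ?d"
  proof -
    have "s * (?d - \<beta>) \<le> t * (?d - \<beta>)" using assms by (intro mult_right_mono) auto
    also have "\<dots> < ?d" using assms(9,3) by (simp add: pos_less_divide_eq)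
    finally show ?thesis .
  qed
  then obtain k where k: "0 < k" "ennreal k \<le> dunkl_morrey_norm \<alpha> s t (bessel_riesz_kernel \<alpha> \<beta> \<gamma>)"
    using kernel_morrey_norm_pos[OF \<alpha> assms(7) _ \<gamma>] by metis
  show ?thesis
  proof (cases rule: bessel_riesz_weighted_bound[OF \<alpha> assms(3) b\<beta> b\<gamma> \<gamma> p pq assms(15) D(1) bq])
  case C: (1 C)
  show ?thesis
  proof (intro exI[of _ "C powr (1 / q) / k"] conjI ballI)
    show "0 < C powr (1 / q) / k" using C k by simp
    fix f :: "real \<Rightarrow> complex" assume f: "f \<in> gen_dunkl_morrey_space \<alpha> p \<phi>"
    define N where "N = enn2real (gen_dunkl_morrey_norm \<alpha> p \<phi> f)"
    have N: "gen_dunkl_morrey_norm \<alpha> p \<phi> f = ennreal N" "0 \<le> N"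
      using f by (auto simp: N_def gen_dunkl_morrey_space_def)
    have fm: "f \<in> borel_measurable borel" and floc: "locally_finite \<alpha> (\<lambda>u. norm (f u) powr p)"
      using f by (auto simp: gen_dunkl_morrey_space_def locally_p_integrable_iff)
    have hm: "(\<lambda>u. norm (f u) powr p) \<in> borel_measurable borel" using fm by measurable
    have bound: "ball_integral \<alpha> r (\<lambda>y. ennreal (norm (f y) powr p)) x \<le> ennreal ((N * \<phi> r) powr p * r powr ?d)"
      if r: "0 < r" for x r
    proof -
      define L where "L = (LINT y:ball 0 r|?M. dunkl_translation \<alpha> (- x) (\<lambda>z. norm (f z) powr p) y)"
      have L: "ennreal L = ball_integral \<alpha> r (\<lambda>y. ennreal (norm (f y) powr p)) x" "0 \<le> L"
        using dunkl_duality(2,3)[OF \<alpha> hm _ floc r, of "- x"] by (simp_all add: L_def)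
      have "ennreal (1 / \<phi> r * (1 / r powr ?d * L) powr (1 / p)) \<le> ennreal N"
        unfolding N(1)[symmetric] gen_dunkl_morrey_norm_def L_def
        by (rule SUP_upper2[of r], use r in simp, rule SUP_upper2[of "- x"]) simp_all
      then have "1 / \<phi> r * (1 / r powr ?d * L) powr (1 / p) \<le> N" using N(2) by simp
      then have "(1 / r powr ?d * L) powr (1 / p) \<le> N * \<phi> r" using phi[OF r] by (simp add: field_simps)
      then have "((1 / r powr ?d * L) powr (1 / p)) powr p \<le> (N * \<phi> r) powr p" using p by (intro powr_mono2) auto
      then have "1 / r powr ?d * L \<le> (N * \<phi> r) powr p" using p L(2) by (simp add: powr_powr)
      then have "L \<le> (N * \<phi> r) powr p * r powr ?d" using r by (simp add: field_simps)
      then show ?thesis unfolding L(1)[symmetric] by (rule ennreal_leI)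
    qed
    let ?g = "bessel_riesz_operator \<alpha> \<beta> \<gamma> f"
    from C(2)[of f N \<phi>, OF fm N(2) phi phi_nu D(2) bound]
    have AE: "AE x in ?M. integrable ?M (bessel_riesz_integrand \<alpha> \<beta> \<gamma> f x)"
      and gb: "\<And>z r. 0 < r \<Longrightarrow> ball_integral \<alpha> r (\<lambda>x. ennreal (norm (?g x) powr q)) z
        \<le> ennreal (C * (N powr q * \<phi> r powr p * r powr ?d))" by blast+
    show "AE x in ?M. integrable ?M (bessel_riesz_integrand \<alpha> \<beta> \<gamma> f x)" by (rule AE)
    have gm: "?g \<in> borel_measurable borel" by (rule measurable_bessel_riesz_operator[OF fm])
    have gqm: "(\<lambda>u. norm (?g u) powr q) \<in> borel_measurable borel" using gm by measurable
    have gloc: "locally_finite \<alpha> (\<lambda>u. norm (?g u) powr q)"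
      by (rule locally_finite_if_weighted_finite[OF \<alpha> gqm]) (rule le_less_trans[OF gb], simp_all)
    have norm_le: "gen_dunkl_morrey_norm \<alpha> q \<psi> ?g \<le> ennreal (C powr (1 / q) * N)"
      unfolding gen_dunkl_morrey_norm_def
    proof (intro SUP_least ennreal_leI)
      fix r x :: real assume "r \<in> {0<..}"
      then have r: "0 < r" by simp
      define L where "L = (LINT y:ball 0 r|?M. dunkl_translation \<alpha> x (\<lambda>z. norm (?g z) powr q) y)"
      have L: "ennreal L = ball_integral \<alpha> r (\<lambda>y. ennreal (norm (?g y) powr q)) (- x)" "0 \<le> L"
        using dunkl_duality(2,3)[OF \<alpha> gqm _ gloc r, of x] by (simp_all add: L_def)
      have "L \<le> C * (N powr q * \<phi> r powr p * r powr ?d)"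
        using gb[OF r, of "- x"] C N unfolding L(1)[symmetric] by (subst (asm) ennreal_le_iff) auto
      then have "1 / r powr ?d * L \<le> C * N powr q * \<phi> r powr p" using r by (simp add: field_simps)
      then have "(1 / r powr ?d * L) powr (1 / q) \<le> (C * N powr q * \<phi> r powr p) powr (1 / q)"
        using q1 L(2) by (intro powr_mono2) auto
      also have "\<dots> = C powr (1 / q) * N * \<psi> r"
        using C N q1 phi[OF r] by (simp add: powr_mult powr_powr assms(19))
      finally show "1 / \<psi> r * (1 / r powr ?d * (LINT y:ball 0 r|?M. dunkl_translation \<alpha> x (\<lambda>z. norm (?g z) powr q) y)) powr (1 / q) \<le> C powr (1 / q) * N"
        using phi[OF r] unfolding L_def[symmetric] by (simp add: assms(19) field_simps)
    qed
    show "?g \<in> gen_dunkl_morrey_space \<alpha> q \<psi>"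
      unfolding gen_dunkl_morrey_space_def locally_p_integrable_iff
      using gm gloc le_less_trans[OF norm_le] by simp
    have "gen_dunkl_morrey_norm \<alpha> q \<psi> ?g \<le> ennreal (C powr (1 / q) / k) * ennreal k * ennreal N"
      using norm_le C k N by (simp flip: ennreal_mult)
    also have "\<dots> \<le> ennreal (C powr (1 / q) / k) * dunkl_morrey_norm \<alpha> s t (bessel_riesz_kernel \<alpha> \<beta> \<gamma>) * ennreal N"
      by (intro mult_right_mono mult_left_mono k) auto
    finally show "gen_dunkl_morrey_norm \<alpha> q \<psi> ?g
             \<le> ennreal (C powr (1 / q) / k) * dunkl_morrey_norm \<alpha> s t (bessel_riesz_kernel \<alpha> \<beta> \<gamma>)
                 * gen_dunkl_morrey_norm \<alpha> p \<phi> f" unfolding N(1) .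
  qed
  qed
qed

end
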